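(* Let $n\ge 2$, $\alpha=(n-3)/2$ and $-1<t<1$. Then $m(t)=\min\{P_k^{(\alpha,\alpha)}(t): k=0,1,2,\dots\}$ exists, and the optimal value of the linear program $$\max\Big\{\omega_n^2 f_0\ :\ f_k\ge 0\ (k=0,1,\dots),\ \sum_{k=0}^\infty f_k=1/\omega_n,\ f_0+\sum_{k=1}^\infty f_kP_k^{(\alpha,\alpha)}(t)=0\Big\}$$ (which equals $\vartheta(G(n,t))$) is $$\vartheta(G(n,t))=\omega_n\,\frac{m(t)}{m(t)-1}.$$
   Context: $P_k^{(\alpha,\beta)}$ denotes the Jacobi polynomial of degree $k$, orthogonal on $[-1,1]$ for the weight $(1-u)^\alpha(1+u)^\beta$, normalized by $P_k^{(\alpha,\beta)}(1)=1$. $\omega_n=2\pi^{n/2}/\Gamma(n/2)$ is the surface area of $S^{n-1}$. $\vartheta(G(n,t))$ is the supremum of $\int_{S^{n-1}}\int_{S^{n-1}}K(x,y)\,d\omega(x)d\omega(y)$ over continuous symmetric positive kernels $K$ on $S^{n-1}\times S^{n-1}$ with $\int K(x,x)\,d\omega(x)=1$ and $K(x,y)=0$ whenever $x\cdot y=t$ ($\omega$ = surface measure).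
   Formalization: For n=2 with arccos(t)/π irrational the minimum does not exist (P_k(t)=cos(kθ) has unattained infimum −1), so m(t) is taken as the infimum and the LP value as a supremum; that both are attained is claimed for n≥3, or n=2 with arccos(t)/π rational. *)

theory Defs
  imports "HOL-Analysis.Analysis" "HOL-Computational_Algebra.Polynomial"
begin

definition jacobi_weight :: "real \<Rightarrow> real \<Rightarrow> real \<Rightarrow> real" where
  "jacobi_weight \<alpha> \<beta> u = (1 - u) powr \<alpha> * (1 + u) powr \<beta>"

definition is_jacobi_poly :: "real \<Rightarrow> real \<Rightarrow> nat \<Rightarrow> real poly \<Rightarrow> bool" where
  "is_jacobi_poly \<alpha> \<beta> k p \<longleftrightarrow>
     degree p = k \<and>
     (\<forall>q. degree q < k \<longrightarrow>
        (LINT u:{-1..1}|lborel. jacobi_weight \<alpha> \<beta> u * (poly p u * poly q u)) = 0) \<and>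
     poly p 1 = 1"

text \<open>
  The normalization is \<open>P\<^sub>k(1) = 1\<close>, not the classical
  \<open>P\<^sub>k(1) = (k + \<alpha>) gchoose k\<close>.  For \<open>\<alpha>, \<beta> > -1\<close> the description is proper
  (theorem \<open>ex1_jacobi_poly\<close> below).
\<close>

definition jacobi_poly :: "real \<Rightarrow> real \<Rightarrow> nat \<Rightarrow> real poly" where
  "jacobi_poly \<alpha> \<beta> k = (THE p. is_jacobi_poly \<alpha> \<beta> k p)"

definition sphere_area :: "nat \<Rightarrow> real" where
  "sphere_area n = 2 * pi powr (real n / 2) / Gamma (real n / 2)"

text \<open>
  Surface measure on the unit sphere, as the cone measure
  \<open>\<omega>(A) = n * vol {r x | x \<in> A, 0 < r < 1}\<close>; this is the measure \<open>\<omega>\<close> of the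
  polar coordinates formula \<open>dx = r^(n-1) dr d\<omega>\<close>.  Note that \<open>sgn x = x /\<^sub>R norm x\<close>.
  Its total mass is \<open>sphere_area n\<close> (theorem \<open>emeasure_surface_measure_sphere\<close> below).
\<close>

definition surface_measure :: "'a::euclidean_space measure" where
  "surface_measure =
     scale_measure (of_nat DIM('a))
       (distr (restrict_space lborel (ball 0 1 - {0})) (restrict_space borel (sphere 0 1)) sgn)"

definition positive_kernel_on :: "'a set \<Rightarrow> ('a \<Rightarrow> 'a \<Rightarrow> real) \<Rightarrow> bool" where
  "positive_kernel_on S K \<longleftrightarrow>
     (\<forall>(N::nat) (x::nat \<Rightarrow> 'a) (c::nat \<Rightarrow> real). (\<forall>i<N. x i \<in> S) \<longrightarrow>
        0 \<le> (\<Sum>i<N. \<Sum>j<N. c i * c j * K (x i) (x j)))"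

text \<open>
  Kernels are functions on the whole space of which only the values on the sphere matter:
  \<open>surface_measure\<close> is a measure with space \<open>sphere 0 1\<close>.
\<close>

definition theta_feasible :: "real \<Rightarrow> ('a::euclidean_space \<Rightarrow> 'a \<Rightarrow> real) \<Rightarrow> bool" where
  "theta_feasible t K \<longleftrightarrow>
     continuous_on (sphere 0 1 \<times> sphere 0 1) (\<lambda>(x, y). K x y) \<and>
     (\<forall>x \<in> sphere 0 1. \<forall>y \<in> sphere 0 1. K x y = K y x) \<and>
     positive_kernel_on (sphere 0 1) K \<and>
     (LINT x|surface_measure. K x x) = 1 \<and>
     (\<forall>x \<in> sphere 0 1. \<forall>y \<in> sphere 0 1. x \<bullet> y = t \<longrightarrow> K x y = 0)"

text \<open>
  The suprema are taken in the extended reals, so that an equation with a finite value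
  includes the claims that the feasible set is nonempty and the objective bounded.
\<close>

definition theta_sphere :: "'a::euclidean_space itself \<Rightarrow> real \<Rightarrow> ereal" where
  "theta_sphere _ t =
     (SUP K \<in> {K :: 'a \<Rightarrow> 'a \<Rightarrow> real. theta_feasible t K}.
        ereal (LINT x|surface_measure. (LINT y|surface_measure. K x y)))"

definition lp_feasible :: "nat \<Rightarrow> real \<Rightarrow> (nat \<Rightarrow> real) \<Rightarrow> bool" where
  "lp_feasible n t f \<longleftrightarrow>
     (let \<alpha> = (real n - 3) / 2 in
       (\<forall>k. 0 \<le> f k) \<and>
       f sums (1 / sphere_area n) \<and>
       summable (\<lambda>k. f (Suc k) * poly (jacobi_poly \<alpha> \<alpha> (Suc k)) t) \<and>
       f 0 + (\<Sum>k. f (Suc k) * poly (jacobi_poly \<alpha> \<alpha> (Suc k)) t) = 0)"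

definition lp_objective :: "nat \<Rightarrow> (nat \<Rightarrow> real) \<Rightarrow> real" where
  "lp_objective n f = (sphere_area n)\<^sup>2 * f 0"

definition lp_value :: "nat \<Rightarrow> real \<Rightarrow> ereal" where
  "lp_value n t = (SUP f \<in> {f. lp_feasible n t f}. ereal (lp_objective n f))"


subsection \<open>Well-definedness of the Jacobi polynomials\<close>

lemma set_integrable_jacobi_weight:
  assumes "\<alpha> > -1" "\<beta> > -1"
  shows "set_integrable lborel {-1..1} (jacobi_weight \<alpha> \<beta>)"
proof -
  define g where "g = (\<lambda>t::real. t powr (\<beta> + 1 - 1) * (1 - t) powr (\<alpha> + 1 - 1))"
  have "integrable lborel (\<lambda>t. indicator {0..1} t *\<^sub>R g t)"
    using integrable_Beta[of "\<beta> + 1" "\<alpha> + 1"] assms by (simp add: set_integrable_def g_def)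
  then have "integrable lborel (\<lambda>u. indicator {0..1} (1/2 + (1/2) * u) *\<^sub>R g (1/2 + (1/2) * u))"
    by (rule lborel_integrable_real_affine) simp
  then have "integrable lborel (\<lambda>u. (2 powr \<alpha> * 2 powr \<beta>) *
               (indicator {0..1} (1/2 + (1/2) * u) *\<^sub>R g (1/2 + (1/2) * u)))"
    by (rule integrable_mult_right)
  also have "(\<lambda>u. (2 powr \<alpha> * 2 powr \<beta>) * (indicator {0..1} (1/2 + (1/2) * u) *\<^sub>R g (1/2 + (1/2) * u)))
      = (\<lambda>u. indicator {-1..1} u *\<^sub>R jacobi_weight \<alpha> \<beta> u)"
  proof
    fix u :: real
    have "(2 powr \<alpha> * 2 powr \<beta>) * g (1/2 + (1/2) * u) = jacobi_weight \<alpha> \<beta> u" if "u \<in> {-1..1}"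
    proof -
      have "(1 - u) powr \<alpha> = 2 powr \<alpha> * (1 - (1/2 + (1/2) * u)) powr \<alpha>"
        by (subst powr_mult [symmetric]) (use that in \<open>simp_all add: algebra_simps\<close>)
      moreover have "(1 + u) powr \<beta> = 2 powr \<beta> * (1/2 + (1/2) * u) powr \<beta>"
        by (subst powr_mult [symmetric]) (use that in \<open>simp_all add: algebra_simps\<close>)
      ultimately show ?thesis by (simp add: jacobi_weight_def g_def)
    qed
    then show "(2 powr \<alpha> * 2 powr \<beta>) * (indicator {0..1} (1/2 + (1/2) * u) *\<^sub>R g (1/2 + (1/2) * u))
      = indicator {-1..1} u *\<^sub>R jacobi_weight \<alpha> \<beta> u"
      by (auto simp: indicator_def)
  qed
  finally show ?thesis by (simp add: set_integrable_def)
qed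

lemma set_integrable_jacobi_weight_poly:
  assumes "\<alpha> > -1" "\<beta> > -1"
  shows "set_integrable lborel {-1..1} (\<lambda>u. jacobi_weight \<alpha> \<beta> u * poly p u)"
proof -
  have "compact (poly p ` {-1..1})"
    by (intro compact_continuous_image continuous_intros) auto
  then have "bounded (poly p ` {-1..1})" by (rule compact_imp_bounded)
  then obtain C where "\<forall>y \<in> poly p ` {-1..1}. norm y \<le> C" unfolding bounded_iff by blast
  then have C: "\<bar>poly p u\<bar> \<le> C" if "u \<in> {-1..1}" for u
    using that by (metis imageI real_norm_def)
  have "set_integrable lborel {-1..1} (\<lambda>u. C * jacobi_weight \<alpha> \<beta> u)"
    using set_integrable_jacobi_weight[OF assms] by auto
  then show ?thesis
  proof (rule set_integrable_bound)
    show "set_borel_measurable lborel {-1..1} (\<lambda>u. jacobi_weight \<alpha> \<beta> u * poly p u)"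
      unfolding set_borel_measurable_def jacobi_weight_def
      using borel_measurable_continuous_onI[OF continuous_on_poly[OF continuous_on_id], of p] by simp
    show "AE u in lborel. u \<in> {-1..1} \<longrightarrow>
            norm (jacobi_weight \<alpha> \<beta> u * poly p u) \<le> norm (C * jacobi_weight \<alpha> \<beta> u)"
    proof (intro AE_I2 impI)
      fix u :: real assume u: "u \<in> {-1..1}"
      have "0 \<le> C" using C[OF u] by linarith
      have "0 \<le> jacobi_weight \<alpha> \<beta> u" by (simp add: jacobi_weight_def)
      with C[OF u] \<open>0 \<le> C\<close> show "norm (jacobi_weight \<alpha> \<beta> u * poly p u) \<le> norm (C * jacobi_weight \<alpha> \<beta> u)"
        by (simp add: abs_mult mult.commute[of C] mult_left_mono)
    qed
  qed
qed

lemma jacobi_integral_pos_def: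
  assumes ab: "\<alpha> > -1" "\<beta> > -1"
    and nonneg: "\<And>u. u \<in> {-1..1} \<Longrightarrow> 0 \<le> poly r u"
    and zero: "(LINT u:{-1..1}|lborel. jacobi_weight \<alpha> \<beta> u * poly r u) = 0"
  shows "r = 0"
proof (rule ccontr)
  assume "r \<noteq> 0"
  then have fin: "finite ({u. poly r u = 0} \<union> {-1, 1})"
    by (simp add: poly_roots_finite)
  have "AE u in lborel. indicator {-1..1} u *\<^sub>R (jacobi_weight \<alpha> \<beta> u * poly r u) = 0"
    using set_integrable_jacobi_weight_poly[OF ab, of r] zero nonneg
    unfolding set_integrable_def set_lebesgue_integral_def
    by (subst (asm) integral_nonneg_eq_0_iff_AE)
       (auto simp: indicator_def jacobi_weight_def split: if_splits)
  moreover have "AE u in lborel. u \<notin> {u. poly r u = 0} \<union> {-1, 1}"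
    using fin by (intro AE_not_in finite_imp_null_set_lborel)
  ultimately have "AE u in lborel. u \<notin> {-1..1::real}"
  proof eventually_elim
    case (elim u)
    show ?case
    proof
      assume "u \<in> {-1..1}"
      then have "jacobi_weight \<alpha> \<beta> u > 0"
        using elim by (auto simp: jacobi_weight_def)
      then show False using elim \<open>u \<in> {-1..1}\<close> by auto
    qed
  qed
  then have "emeasure lborel {-1..1::real} = 0"
    by (subst (asm) AE_iff_measurable[of "{-1..1}"]) auto
  then show False by simp
qed

theorem ex1_jacobi_poly:
  assumes ab: "\<alpha> > -1" "\<beta> > -1"
  shows "\<exists>!p. is_jacobi_poly \<alpha> \<beta> k p"
proof -
  define B where "B = (\<lambda>r. (LINT u:{-1..1}|lborel. jacobi_weight \<alpha> \<beta> u * poly r u))"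
  note int = set_integrable_jacobi_weight_poly[OF ab]
  have B_add: "B (p + q) = B p + B q" for p q
    using set_integral_add(2)[OF int[of p] int[of q]] by (simp add: B_def algebra_simps)
  have B_smult: "B (smult c p) = c * B p" for c p
  proof -
    have "B (smult c p) = (LINT u:{-1..1}|lborel. c * (jacobi_weight \<alpha> \<beta> u * poly p u))"
      by (simp add: B_def mult.left_commute)
    then show ?thesis by (simp only: B_def set_integral_mult_right)
  qed
  have B_diff: "B (p - q) = B p - B q" for p q
    using B_add[of p "smult (-1) q"] B_smult[of "-1" q] by simp
  have B_0: "B 0 = 0" using B_smult[of 0 0] by simp
  have B_sum: "B (\<Sum>i\<in>I. f i) = (\<Sum>i\<in>I. B (f i))" if "finite I" for I :: "nat set" and f
    using that by (induction I rule: finite_induct) (simp_all add: B_0 B_add)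
  have B_pos: "r = 0" if "\<And>u. u \<in> {-1..1} \<Longrightarrow> 0 \<le> poly r u" "B r = 0" for r
    using jacobi_integral_pos_def[OF ab that[unfolded B_def]] .
  have B_sq: "p = 0" if "B (p * p) = 0" for p
    using B_pos[of "p * p"] that by simp
  define orth where "orth = (\<lambda>k p. degree p = k \<and> p \<noteq> 0 \<and> (\<forall>q. degree q < k \<longrightarrow> B (p * q) = 0))"
  have J: "is_jacobi_poly \<alpha> \<beta> k p \<longleftrightarrow> orth k p \<and> poly p 1 = 1" for k p
    by (auto simp: is_jacobi_poly_def orth_def B_def)
  have red: "\<exists>c. r - smult c p = 0 \<or> degree (r - smult c p) < degree p"
    if "degree r \<le> degree p" "p \<noteq> 0" for r p :: "real poly"
  proof (rule exI)
    define c where "c = coeff r (degree p) / lead_coeff p"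
    have "coeff (r - smult c p) (degree p) = 0"
      using that by (simp add: c_def)
    moreover have "degree (r - smult c p) \<le> degree p"
      using that degree_diff_le[of r "degree p" "smult c p"] degree_smult_le[of c p] by simp
    ultimately show "r - smult c p = 0 \<or> degree (r - smult c p) < degree p"
      by (metis le_neq_implies_less leading_coeff_0_iff)
  qed
  have ex: "\<exists>p. orth k p" for k
  proof (induction k rule: less_induct)
    case (less k)
    then obtain e where e: "\<And>j. j < k \<Longrightarrow> orth j (e j)" by metis
    define m :: "real poly" where "m = monom 1 k"
    define s where "s = (\<Sum>j<k. smult (B (m * e j) / B (e j * e j)) (e j))"
    define p where "p = m - s"
    have ds: "s = 0 \<or> degree s < k"
    proof (cases "k = 0")
      case False
      then have "degree s < k" unfolding s_def
        using e by (intro degree_sum_less) (auto simp: orth_def intro: le_less_trans[OF degree_smult_le])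
      then show ?thesis ..
    qed (simp add: s_def)
    have "coeff p k = 1"
      using ds by (auto simp: p_def m_def coeff_eq_0)
    moreover have "degree p \<le> k"
      unfolding p_def m_def using ds by (intro degree_diff_le) (auto simp: degree_monom_le)
    ultimately have p: "degree p = k" "p \<noteq> 0"
      by (metis le_antisym le_degree zero_neq_one) (use \<open>coeff p k = 1\<close> in auto)
    have orth_e: "B (e i * e j) = 0" if "i < k" "j < k" "i \<noteq> j" for i j
    proof (cases "j < i")
      case True then show ?thesis using e[OF that(1)] e[OF that(2)] by (simp add: orth_def)
    next
      case False then show ?thesis
        using e[OF that(1)] e[OF that(2)] that by (simp add: orth_def mult.commute[of "e i"])
    qed
    have pe: "B (p * e j) = 0" if j: "j < k" for j
    proof -
      have "B (e j * e j) \<noteq> 0" using B_sq e[OF j] by (auto simp: orth_def)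
      have "B (s * e j) = (\<Sum>i<k. B (m * e i) / B (e i * e i) * B (e i * e j))"
        unfolding s_def by (simp add: sum_distrib_right B_sum B_smult)
      also have "\<dots> = (\<Sum>i\<in>{j}. B (m * e i) / B (e i * e i) * B (e i * e j))"
        using j orth_e by (intro sum.mono_neutral_right) auto
      also have "\<dots> = B (m * e j)" using \<open>B (e j * e j) \<noteq> 0\<close> by simp
      finally show ?thesis by (simp add: p_def left_diff_distrib B_diff)
    qed
    have "degree q < k \<Longrightarrow> B (p * q) = 0" for q
    proof (induction "degree q" arbitrary: q rule: less_induct)
      case (less q)
      let ?e = "e (degree q)"
      have e': "degree ?e = degree q" "?e \<noteq> 0" using e[OF less.prems] by (auto simp: orth_def)
      then obtain c where c: "q - smult c ?e = 0 \<or> degree (q - smult c ?e) < degree q"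
        using red[of q ?e] by auto
      have "B (p * (q - smult c ?e)) = 0"
        using c less by (auto simp: B_0)
      then show ?case
        using pe[OF less.prems] by (simp add: right_diff_distrib B_diff B_smult)
    qed
    then show ?case using p by (auto simp: orth_def)
  qed
  have nz: "poly p 1 \<noteq> 0" if p: "orth k p" for k p
  proof
    assume "poly p 1 = 0"
    then obtain q where q: "p = [:-1, 1:] * q"
      by (auto simp: poly_eq_0_iff_dvd dvd_def)
    have "p \<noteq> 0" using p by (auto simp: orth_def)
    then have "q \<noteq> 0" using q by auto
    then have "degree p = Suc (degree q)"
      unfolding q by (subst degree_mult_eq) auto
    then have "B (p * q) = 0" using p by (auto simp: orth_def)
    then have "B (smult (-1) (p * q)) = 0" by (simp only: B_smult)
    moreover have "0 \<le> poly (smult (-1) (p * q)) u" if "u \<in> {-1..1}" for u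
    proof -
      have "poly (smult (-1) (p * q)) u = (1 - u) * (poly q u * poly q u)"
        by (simp add: q algebra_simps)
      then show ?thesis using that by simp
    qed
    ultimately have "smult (-1) (p * q) = 0" by (intro B_pos)
    then show False using \<open>p \<noteq> 0\<close> \<open>q \<noteq> 0\<close> by simp
  qed
  show ?thesis
  proof (rule ex_ex1I)
    obtain p where p: "orth k p" using ex by blast
    have "orth k (smult (1 / poly p 1) p)"
      using p nz[OF p] by (auto simp: orth_def B_smult)
    moreover have "poly (smult (1 / poly p 1) p) 1 = 1" using nz[OF p] by simp
    ultimately show "\<exists>p. is_jacobi_poly \<alpha> \<beta> k p" using J by blast
  next
    fix p q assume "is_jacobi_poly \<alpha> \<beta> k p" "is_jacobi_poly \<alpha> \<beta> k q"
    then have p: "orth k p" "poly p 1 = 1" and q: "orth k q" "poly q 1 = 1" using J by blast+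
    obtain c where c: "p - smult c q = 0 \<or> degree (p - smult c q) < k"
    proof -
      have "degree p \<le> degree q" "q \<noteq> 0" "degree q = k" using p(1) q(1) unfolding orth_def by simp_all
      then show thesis using red[of p q] that by blast
    qed
    have kill: "B (r * (p - smult c q)) = 0" if "orth k r" for r
      using c
    proof
      assume "p - smult c q = 0"
      then show ?thesis by (simp only: mult_zero_right B_0)
    next
      assume "degree (p - smult c q) < k"
      then show ?thesis using that unfolding orth_def by blast
    qed
    have "(p - smult c q) * (p - smult c q) = p * (p - smult c q) - smult c (q * (p - smult c q))"
      by (simp only: left_diff_distrib mult_smult_left)
    then have "B ((p - smult c q) * (p - smult c q)) = 0"
      by (simp only: B_diff B_smult kill[OF p(1)] kill[OF q(1)] mult_zero_right diff_zero)
    then have "p - smult c q = 0" by (rule B_sq)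
    then have pq: "p = smult c q" by simp
    then have "poly p 1 = c * poly q 1" by simp
    then have "c = 1" using p(2) q(2) by simp
    then show "p = q" using pq by simp
  qed
qed


subsection \<open>Total mass of the surface measure\<close>

theorem emeasure_surface_measure_sphere:
  "emeasure (surface_measure :: 'a::euclidean_space measure) (sphere 0 1) = ennreal (sphere_area DIM('a))"
proof -
  let ?n = "real DIM('a)"
  have sgn: "(sgn :: 'a \<Rightarrow> 'a) \<in> restrict_space lborel (ball 0 1 - {0}) \<rightarrow>\<^sub>M restrict_space borel (sphere 0 1)"
  proof (rule measurable_restrict_space2)
    show "sgn \<in> space (restrict_space lborel (ball 0 1 - {0::'a})) \<rightarrow> sphere 0 1"
      by (auto simp: space_restrict_space norm_sgn)
    have "(\<lambda>x::'a. x /\<^sub>R norm x) \<in> borel_measurable borel" by measurable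
    then show "sgn \<in> borel_measurable (restrict_space lborel (ball 0 1 - {0::'a}))"
      by (intro measurable_restrict_space1) (simp add: sgn_div_norm[abs_def])
  qed
  have "emeasure (distr (restrict_space lborel (ball 0 1 - {0::'a})) (restrict_space borel (sphere 0 1)) sgn)
          (sphere 0 1)
        = emeasure (restrict_space lborel (ball 0 1 - {0::'a})) (ball 0 1 - {0})"
    by (subst emeasure_distr[OF sgn])
       (auto simp: sets_restrict_space space_restrict_space norm_sgn intro!: arg_cong2[where f = emeasure])
  also have "\<dots> = emeasure lborel (ball 0 1 - {0::'a})"
    by (subst emeasure_restrict_space) auto
  also have "\<dots> = emeasure lborel (ball (0::'a) 1)"
    by (intro emeasure_Diff_null_set finite_imp_null_set_lborel) auto
  also have "\<dots> = ennreal (unit_ball_vol ?n)"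
    using emeasure_ball[of 1 "0::'a"] by simp
  finally have "emeasure (surface_measure :: 'a measure) (sphere 0 1) = of_nat DIM('a) * ennreal (unit_ball_vol ?n)"
    by (simp add: surface_measure_def)
  also have "\<dots> = ennreal (?n * unit_ball_vol ?n)"
    by (simp add: ennreal_mult ennreal_of_nat_eq_real_of_nat)
  also have "?n * unit_ball_vol ?n = sphere_area DIM('a)"
  proof -
    have pos: "?n / 2 > 0" by simp
    then have "?n / 2 \<notin> \<int>\<^sub>\<le>\<^sub>0" using nonpos_Ints_nonpos[of "?n / 2"] by linarith
    then have "Gamma (?n / 2 + 1) = ?n / 2 * Gamma (?n / 2)" by (rule Gamma_plus1)
    moreover have "Gamma (?n / 2) > 0" using pos by (rule Gamma_real_pos)
    ultimately show ?thesis by (simp only: unit_ball_vol_def sphere_area_def) (simp add: field_simps)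
  qed
  finally show ?thesis .
qed

end

theory Submission
  imports Defs
begin

text \<open>
  Write \<open>P k\<close> for the Jacobi polynomials and \<open>m\<close> for the infimum of the \<open>P k t\<close>.
  The translation operator that averages a zonal function over the parallel \<open>x \<bullet> e = t\<close> is symmetric
  and does not raise degrees, so it multiplies \<open>P k\<close> by \<open>P k t\<close> (product formula); hence the kernels
  \<open>P k (x \<bullet> y)\<close> are positive.
  Expand \<open>((1 + x \<bullet> y) / 2)\<^sup>N = (\<Sum>k. a k * P k (x \<bullet> y))\<close> with \<open>a k \<ge> 0\<close>.
  For a feasible \<open>K\<close>, the integral of \<open>K x y\<close> against
  \<open>(\<Sum>k. a k * (P k t - m) * P k (x \<bullet> y)) - a 0 * (1 - m)\<close> is nonnegative, because the summand with
  \<open>k = 0\<close> is cancelled. Divided by \<open>a 0\<close> and as \<open>N\<close> tends to infinity, the part with \<open>P k t\<close>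
  concentrates on \<open>x \<bullet> y = t\<close>, where \<open>K\<close> vanishes, and the part with \<open>m\<close> on the diagonal, where
  \<open>K\<close> has integral 1. This gives the upper bound; combinations \<open>f 0 + f k * P k (x \<bullet> y)\<close> with
  \<open>P k t < 0\<close> show that it is sharp. Such \<open>k\<close> exist, since otherwise \<open>a 0\<close> would be at most
  \<open>((1 + t) / 2)\<^sup>N\<close>. The infimum is attained for \<open>n \<ge> 3\<close> because \<open>P k t\<close> tends to 0, and
  for \<open>n = 2\<close> and rational angle because only finitely many values occur.
\<close>

subsection \<open>Means for the ultraspherical weight\<close>

text \<open>A feasible \<open>K\<close> need not depend on \<open>x \<bullet> y\<close> alone.
  Instead of averaging \<open>K\<close> over rotations and expanding it, the proof tests it against
  polynomials in \<open>x \<bullet> y\<close>, whose Jacobi expansions are finite; the price is the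
  limit in \<open>N\<close>. Powers of (1 + u) / 2 serve because Schur products make them positive
  kernels and because their means have consecutive quotients tending to 1, so geometrically small
  errors survive the division by \<open>a 0\<close>. No measure is put on the parallels. Translation
  is defined algebraically from moments, using the weight one dimension lower, and the link with the
  sphere is a comparison of moments: a coordinate on the sphere and the weight obey the same
  recursion. For n = 2 and irrational arccos t / pi the values are cos (k * arccos t), which come
  arbitrarily near -1 without reaching it. No minimum exists then; hence \<open>m\<close> is an
  infimum, attainment carries a side condition, and sharpness is reached through a limit of
  values.\<close>

definition jint :: "real \<Rightarrow> real poly \<Rightarrow> real" where
  "jint \<alpha> p = (LINT u:{-1..1}|lborel. jacobi_weight \<alpha> \<alpha> u * poly p u)"

definition gmean :: "real \<Rightarrow> real poly \<Rightarrow> real" where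
  "gmean \<alpha> p = jint \<alpha> p / jint \<alpha> 1"

lemma poly_as_sum_monom: "(p :: real poly) = (\<Sum>i\<le>degree p. smult (coeff p i) (monom 1 i))"
  using poly_as_sum_of_monoms[of p] by (simp add: smult_monom)

definition jcoeff :: "real \<Rightarrow> real poly \<Rightarrow> nat \<Rightarrow> real" where
  "jcoeff \<alpha> p k = gmean \<alpha> (p * jacobi_poly \<alpha> \<alpha> k) / gmean \<alpha> (jacobi_poly \<alpha> \<alpha> k * jacobi_poly \<alpha> \<alpha> k)"

context
  fixes \<alpha> :: real
  assumes alpha: "\<alpha> > -1"
begin

lemma jint_add: "jint \<alpha> (p + q) = jint \<alpha> p + jint \<alpha> q"
  using set_integral_add(2)[OF set_integrable_jacobi_weight_poly[OF alpha alpha, of p]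
      set_integrable_jacobi_weight_poly[OF alpha alpha, of q]]
  by (simp add: jint_def algebra_simps)

lemma jint_smult: "jint \<alpha> (smult c p) = c * jint \<alpha> p"
proof -
  have "jint \<alpha> (smult c p) = (LINT u:{-1..1}|lborel. c * (jacobi_weight \<alpha> \<alpha> u * poly p u))"
    by (simp add: jint_def mult.left_commute)
  then show ?thesis by (simp only: jint_def set_integral_mult_right)
qed

lemma jint_nonneg:
  assumes "\<And>u. u \<in> {-1..1} \<Longrightarrow> 0 \<le> poly p u"
  shows "0 \<le> jint \<alpha> p"
  unfolding jint_def set_lebesgue_integral_def
  by (rule integral_nonneg_AE) (use assms in \<open>auto simp: indicator_def jacobi_weight_def\<close>)

lemma jint_1_pos: "jint \<alpha> 1 > 0"
proof -
  have "jint \<alpha> 1 \<ge> 0" by (rule jint_nonneg) simp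
  moreover have "jint \<alpha> 1 \<noteq> 0"
    using jacobi_integral_pos_def[OF alpha alpha, of 1] by (auto simp: jint_def)
  ultimately show ?thesis by linarith
qed

lemma gmean_1 [simp]: "gmean \<alpha> 1 = 1"
  using jint_1_pos by (simp add: gmean_def)

lemma gmean_add: "gmean \<alpha> (p + q) = gmean \<alpha> p + gmean \<alpha> q"
  by (simp add: gmean_def jint_add add_divide_distrib)

lemma gmean_smult: "gmean \<alpha> (smult c p) = c * gmean \<alpha> p"
  by (simp add: gmean_def jint_smult)

lemma gmean_0 [simp]: "gmean \<alpha> 0 = 0"
  using gmean_smult[of 0 0] by simp

lemma gmean_diff: "gmean \<alpha> (p - q) = gmean \<alpha> p - gmean \<alpha> q"
  using gmean_add[of p "smult (-1) q"] gmean_smult[of "-1" q] by simp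

lemma gmean_sum: "gmean \<alpha> (\<Sum>i\<in>I. f i) = (\<Sum>i\<in>I. gmean \<alpha> (f i))"
  by (induction I rule: infinite_finite_induct) (simp_all add: gmean_add)

lemma gmean_nonneg:
  assumes "\<And>u. u \<in> {-1..1} \<Longrightarrow> 0 \<le> poly p u"
  shows "0 \<le> gmean \<alpha> p"
  using jint_nonneg[OF assms] jint_1_pos by (simp add: gmean_def)

lemma gmean_eq_0_imp:
  assumes "\<And>u. u \<in> {-1..1} \<Longrightarrow> 0 \<le> poly p u" "gmean \<alpha> p = 0"
  shows "p = 0"
  using jacobi_integral_pos_def[OF alpha alpha assms(1)] assms(2) jint_1_pos
  by (simp add: gmean_def jint_def)

lemma gmean_square_pos: "p \<noteq> 0 \<Longrightarrow> 0 < gmean \<alpha> (p * p)"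
  using gmean_eq_0_imp[of "p * p"] gmean_nonneg[of "p * p"] by fastforce

lemma gmean_le:
  assumes "\<And>u. u \<in> {-1..1} \<Longrightarrow> poly p u \<le> poly q u"
  shows "gmean \<alpha> p \<le> gmean \<alpha> q"
  using gmean_nonneg[of "q - p"] assms by (simp add: gmean_diff)

text \<open>Integration by parts: the left-hand side integrates the derivative of
  \<open>(1 - u\<^sup>2) powr (\<alpha> + 1) * q u\<close>, which vanishes at both end points.\<close>

lemma jint_by_parts: "jint \<alpha> ([:1, 0, -1:] * pderiv q - smult (2 * \<alpha> + 2) ([:0, 1:] * q)) = 0"
proof -
  let ?r = "[:1, 0, -1:] * pderiv q - smult (2 * \<alpha> + 2) ([:0, 1:] * q)"
  let ?F = "\<lambda>u. (1 - u) powr (\<alpha> + 1) * (1 + u) powr (\<alpha> + 1) * poly q u"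
  let ?f = "\<lambda>u. jacobi_weight \<alpha> \<alpha> u * poly ?r u"
  have "(?f has_integral (?F 1 - ?F (-1))) {-1..1}"
  proof (rule fundamental_theorem_of_calculus_interior)
    show "continuous_on {-1..1} ?F"
      using alpha by (intro continuous_intros continuous_on_powr') auto
  next
    fix u :: real assume u: "u \<in> {-1<..<1}"
    have pw: "(1 - u) powr (\<alpha> + 1) = (1 - u) * (1 - u) powr \<alpha>"
             "(1 + u) powr (\<alpha> + 1) = (1 + u) * (1 + u) powr \<alpha>"
      using u by (simp_all add: powr_add)
    have "((\<lambda>u. (1 - u) powr (\<alpha> + 1)) has_real_derivative (\<alpha> + 1) * (1 - u) powr \<alpha> * (-1)) (at u)"
         "((\<lambda>u. (1 + u) powr (\<alpha> + 1)) has_real_derivative (\<alpha> + 1) * (1 + u) powr \<alpha> * 1) (at u)"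
      using u by (auto intro!: derivative_eq_intros)
    from DERIV_mult[OF DERIV_mult[OF this] poly_DERIV[of q u]]
    have "(?F has_real_derivative ?f u) (at u)"
      by (rule DERIV_cong) (simp only: pw jacobi_weight_def, simp add: algebra_simps)
    then show "(?F has_vector_derivative ?f u) (at u)"
      by (simp add: has_real_derivative_iff_has_vector_derivative)
  qed simp
  then have "integral {-1..1} ?f = 0" using alpha by (auto dest!: integral_unique)
  then show ?thesis
    unfolding jint_def
    by (subst set_borel_integral_eq_integral(2)[OF set_integrable_jacobi_weight_poly[OF alpha alpha]])
qed

text \<open>Integration by parts with q = u^(k+1). For \<alpha> = (n - 3) / 2 the left factor is k +
  n, the one in \<open>sphere_moment_rec\<close>; this coincidence identifies the weight with the
  law of a coordinate on the sphere.\<close>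

lemma gmean_moment_rec:
  "(real k + 2 * \<alpha> + 3) * gmean \<alpha> (monom 1 (k + 2)) = (real k + 1) * gmean \<alpha> (monom 1 k)"
proof -
  have "[:1, 0, -1:] * pderiv (monom 1 (Suc k)) - smult (2 * \<alpha> + 2) ([:0, 1:] * monom 1 (Suc k))
      = smult (real k + 1) (monom 1 k) - smult (real k + 2 * \<alpha> + 3) (monom 1 (k + 2))"
    by (rule poly_eq_poly_eq_iff[THEN iffD1])
       (simp add: fun_eq_iff pderiv_monom poly_monom algebra_simps)
  with jint_by_parts[of "monom 1 (Suc k)"]
  have "gmean \<alpha> (smult (real k + 1) (monom 1 k) - smult (real k + 2 * \<alpha> + 3) (monom 1 (k + 2))) = 0"
    by (simp add: gmean_def)
  then show ?thesis by (simp add: gmean_diff gmean_smult)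
qed

lemma gmean_odd_moment: "odd k \<Longrightarrow> gmean \<alpha> (monom 1 k) = 0"
proof (induction k rule: less_induct)
  case (less k)
  show ?case
  proof (cases "k = 1")
    case True
    have "jint \<alpha> (smult (-(2 * \<alpha> + 2)) (monom 1 1)) = 0"
      using jint_by_parts[of 1] by (simp add: monom_altdef)
    then show ?thesis using alpha True by (simp add: jint_smult gmean_def)
  next
    case False
    then have "gmean \<alpha> (monom 1 (k - 2)) = 0" "k - 2 + 2 = k"
      using less.prems by (auto intro!: less.IH elim!: oddE)
    then have "(real (k - 2) + 2 * \<alpha> + 3) * gmean \<alpha> (monom 1 k) = 0"
      using gmean_moment_rec[of "k - 2"] by simp
    moreover have "real (k - 2) + 2 * \<alpha> + 3 > 0" using alpha by (simp add: add_pos_nonneg)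
    ultimately show ?thesis by simp
  qed
qed

section \<open>Orthogonality of the Jacobi polynomials and finite expansions\<close>

lemma jacobi_poly_spec: "is_jacobi_poly \<alpha> \<alpha> k (jacobi_poly \<alpha> \<alpha> k)"
  unfolding jacobi_poly_def by (rule theI'[OF ex1_jacobi_poly[OF alpha alpha]])

lemma degree_jacobi [simp]: "degree (jacobi_poly \<alpha> \<alpha> k) = k"
  and jacobi_at_1 [simp]: "poly (jacobi_poly \<alpha> \<alpha> k) 1 = 1"
  using jacobi_poly_spec[of k] by (simp_all add: is_jacobi_poly_def)

lemma jacobi_nonzero [simp]: "jacobi_poly \<alpha> \<alpha> k \<noteq> 0"
  using jacobi_at_1[of k] by force

lemma jacobi_orth_lower: "degree q < k \<Longrightarrow> gmean \<alpha> (jacobi_poly \<alpha> \<alpha> k * q) = 0"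
  using jacobi_poly_spec[of k] by (simp add: is_jacobi_poly_def gmean_def jint_def)

lemma jacobi_orth: "j \<noteq> k \<Longrightarrow> gmean \<alpha> (jacobi_poly \<alpha> \<alpha> j * jacobi_poly \<alpha> \<alpha> k) = 0"
  using jacobi_orth_lower[of "jacobi_poly \<alpha> \<alpha> j" k] jacobi_orth_lower[of "jacobi_poly \<alpha> \<alpha> k" j]
  by (metis degree_jacobi linorder_neqE_nat mult.commute)

lemma jacobi_0 [simp]: "jacobi_poly \<alpha> \<alpha> 0 = 1"
proof -
  obtain c where c: "jacobi_poly \<alpha> \<alpha> 0 = [:c:]"
    using degree_jacobi[of 0] by (metis degree_eq_zeroE)
  then show ?thesis using jacobi_at_1[of 0] by simp
qed

lemma jacobi_square_pos: "0 < gmean \<alpha> (jacobi_poly \<alpha> \<alpha> k * jacobi_poly \<alpha> \<alpha> k)"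
  by (simp add: gmean_square_pos)

lemma jcoeff_sum:
  assumes "k \<le> N"
  shows "jcoeff \<alpha> (\<Sum>j\<le>N. smult (c j) (jacobi_poly \<alpha> \<alpha> j)) k = c k"
proof -
  have "gmean \<alpha> ((\<Sum>j\<le>N. smult (c j) (jacobi_poly \<alpha> \<alpha> j)) * jacobi_poly \<alpha> \<alpha> k)
      = (\<Sum>j\<le>N. c j * gmean \<alpha> (jacobi_poly \<alpha> \<alpha> j * jacobi_poly \<alpha> \<alpha> k))"
    by (simp add: sum_distrib_right gmean_sum gmean_smult)
  also have "\<dots> = (\<Sum>j\<in>{k}. c j * gmean \<alpha> (jacobi_poly \<alpha> \<alpha> j * jacobi_poly \<alpha> \<alpha> k))"
    using assms by (intro sum.mono_neutral_right) (auto simp: jacobi_orth)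
  finally show ?thesis using jacobi_square_pos[of k] by (simp add: jcoeff_def)
qed

lemma jacobi_expansion_ex:
  "degree p \<le> N \<Longrightarrow> \<exists>c. p = (\<Sum>k\<le>N. smult (c k) (jacobi_poly \<alpha> \<alpha> k))"
proof (induction N arbitrary: p)
  case 0
  then obtain a where "p = [:a:]" by (auto elim: degree_eq_zeroE)
  then show ?case by (intro exI[of _ "\<lambda>_. a"]) simp
next
  case (Suc N)
  let ?P = "jacobi_poly \<alpha> \<alpha> (Suc N)"
  define a where "a = coeff p (Suc N) / coeff ?P (Suc N)"
  have "coeff ?P (Suc N) \<noteq> 0"
    using leading_coeff_neq_0[OF jacobi_nonzero[of "Suc N"]] by simp
  then have "coeff (p - smult a ?P) (Suc N) = 0" by (simp add: a_def)
  moreover have "degree (p - smult a ?P) \<le> Suc N"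
    using Suc.prems by (intro degree_diff_le) (auto intro: order_trans[OF degree_smult_le])
  ultimately have "degree (p - smult a ?P) \<le> N"
    by (metis degree_0 eq_zero_or_degree_less bot_nat_0.extremum less_Suc_eq_le)
  then obtain c where "p - smult a ?P = (\<Sum>k\<le>N. smult (c k) (jacobi_poly \<alpha> \<alpha> k))"
    using Suc.IH by blast
  then have "p = (\<Sum>k\<le>Suc N. smult ((c(Suc N := a)) k) (jacobi_poly \<alpha> \<alpha> k))"
    by (simp add: algebra_simps)
  then show ?case by blast
qed

lemma jacobi_expansion:
  assumes "degree p \<le> N"
  shows "p = (\<Sum>k\<le>N. smult (jcoeff \<alpha> p k) (jacobi_poly \<alpha> \<alpha> k))"
proof -
  obtain c where c: "p = (\<Sum>k\<le>N. smult (c k) (jacobi_poly \<alpha> \<alpha> k))"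
    using jacobi_expansion_ex[OF assms] by blast
  have "jcoeff \<alpha> p k = c k" if "k \<le> N" for k
    using jcoeff_sum[OF that, of c] c by simp
  then show ?thesis using c by simp
qed

end

subsection \<open>Rotation invariance of the surface measure\<close>

text \<open>An isometry \<open>T\<close> and the unit ball \<open>B\<close>, which \<open>T\<close> preserves: evaluating
  \<open>\<integral>\<integral> 1\<^sub>A(T x) 1\<^sub>B(T x + y) dx dy\<close> in both orders gives \<open>\<lambda>(T\<inverse> A) \<lambda>(B) = \<lambda>(A) \<lambda>(B)\<close>.\<close>

lemma emeasure_lborel_orthogonal_vimage:
  fixes T :: "'a::euclidean_space \<Rightarrow> 'a"
  assumes T: "orthogonal_transformation T" and A: "A \<in> sets borel"
  shows "emeasure lborel (T -` A) = emeasure lborel A"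
proof -
  let ?B = "ball (0::'a) 1"
  define f g :: "'a \<Rightarrow> ennreal" where "f = indicator A" and "g = indicator ?B"
  have lin: "linear T" by (rule orthogonal_transformation_linear[OF T])
  then have cont: "continuous_on UNIV T" by (rule linear_continuous_on[OF linear_conv_bounded_linear[THEN iffD1]])
  have [measurable]: "f \<in> borel_measurable borel" "g \<in> borel_measurable borel" "T \<in> borel_measurable borel"
    using A borel_measurable_continuous_onI[OF cont] unfolding f_def g_def by (simp_all add: borel_measurable_indicator)
  have transl: "(\<integral>\<^sup>+ y. h (y + a) \<partial>lborel) = (\<integral>\<^sup>+ y. h y \<partial>lborel)"
    if [measurable]: "h \<in> borel_measurable borel" for h :: "'a \<Rightarrow> ennreal" and a
    by (subst (2) lborel_distr_plus[of a, symmetric]) (simp add: nn_integral_distr add.commute)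
  have reflect: "(\<integral>\<^sup>+ y. h (a - y) \<partial>lborel) = (\<integral>\<^sup>+ y. h y \<partial>lborel)"
    if [measurable]: "h \<in> borel_measurable borel" for h :: "'a \<Rightarrow> ennreal" and a
  proof -
    have "lborel = density (distr lborel borel (\<lambda>x. a + (-1) *\<^sub>R x)) (\<lambda>_. ennreal (\<bar>-1\<bar> ^ DIM('a)))"
      by (rule lborel_affine) simp
    then have eq: "lborel = distr lborel borel (\<lambda>x. a - x)" by (simp add: density_1)
    show ?thesis by (subst (2) eq) (simp add: nn_integral_distr)
  qed
  have TB: "g (T x) = g x" for x
    using orthogonal_transformation_norm[OF T] by (simp add: g_def indicator_def)
  have f: "(\<integral>\<^sup>+ x. f x \<partial>lborel) = emeasure lborel A" and g: "(\<integral>\<^sup>+ x. g x \<partial>lborel) = emeasure lborel ?B"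
    using A by (simp_all add: f_def g_def)
  have fT: "(\<integral>\<^sup>+ x. f (T x) \<partial>lborel) = emeasure lborel (T -` A)"
  proof -
    have "(\<integral>\<^sup>+ x. f (T x) \<partial>lborel) = (\<integral>\<^sup>+ x. indicator (T -` A) x \<partial>lborel)"
      by (intro nn_integral_cong) (simp add: f_def indicator_def)
    also have "\<dots> = emeasure lborel (T -` A)"
      using measurable_sets[of T borel borel A] A by (intro nn_integral_indicator) simp
    finally show ?thesis .
  qed
  have "emeasure lborel (T -` A) * emeasure lborel ?B
      = (\<integral>\<^sup>+ x. \<integral>\<^sup>+ y. f (T x) * g (y + T x) \<partial>lborel \<partial>lborel)"
    by (simp add: nn_integral_cmult nn_integral_multc transl g fT)
  also have "\<dots> = (\<integral>\<^sup>+ y. \<integral>\<^sup>+ x. f (T x) * g (y + T x) \<partial>lborel \<partial>lborel)"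
    by (rule lborel_pair.Fubini'[symmetric]) measurable
  also have "\<dots> = (\<integral>\<^sup>+ y. \<integral>\<^sup>+ x. f (T x - y) * g (T x) \<partial>lborel \<partial>lborel)"
  proof (rule nn_integral_cong)
    fix y :: 'a
    \<comment> \<open>Surjectivity turns the shift by \<open>y\<close> in the image into a shift of
      \<open>x\<close> by \<open>z\<close>, under which Lebesgue measure is invariant.\<close>
    obtain z where z: "y = T z" using surjD[OF orthogonal_transformation_surj[OF T]] by blast
    show "(\<integral>\<^sup>+ x. f (T x) * g (y + T x) \<partial>lborel) = (\<integral>\<^sup>+ x. f (T x - y) * g (T x) \<partial>lborel)"
      using transl[of "\<lambda>x. f (T x - y) * g (T x)" z]
      by (simp add: z linear_add[OF lin] add.commute)
  qed
  also have "\<dots> = (\<integral>\<^sup>+ x. \<integral>\<^sup>+ y. f (T x - y) * g (T x) \<partial>lborel \<partial>lborel)"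
    by (rule lborel_pair.Fubini') measurable
  also have "\<dots> = emeasure lborel A * emeasure lborel ?B"
    by (simp add: nn_integral_multc nn_integral_cmult reflect TB f g)
  finally have "emeasure lborel ?B * emeasure lborel (T -` A) = emeasure lborel ?B * emeasure lborel A"
    by (simp only: mult.commute)
  moreover have "emeasure lborel ?B \<noteq> 0" "emeasure lborel ?B \<noteq> \<infinity>"
    using emeasure_ball[of 1 "0::'a"] less_imp_neq[OF unit_ball_vol_pos[of "real DIM('a)"]] by auto
  ultimately show ?thesis by (simp add: ennreal_mult_cancel_left)
qed

section \<open>Surface integrals of continuous functions and their rotation invariance\<close>

lemma space_surface_measure: "space (surface_measure :: 'a::euclidean_space measure) = sphere 0 1"
  by (simp add: surface_measure_def space_scale_measure)

lemma sets_surface_measure: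
  "sets (surface_measure :: 'a::euclidean_space measure) = sets (restrict_space borel (sphere 0 1))"
  by (simp add: surface_measure_def)

lemma measurable_sgn_sphere:
  "(sgn :: 'a::euclidean_space \<Rightarrow> 'a)
     \<in> restrict_space lborel (ball 0 1 - {0}) \<rightarrow>\<^sub>M restrict_space borel (sphere 0 1)"
proof (rule measurable_restrict_space2)
  show "sgn \<in> space (restrict_space lborel (ball 0 1 - {0::'a})) \<rightarrow> sphere 0 1"
    by (auto simp: space_restrict_space norm_sgn)
  have "(\<lambda>x::'a. x /\<^sub>R norm x) \<in> borel_measurable borel" by measurable
  then show "sgn \<in> borel_measurable (restrict_space lborel (ball 0 1 - {0::'a}))"
    by (intro measurable_restrict_space1) (simp add: sgn_div_norm[abs_def])
qed

lemma emeasure_surface_measure: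
  assumes "A \<in> sets (surface_measure :: 'a::euclidean_space measure)"
  shows "emeasure surface_measure A
       = of_nat DIM('a) * emeasure lborel {x \<in> ball 0 1 - {0}. sgn x \<in> A}"
proof -
  have A: "A \<in> sets (restrict_space borel (sphere 0 1))" using assms by (simp add: sets_surface_measure)
  have eq: "sgn -` A \<inter> space (restrict_space lborel (ball 0 1 - {0})) = {x \<in> ball 0 1 - {0}. sgn x \<in> A}"
    by (auto simp: space_restrict_space)
  have "emeasure surface_measure A
      = of_nat DIM('a) * emeasure (restrict_space lborel (ball 0 1 - {0})) {x \<in> ball 0 1 - {0}. sgn x \<in> A}"
    unfolding surface_measure_def emeasure_scale_measure emeasure_distr[OF measurable_sgn_sphere A] eq ..
  then show ?thesis by (simp add: emeasure_restrict_space Collect_mono subset_iff)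
qed

lemma finite_measure_surface_measure: "finite_measure (surface_measure :: 'a::euclidean_space measure)"
  by (rule finite_measureI) (simp add: space_surface_measure emeasure_surface_measure_sphere)

lemma sphere_area_pos: "n > 0 \<Longrightarrow> sphere_area n > 0"
  by (simp add: sphere_area_def Gamma_real_pos)

lemma measure_surface_measure_space:
  "measure (surface_measure :: 'a::euclidean_space measure) (space surface_measure) = sphere_area DIM('a)"
  using sphere_area_pos[of "DIM('a)"]
  by (simp add: measure_def space_surface_measure emeasure_surface_measure_sphere)

lemma borel_measurable_surface_measure:
  fixes f :: "'a::euclidean_space \<Rightarrow> 'b::topological_space"
  assumes "continuous_on (sphere 0 1) f"
  shows "f \<in> borel_measurable surface_measure"
  using borel_measurable_continuous_on_restrict[OF assms]
  by (simp add: measurable_cong_sets[OF sets_surface_measure refl])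

lemma integrable_surface_measure:
  fixes f :: "'a::euclidean_space \<Rightarrow> real"
  assumes "continuous_on (sphere 0 1) f"
  shows "integrable surface_measure f"
proof -
  have "compact (f ` sphere 0 1)"
    by (intro compact_continuous_image assms) auto
  then have "bounded (f ` sphere 0 1)" by (rule compact_imp_bounded)
  then obtain B where "\<forall>y\<in>f ` sphere 0 1. norm y \<le> B" unfolding bounded_iff by blast
  then show ?thesis
    by (intro finite_measure.integrable_const_bound[OF finite_measure_surface_measure, of _ B]
        borel_measurable_surface_measure assms AE_I2) (simp add: space_surface_measure)
qed

text \<open>\<open>T\<close> commutes with \<open>sgn\<close> and preserves the punctured ball, so
  the cone over the preimage of a set is the preimage of its cone. The invariance of Lebesgue
  measure then carries over.\<close>

lemma distr_surface_measure_orthogonal: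
  fixes T :: "'a::euclidean_space \<Rightarrow> 'a"
  assumes T: "orthogonal_transformation T"
  shows "T \<in> surface_measure \<rightarrow>\<^sub>M surface_measure"
    and "distr surface_measure surface_measure T = surface_measure"
proof -
  have lin: "linear T" by (rule orthogonal_transformation_linear[OF T])
  have norm: "norm (T x) = norm x" for x by (rule orthogonal_transformation_norm[OF T])
  have zero: "T x = 0 \<longleftrightarrow> x = 0" for x by (metis norm norm_eq_zero)
  have sgn: "sgn (T x) = T (sgn x)" for x
    by (simp add: sgn_div_norm norm linear_scale[OF lin])
  have cont: "continuous_on X T" for X
    by (rule linear_continuous_on[OF linear_conv_bounded_linear[THEN iffD1, OF lin]])
  have "T \<in> surface_measure \<rightarrow>\<^sub>M restrict_space borel (sphere 0 1)"
    by (intro measurable_restrict_space2 borel_measurable_surface_measure cont)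
       (auto simp: space_surface_measure norm)
  then show meas: "T \<in> surface_measure \<rightarrow>\<^sub>M surface_measure"
    by (simp add: measurable_cong_sets[OF refl sets_surface_measure])
  show "distr surface_measure surface_measure T = surface_measure"
  proof (rule measure_eqI)
    fix A :: "'a set" assume "A \<in> sets (distr surface_measure surface_measure T)"
    then have A: "A \<in> sets surface_measure" by simp
    let ?C = "{x \<in> ball 0 1 - {0}. sgn x \<in> A}"
    have "?C = sgn -` A \<inter> space (restrict_space lborel (ball 0 1 - {0}))"
      by (auto simp: space_restrict_space)
    then have "?C \<in> sets (restrict_space lborel (ball 0 1 - {0}))"
      using measurable_sets[OF measurable_sgn_sphere, of A] A by (simp add: sets_surface_measure)
    then have C: "?C \<in> sets borel" by (subst (asm) sets_restrict_space_iff) simp_all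
    have "emeasure (distr surface_measure surface_measure T) A
        = emeasure surface_measure (T -` A \<inter> space surface_measure)"
      by (rule emeasure_distr[OF meas A])
    also have "\<dots> = of_nat DIM('a) * emeasure lborel {x \<in> ball 0 1 - {0}. sgn x \<in> T -` A \<inter> space surface_measure}"
      by (rule emeasure_surface_measure[OF measurable_sets[OF meas A]])
    also have "{x \<in> ball 0 1 - {0}. sgn x \<in> T -` A \<inter> space surface_measure} = T -` ?C"
      by (auto simp: space_surface_measure norm_sgn norm zero sgn)
    also have "of_nat DIM('a) * emeasure lborel (T -` ?C) = emeasure surface_measure A"
      by (simp only: emeasure_lborel_orthogonal_vimage[OF T C] emeasure_surface_measure[OF A])
    finally show "emeasure (distr surface_measure surface_measure T) A = emeasure surface_measure A" .
  qed simp
qed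

lemma integral_surface_measure_orthogonal:
  fixes f :: "'a::euclidean_space \<Rightarrow> real" and T :: "'a \<Rightarrow> 'a"
  assumes "orthogonal_transformation T" "continuous_on (sphere 0 1) f"
  shows "(LINT y|surface_measure. f (T y)) = (LINT y|surface_measure. f y)"
  using integral_distr[OF distr_surface_measure_orthogonal(1)
      borel_measurable_surface_measure[OF assms(2)], of T] assms(1)
  by (simp add: distr_surface_measure_orthogonal(2)[OF assms(1)])

text \<open>Some isometry carries \<open>norm v *\<^sub>R e\<close> to \<open>v\<close>, so only the
  length of \<open>v\<close> matters. Inserting v = e + s f makes the right-hand side an explicit
  polynomial in s for even \<open>k\<close>, the source of all mixed moments.\<close>

lemma integral_inner_power:
  fixes v e :: "real^'n"
  assumes e: "norm e = 1"
  shows "(LINT y|surface_measure. (v \<bullet> y) ^ k) = norm v ^ k * (LINT y|surface_measure. (e \<bullet> y) ^ k)"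
proof -
  obtain T where T: "orthogonal_transformation T" "T (norm v *\<^sub>R e) = v"
    using orthogonal_transformation_exists[of "norm v *\<^sub>R e" v] e by auto
  have "(LINT y|surface_measure. (v \<bullet> y) ^ k) = (LINT y|surface_measure. (v \<bullet> T y) ^ k)"
    by (rule integral_surface_measure_orthogonal[OF T(1), symmetric]) (intro continuous_intros)
  also have "\<dots> = (LINT y|surface_measure. norm v ^ k * (e \<bullet> y) ^ k)"
    by (subst T(2)[symmetric])
       (simp only: orthogonal_transformation_def[THEN iffD1, OF T(1), THEN conjunct2, rule_format]
          inner_scaleR_left power_mult_distrib)
  finally show ?thesis by simp
qed

subsection \<open>Moments of the surface measure\<close>

text \<open>Comparison of the coefficients of \<open>s\<close> in
  \<open>\<integral> (e \<bullet> y + s f \<bullet> y)\<^sup>N d\<omega>(y) = (1 + s\<^sup>2)\<^bsup>N/2\<^esup> \<integral> (e \<bullet> y)\<^sup>N d\<omega>(y)\<close>.\<close>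

lemma mixed_moment_binomial:
  fixes e f :: "real^'n"
  assumes e: "norm e = 1" and f: "norm f = 1" and ef: "e \<bullet> f = 0" and b: "b \<le> 2 * m"
  shows "real ((2 * m) choose b) * (LINT y|surface_measure. (e \<bullet> y) ^ (2 * m - b) * (f \<bullet> y) ^ b)
       = (if even b then real (m choose (b div 2)) * (LINT y|surface_measure. (e \<bullet> y) ^ (2 * m)) else 0)"
proof -
  let ?W = "\<lambda>b. LINT y|surface_measure. (e \<bullet> y) ^ (2 * m - b) * (f \<bullet> y) ^ b"
  let ?M = "LINT y|surface_measure. (e \<bullet> y) ^ (2 * m)"
  define p where "p = (\<Sum>b\<le>2 * m. monom (real ((2 * m) choose b) * ?W b) b)"
  define q where "q = (\<Sum>j\<le>m. monom (real (m choose j) * ?M) (2 * j))"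
  have "poly p s = poly q s" for s
  proof -
    have "poly p s = (\<Sum>b\<le>2 * m. LINT y|surface_measure.
        real ((2 * m) choose b) * (s * (f \<bullet> y)) ^ b * (e \<bullet> y) ^ (2 * m - b))"
    proof -
      have "real ((2 * m) choose b) * ?W b * s ^ b = (LINT y|surface_measure.
          real ((2 * m) choose b) * (s * (f \<bullet> y)) ^ b * (e \<bullet> y) ^ (2 * m - b))" for b
      proof -
        have "real ((2 * m) choose b) * ?W b * s ^ b
            = (LINT y|surface_measure. (real ((2 * m) choose b) * s ^ b) * ((e \<bullet> y) ^ (2 * m - b) * (f \<bullet> y) ^ b))"
          by (subst integral_mult_right_zero) simp
        then show ?thesis by (simp add: power_mult_distrib mult_ac)
      qed
      then show ?thesis unfolding p_def poly_sum poly_monom by simp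
    qed
    also have "\<dots> = (LINT y|surface_measure. (\<Sum>b\<le>2 * m.
        real ((2 * m) choose b) * (s * (f \<bullet> y)) ^ b * (e \<bullet> y) ^ (2 * m - b)))"
      by (intro Bochner_Integration.integral_sum[symmetric] integrable_surface_measure continuous_intros)
    also have "\<dots> = (LINT y|surface_measure. ((s *\<^sub>R f + e) \<bullet> y) ^ (2 * m))"
      by (simp add: binomial_ring inner_add_left)
    also have "\<dots> = norm (s *\<^sub>R f + e) ^ (2 * m) * ?M"
      by (rule integral_inner_power[OF e])
    also have "norm (s *\<^sub>R f + e) ^ (2 * m) = (s\<^sup>2 + 1) ^ m"
    proof -
      have "(norm (s *\<^sub>R f + e))\<^sup>2 = s\<^sup>2 * (norm f)\<^sup>2 + (norm e)\<^sup>2"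
        unfolding power2_norm_eq_inner using ef
        by (simp add: inner_add_left inner_add_right inner_commute power2_eq_square)
      then show ?thesis using e f by (simp add: power_mult)
    qed
    also have "(s\<^sup>2 + 1) ^ m * ?M = poly q s"
      unfolding q_def poly_sum poly_monom binomial_ring
      by (simp add: sum_distrib_left sum_distrib_right power_mult[symmetric] mult_ac)
    finally show ?thesis .
  qed
  then have "p = q" by (simp add: poly_eq_poly_eq_iff[symmetric] fun_eq_iff)
  then have "coeff p b = coeff q b" by simp
  moreover have "coeff p b = real ((2 * m) choose b) * ?W b"
    using b unfolding p_def coeff_sum by (simp add: if_distrib cong: if_cong)
  moreover have "coeff q b = (if even b then real (m choose (b div 2)) * ?M else 0)"
  proof (cases "even b")
    case True
    then obtain i where i: "b = 2 * i" by blast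
    then have "i \<le> m" using b by simp
    then show ?thesis unfolding q_def coeff_sum i by (simp add: if_distrib cong: if_cong)
  next
    case False
    then show ?thesis unfolding q_def coeff_sum by (auto intro!: sum.neutral)
  qed
  ultimately show ?thesis by simp
qed

text \<open>The antipodal map preserves the measure and reverses the sign of the integrand.\<close>

lemma mixed_moment_odd:
  fixes e f :: "real^'n"
  assumes "odd (a + b)"
  shows "(LINT y|surface_measure. (e \<bullet> y) ^ a * (f \<bullet> y) ^ b) = 0"
proof -
  have T: "orthogonal_transformation (uminus :: real^'n \<Rightarrow> real^'n)"
    by (simp add: orthogonal_transformation_def linear_iff)
  have "(LINT y|surface_measure. (e \<bullet> y) ^ a * (f \<bullet> y) ^ b)
      = (LINT y|surface_measure. (e \<bullet> (- y)) ^ a * (f \<bullet> (- y)) ^ b)"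
    by (rule integral_surface_measure_orthogonal[OF T, symmetric]) (intro continuous_intros)
  also have "\<dots> = (LINT y|surface_measure. - ((e \<bullet> y) ^ a * (f \<bullet> y) ^ b))"
  proof (rule Bochner_Integration.integral_cong[OF refl])
    fix y
    show "(e \<bullet> - y) ^ a * (f \<bullet> - y) ^ b = - ((e \<bullet> y) ^ a * (f \<bullet> y) ^ b)"
      using assms by (cases "even a"; cases "even b") simp_all
  qed
  finally show ?thesis by simp
qed

text \<open>On the sphere 1 minus the square of one coordinate is the sum of the other n - 1
  squares. Hence M k - M (k + 2) is a sum of n - 1 mixed moments, each equal to M (k + 2) / (k + 1)
  for even k.\<close>

lemma sphere_moment_rec:
  fixes e :: "real^'n"
  assumes e: "norm e = 1"
  shows "(real k + real CARD('n)) * (LINT y|surface_measure. (e \<bullet> y) ^ (k + 2))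
       = (real k + 1) * (LINT y|surface_measure. (e \<bullet> y) ^ k)"
proof (cases "odd k")
  case True
  then show ?thesis
    using mixed_moment_odd[of k 0 e e] mixed_moment_odd[of "k + 2" 0 e e] by simp
next
  case False
  then obtain l where k: "k = 2 * l" by auto
  \<comment> \<open>Any coordinate will do: \<open>integral_inner_power\<close> transfers the result
    to \<open>e\<close> at the end.\<close>
  define i where "i = (undefined :: 'n)"
  let ?E = "axis i 1 :: real^'n"
  define M where "M = (\<lambda>k. LINT y|surface_measure. (?E \<bullet> y) ^ k)"
  \<comment> \<open>The case b = 2, m = l + 1 of \<open>mixed_moment_binomial\<close>, with the
    common factor l + 1 of both binomials cancelled.\<close>
  have W: "real (k + 1) * (LINT y|surface_measure. (?E \<bullet> y) ^ k * (axis j 1 \<bullet> y) ^ 2) = M (k + 2)"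
    if "j \<noteq> i" for j
  proof -
    have "real ((2 * Suc l) choose 2) * (LINT y|surface_measure. (?E \<bullet> y) ^ (2 * Suc l - 2) * (axis j 1 \<bullet> y) ^ 2)
       = (if even (2::nat) then real (Suc l choose (2 div 2)) * (LINT y|surface_measure. (?E \<bullet> y) ^ (2 * Suc l)) else 0)"
      by (rule mixed_moment_binomial) (use that in \<open>simp_all add: inner_axis_axis\<close>)
    moreover have "real ((2 * Suc l) choose 2) = real (Suc l) * real (k + 1)"
      by (simp add: choose_two k algebra_simps)
    ultimately have "real (Suc l) * (real (k + 1) * (LINT y|surface_measure. (?E \<bullet> y) ^ k * (axis j 1 \<bullet> y) ^ 2))
        = real (Suc l) * M (k + 2)"
      by (simp add: k M_def algebra_simps)
    then show ?thesis by (subst (asm) mult_cancel_left) simp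
  qed
  have "real (k + 1) * (M k - M (k + 2))
      = real (k + 1) * (LINT y|surface_measure. (\<Sum>j\<in>UNIV - {i}. (?E \<bullet> y) ^ k * (axis j 1 \<bullet> y) ^ 2))"
  proof -
    have "M k - M (k + 2) = (LINT y|surface_measure. (?E \<bullet> y) ^ k - (?E \<bullet> y) ^ (k + 2))"
      unfolding M_def
      by (intro Bochner_Integration.integral_diff[symmetric] integrable_surface_measure continuous_intros)
    also have "\<dots> = (LINT y|surface_measure. (\<Sum>j\<in>UNIV - {i}. (?E \<bullet> y) ^ k * (axis j 1 \<bullet> y) ^ 2))"
    proof (rule Bochner_Integration.integral_cong[OF refl])
      fix y :: "real^'n" assume "y \<in> space surface_measure"
      then have "y \<bullet> y = 1" by (simp add: space_surface_measure norm_eq_1)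
      then have "(\<Sum>j\<in>UNIV. (y $ j)\<^sup>2) = 1"
        by (simp add: inner_vec_def power2_eq_square)
      then have "(\<Sum>j\<in>UNIV - {i}. (y $ j)\<^sup>2) = 1 - (y $ i)\<^sup>2"
        by (simp add: sum_diff1)
      then show "(?E \<bullet> y) ^ k - (?E \<bullet> y) ^ (k + 2) = (\<Sum>j\<in>UNIV - {i}. (?E \<bullet> y) ^ k * (axis j 1 \<bullet> y) ^ 2)"
        by (simp add: sum_distrib_left[symmetric] inner_axis' power_add right_diff_distrib power2_eq_square)
    qed
    finally show ?thesis by simp
  qed
  also have "\<dots> = (\<Sum>j\<in>UNIV - {i}. real (k + 1) * (LINT y|surface_measure. (?E \<bullet> y) ^ k * (axis j 1 \<bullet> y) ^ 2))"
    by (subst Bochner_Integration.integral_sum)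
       (auto intro!: integrable_surface_measure continuous_intros simp: sum_distrib_left)
  also have "\<dots> = (\<Sum>j\<in>UNIV - {i}. M (k + 2))" by (intro sum.cong) (use W in auto)
  also have "\<dots> = (real CARD('n) - 1) * M (k + 2)" by (simp add: card_Diff_singleton of_nat_diff Suc_leI)
  finally have "(real k + real CARD('n)) * M (k + 2) = (real k + 1) * M k"
    by (simp add: algebra_simps)
  moreover have "M j = (LINT y|surface_measure. (e \<bullet> y) ^ j)" for j
    using integral_inner_power[OF e, of ?E j] by (simp add: M_def)
  ultimately show ?thesis by simp
qed

text \<open>The mean of \<open>p\<close> at a coordinate of a random point of the unit sphere in dimension \<open>n - 1\<close>.\<close>

definition slice_mean :: "nat \<Rightarrow> real poly \<Rightarrow> real" where
  "slice_mean n p = (if n = 2 then (poly p 1 + poly p (-1)) / 2 else gmean ((real n - 4) / 2) p)"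

context
  fixes n :: nat
  assumes n2: "2 \<le> n"
begin

text \<open>The exponent one dimension lower, ((n - 1) - 3) / 2, reaches the non-integrable value -1
  at n = 2. There the lower sphere is the pair 1, -1, which explains the separate clause in
  \<open>slice_mean\<close>.\<close>

lemma slice_alpha: "n \<noteq> 2 \<Longrightarrow> (real n - 4) / 2 > -1"
  using n2 by auto

lemma slice_mean_1 [simp]: "slice_mean n 1 = 1"
  using slice_alpha by (simp add: slice_mean_def)

lemma slice_mean_smult: "slice_mean n (smult c p) = c * slice_mean n p"
  using gmean_smult[OF slice_alpha] by (simp add: slice_mean_def algebra_simps)

lemma slice_mean_add: "slice_mean n (p + q) = slice_mean n p + slice_mean n q"
  using gmean_add[OF slice_alpha] by (simp add: slice_mean_def field_simps)

lemma slice_mean_0 [simp]: "slice_mean n 0 = 0"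
  using slice_mean_smult[of 0 0] by simp

lemma slice_mean_sum: "slice_mean n (\<Sum>i\<in>I. f i) = (\<Sum>i\<in>I. slice_mean n (f i))"
  by (induction I rule: infinite_finite_induct) (simp_all add: slice_mean_add)

lemma slice_mean_const [simp]: "slice_mean n [:c:] = c"
  using slice_mean_smult[of c 1] by simp

lemma slice_mean_nonneg:
  assumes "\<And>u. u \<in> {-1..1} \<Longrightarrow> 0 \<le> poly p u"
  shows "0 \<le> slice_mean n p"
  using gmean_nonneg[OF slice_alpha assms] assms[of 1] assms[of "-1"] by (simp add: slice_mean_def)

lemma slice_mean_le:
  assumes "\<And>u. u \<in> {-1..1} \<Longrightarrow> poly p u \<le> c"
  shows "slice_mean n p \<le> c"
proof -
  have "0 \<le> slice_mean n ([:c:] + smult (-1) p)"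
    by (rule slice_mean_nonneg) (use assms in simp)
  then show ?thesis by (simp only: slice_mean_add slice_mean_smult slice_mean_const)
qed

lemma slice_mean_odd: "odd k \<Longrightarrow> slice_mean n (monom 1 k) = 0"
  using gmean_odd_moment[OF slice_alpha] by (simp add: slice_mean_def poly_monom)

text \<open>The moment recursion one dimension lower, solved and cleared of denominators. For n = 2
  the two products agree and the moment is 1.\<close>

lemma slice_mean_even:
  "slice_mean n (monom 1 (2 * j)) * (\<Prod>i<j. real n - 1 + 2 * real i) = (\<Prod>i<j. 1 + 2 * real i)"
proof (induction j)
  case (Suc j)
  have "(2 * real j + real n - 1) * slice_mean n (monom 1 (2 * j + 2)) = (2 * real j + 1) * slice_mean n (monom 1 (2 * j))"
    using gmean_moment_rec[OF slice_alpha, of "2 * j"]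
    by (cases "n = 2") (simp_all add: slice_mean_def poly_monom field_simps)
  then have "slice_mean n (monom 1 (2 * Suc j)) * (real n - 1 + 2 * real j) = (1 + 2 * real j) * slice_mean n (monom 1 (2 * j))"
    by (simp add: algebra_simps)
  then have "slice_mean n (monom 1 (2 * Suc j)) * (real n - 1 + 2 * real j) * (\<Prod>i<j. real n - 1 + 2 * real i)
      = (1 + 2 * real j) * (\<Prod>i<j. 1 + 2 * real i)"
    by (simp only: mult.assoc Suc.IH)
  then show ?case by (simp add: mult_ac)
qed (simp add: monom_0[symmetric])

text \<open>For even \<open>a\<close> this is a quotient of Beta integrals with the Gamma factors
  written as finite products. Splitting one factor 1 - u^2 reduces \<open>j + 1\<close> to
  \<open>j\<close> at \<open>a\<close> and at \<open>a + 2\<close>, so the induction must keep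
  \<open>a\<close> arbitrary.\<close>

lemma gmean_monom_parallel:
  assumes "\<alpha> = (real n - 3) / 2"
  shows "gmean \<alpha> (monom 1 a * [:1, 0, -1:] ^ j) * (\<Prod>i<j. real a + 1 + 2 * real i)
       = gmean \<alpha> (monom 1 (a + 2 * j)) * (\<Prod>i<j. real n - 1 + 2 * real i)"
proof (induction j arbitrary: a)
  case (Suc j)
  have alpha: "\<alpha> > -1" using assms n2 by simp
  let ?V = "\<lambda>a. gmean \<alpha> (monom 1 a * [:1, 0, -1:] ^ j)"
  let ?M = "\<lambda>a. gmean \<alpha> (monom 1 a)"
  let ?P = "\<lambda>a. \<Prod>i<j. real a + 1 + 2 * real i"
  let ?N = "\<Prod>i<j. real n - 1 + 2 * real i"
  have X2: "monom 1 a * [:1, 0, -1:] = monom 1 a - (monom 1 (a + 2) :: real poly)"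
    by (rule poly_eq_poly_eq_iff[THEN iffD1])
       (simp add: fun_eq_iff poly_monom power_add power2_eq_square algebra_simps)
  have "(monom 1 a * [:1, 0, -1:] ^ Suc j :: real poly) = (monom 1 a * [:1, 0, -1:]) * [:1, 0, -1:] ^ j"
    by (simp only: power_Suc mult.assoc)
  then have split: "gmean \<alpha> (monom 1 a * [:1, 0, -1:] ^ Suc j) = ?V a - ?V (a + 2)"
    by (simp only: X2 left_diff_distrib gmean_diff[OF alpha])
  have sh: "(\<Prod>i<Suc j. real a + 1 + 2 * real i) = (real a + 1) * ?P (a + 2)"
    by (subst prod.lessThan_Suc_shift) (simp add: algebra_simps)
  have rec: "(real a + 2 * real j + real n) * ?M (a + 2 * j + 2) = (real a + 2 * real j + 1) * ?M (a + 2 * j)"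
  proof -
    have c: "real (a + 2 * j) + 2 * \<alpha> + 3 = real a + 2 * real j + real n"
      using assms by (simp add: field_simps)
    show ?thesis using gmean_moment_rec[OF alpha, of "a + 2 * j"] unfolding c by (simp add: add_ac)
  qed
  have "gmean \<alpha> (monom 1 a * [:1, 0, -1:] ^ Suc j) * (\<Prod>i<Suc j. real a + 1 + 2 * real i)
      = (?V a * ?P a) * (real a + 1 + 2 * real j) - (real a + 1) * (?V (a + 2) * ?P (a + 2))"
    unfolding split left_diff_distrib by (subst (2) sh) (simp add: algebra_simps)
  also have "\<dots> = ?N * ((real a + 2 * real j + 1) * ?M (a + 2 * j) - (real a + 1) * ?M (a + 2 * j + 2))"
    unfolding Suc.IH by (simp add: algebra_simps)
  also have "\<dots> = ?N * ((real n - 1 + 2 * real j) * ?M (a + 2 * j + 2))"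
    unfolding rec[symmetric] by (simp add: algebra_simps)
  finally show ?case by (simp add: algebra_simps)
qed simp

end

text \<open>With N = l + j, use (2 N)! = 2^N * N! * (2 N - 1)!! and likewise for 2 l and 2 j: the
  powers of 2 cancel and the odd double factorials remain. This reconciles the binomials of
  \<open>mixed_moment_binomial\<close> with the products in the moment formulas.\<close>

lemma choose_double:
  "real ((2 * (l + j)) choose (2 * j)) * (\<Prod>i<j. 1 + 2 * real i)
     = real ((l + j) choose j) * (\<Prod>i<j. 2 * real l + 1 + 2 * real i)"
proof (induction j)
  case (Suc j)
  let ?N = "2 * (l + j)"
  let ?c = "real (?N choose (2 * j))" and ?d = "real (Suc (Suc ?N) choose Suc (Suc (2 * j)))"
  let ?e = "real ((l + j) choose j)" and ?g = "real (Suc (l + j) choose Suc j)"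
  have 1: "real (2 * j + 2) * ?d = real (?N + 2) * real (Suc ?N choose Suc (2 * j))"
    using Suc_times_binomial[of "Suc (2 * j)" "Suc ?N"] by (simp only: of_nat_mult[symmetric]) (simp del: binomial_Suc_Suc)
  have 2: "real (2 * j + 1) * real (Suc ?N choose Suc (2 * j)) = real (?N + 1) * ?c"
    using Suc_times_binomial[of "2 * j" ?N] by (simp only: of_nat_mult[symmetric]) (simp del: binomial_Suc_Suc)
  have 3: "real (j + 1) * ?g = real (l + j + 1) * ?e"
    using Suc_times_binomial[of j "l + j"] by (simp only: of_nat_mult[symmetric]) (simp del: binomial_Suc_Suc)
  have "real (2 * j + 2) * (?d * (1 + 2 * real j))
      = real (?N + 2) * (real (2 * j + 1) * real (Suc ?N choose Suc (2 * j)))"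
    using arg_cong[OF 1, of "\<lambda>x. x * real (2 * j + 1)"] by (simp add: mult_ac add_ac del: binomial_Suc_Suc)
  then have "real (2 * j + 2) * (?d * (1 + 2 * real j)) = real (?N + 2) * (real (?N + 1) * ?c)"
    unfolding 2 .
  then have 4: "real (j + 1) * (?d * (1 + 2 * real j)) = real (l + j + 1) * (real (?N + 1) * ?c)"
    by (simp add: algebra_simps del: binomial_Suc_Suc)
  have "real (j + 1) * (?d * (1 + 2 * real j) * (\<Prod>i<j. 1 + 2 * real i))
      = real (l + j + 1) * real (?N + 1) * (?c * (\<Prod>i<j. 1 + 2 * real i))"
    using 4 by (simp add: mult.assoc[symmetric] del: binomial_Suc_Suc)
  also have "\<dots> = (real (l + j + 1) * ?e) * (real (?N + 1) * (\<Prod>i<j. 2 * real l + 1 + 2 * real i))"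
    unfolding Suc.IH by (simp add: mult_ac del: binomial_Suc_Suc)
  also have "\<dots> = real (j + 1) * (?g * (real (?N + 1) * (\<Prod>i<j. 2 * real l + 1 + 2 * real i)))"
    unfolding 3[symmetric] by (simp add: mult_ac del: binomial_Suc_Suc)
  finally have "?d * (1 + 2 * real j) * (\<Prod>i<j. 1 + 2 * real i)
      = ?g * (real (?N + 1) * (\<Prod>i<j. 2 * real l + 1 + 2 * real i))"
    by (subst (asm) mult_cancel_left) (simp del: binomial_Suc_Suc)
  then show ?case by (simp add: mult_ac add_ac del: binomial_Suc_Suc)
qed simp

subsection \<open>Product formula and positivity of the Jacobi kernels\<close>

text \<open>The binomial expansion of the mean of (t v + sqrt (1 - t^2) sqrt (1 - v^2) z)^i over z,
  as a polynomial in v. Odd moments of z vanish, so only even \<open>b\<close> contribute; there the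
  square roots become integral powers \<open>b div 2\<close>, and the rounding for odd
  \<open>b\<close> is harmless.\<close>

definition parallel_monom :: "nat \<Rightarrow> real \<Rightarrow> nat \<Rightarrow> real poly" where
  "parallel_monom n t i = (\<Sum>b\<le>i. smult (real (i choose b) * t ^ (i - b) * (1 - t\<^sup>2) ^ (b div 2)
       * slice_mean n (monom 1 b)) (monom 1 (i - b) * [:1, 0, -1:] ^ (b div 2)))"

text \<open>The generalised translation of \<open>p\<close>: if \<open>e\<close> and \<open>y\<close> are unit vectors, then its value at \<open>e \<bullet> y\<close>
  is the mean of \<open>p (x \<bullet> y)\<close> over the parallel \<open>{x. x \<bullet> e = t}\<close>.\<close>

definition translate :: "nat \<Rightarrow> real \<Rightarrow> real poly \<Rightarrow> real poly" where
  "translate n t p = (\<Sum>i\<le>degree p. smult (coeff p i) (parallel_monom n t i))"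

text \<open>A power z^b is traded for \<open>b div 2\<close> factors 1 - v^2, so the degree is at
  most (i - b) + 2 (b div 2). This makes translation triangular with respect to the Jacobi
  polynomials.\<close>

lemma degree_translate_le: "degree (translate n t p) \<le> degree p"
proof -
  have "degree (parallel_monom n t i) \<le> i" for i
    unfolding parallel_monom_def
  proof (intro degree_sum_le finite_atMost)
    fix b assume "b \<in> {..i}"
    have "degree ([:1, 0, -1 :: real:] ^ (b div 2)) \<le> degree [:1, 0, -1 :: real:] * (b div 2)"
      by (rule degree_power_le)
    then have "degree (monom 1 (i - b) * [:1, 0, -1 :: real:] ^ (b div 2)) \<le> (i - b) + 2 * (b div 2)"
      by (intro order_trans[OF degree_mult_le]) (simp add: degree_monom_eq)
    also have "\<dots> \<le> i" using \<open>b \<in> {..i}\<close> by simp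
    finally show "degree (smult (real (i choose b) * t ^ (i - b) * (1 - t\<^sup>2) ^ (b div 2)
       * slice_mean n (monom 1 b)) (monom 1 (i - b) * [:1, 0, -1:] ^ (b div 2))) \<le> i"
      by (rule order_trans[OF degree_smult_le])
  qed
  then show ?thesis
    unfolding translate_def
    by (intro degree_sum_le) (auto intro: order_trans[OF degree_smult_le] order_trans)
qed

lemma sphere_orthonormal_decomposition:
  fixes x y :: "'a::euclidean_space"
  assumes "norm x = 1" "norm y = 1" "2 \<le> DIM('a)"
  obtains f where "norm f = 1" "x \<bullet> f = 0" "y = (x \<bullet> y) *\<^sub>R x + sqrt (1 - (x \<bullet> y)\<^sup>2) *\<^sub>R f"
proof -
  define w where "w = y - (x \<bullet> y) *\<^sub>R x"
  have xx: "x \<bullet> x = 1" "y \<bullet> y = 1" using assms by (simp_all add: norm_eq_1)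
  have xw: "x \<bullet> w = 0" by (simp add: w_def inner_diff_right xx)
  have "w \<bullet> w = 1 - (x \<bullet> y)\<^sup>2"
    by (simp add: w_def inner_diff_right inner_diff_left xx inner_commute power2_eq_square)
  then have nw: "sqrt (1 - (x \<bullet> y)\<^sup>2) = norm w" by (simp add: norm_eq_sqrt_inner)
  show thesis
  proof (cases "w = 0")
    case False
    show thesis
    proof (rule that[of "w /\<^sub>R norm w"])
      show "y = (x \<bullet> y) *\<^sub>R x + sqrt (1 - (x \<bullet> y)\<^sup>2) *\<^sub>R (w /\<^sub>R norm w)"
        using False by (simp add: nw) (simp add: w_def)
    qed (use False xw in simp_all)
  next
    \<comment> \<open>Here \<open>y\<close> is a multiple of \<open>x\<close> and the coefficient of
      \<open>f\<close> is 0, so any unit vector orthogonal to \<open>x\<close> serves. Its existence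
      requires dimension at least 2.\<close>
    case True
    obtain g where g: "g \<noteq> 0" "orthogonal x g" using orthogonal_to_vector_exists[OF assms(3), of x] .
    show thesis
    proof (rule that[of "g /\<^sub>R norm g"])
      show "y = (x \<bullet> y) *\<^sub>R x + sqrt (1 - (x \<bullet> y)\<^sup>2) *\<^sub>R (g /\<^sub>R norm g)"
        using True by (simp add: nw) (simp add: w_def)
    qed (use g in \<open>simp_all add: orthogonal_def\<close>)
  qed
qed

lemma ex_unit_vectors_inner:
  assumes "2 \<le> DIM('a::euclidean_space)" "t \<in> {-1..1}"
  obtains x y :: "'a::euclidean_space" where "norm x = 1" "norm y = 1" "x \<bullet> y = t"
proof -
  obtain x :: 'a where x: "norm x = 1" using vector_choose_size[of 1] by auto
  then obtain f where f: "norm f = 1" "x \<bullet> f = 0"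
    using sphere_orthonormal_decomposition[OF x x assms(1)] by metis
  have t: "t\<^sup>2 \<le> 1" using assms(2) by (simp add: abs_square_le_1 abs_le_iff)
  define s where "s = sqrt (1 - t\<^sup>2)"
  have s: "s\<^sup>2 = 1 - t\<^sup>2" using t by (simp add: s_def)
  have "(norm (t *\<^sub>R x + s *\<^sub>R f))\<^sup>2 = t\<^sup>2 + s\<^sup>2"
    unfolding power2_norm_eq_inner using x f
    by (simp add: inner_add_left inner_add_right inner_commute norm_eq_1 power2_eq_square)
  then have "norm (t *\<^sub>R x + s *\<^sub>R f) = 1"
    using s by (simp add: power2_eq_1_iff) (smt (verit) norm_ge_zero)
  moreover have "x \<bullet> (t *\<^sub>R x + s *\<^sub>R f) = t"
    using x f by (simp add: inner_add_right norm_eq_1)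
  ultimately show thesis using that x by blast
qed

lemma pcompose_as_sum: "pcompose p q = (\<Sum>i\<le>degree p. smult (coeff p i) (q ^ i))"
  for p :: "real poly"
  by (rule poly_eq_poly_eq_iff[THEN iffD1])
     (simp add: fun_eq_iff poly_pcompose poly_sum poly_altdef[of p])

lemma positive_kernel_const: "0 \<le> a \<Longrightarrow> positive_kernel_on S (\<lambda>x y. a)"
proof -
  assume a: "0 \<le> a"
  have "(\<Sum>i<N. \<Sum>j<N. c i * c j * a) = a * (\<Sum>i<N. c i)\<^sup>2" for N and c :: "nat \<Rightarrow> real"
    by (simp add: power2_eq_square sum_product sum_distrib_left mult_ac)
  then show ?thesis using a by (simp add: positive_kernel_on_def)
qed

text \<open>The type argument ties \<open>n\<close> to \<open>real^'n\<close>, so that statements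
  purely about polynomials can be proved by integrating over the sphere.\<close>

locale ultraspherical =
  fixes n :: nat and \<alpha> :: real and dim :: "'n::finite itself"
  assumes n: "n = CARD('n)" and n2: "2 \<le> n" and \<alpha>: "\<alpha> = (real n - 3) / 2"
begin

lemma ultraspherical_alpha: "\<alpha> > -1" using n2 \<alpha> by simp

lemmas gmean_simps = gmean_add[OF ultraspherical_alpha] gmean_smult[OF ultraspherical_alpha]
  gmean_sum[OF ultraspherical_alpha]

lemma poly_translate:
  assumes t: "t \<in> {-1..1}" and v: "v \<in> {-1..1}"
  shows "poly (translate n t p) v
       = slice_mean n (pcompose p [:t * v, sqrt (1 - t\<^sup>2) * sqrt (1 - v\<^sup>2):])"
proof -
  define s where "s = sqrt (1 - t\<^sup>2) * sqrt (1 - v\<^sup>2)"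
  have s2: "s\<^sup>2 = (1 - t\<^sup>2) * (1 - v\<^sup>2)"
    using t v by (simp add: s_def power_mult_distrib abs_square_le_1 abs_le_iff)
  have mon: "poly (parallel_monom n t i) v = slice_mean n ([:t * v, s:] ^ i)" for i
  proof -
    have "[:t * v, s:] ^ i = (monom s 1 + [:t * v:]) ^ i"
      by (simp add: monom_altdef)
    also have "\<dots> = (\<Sum>b\<le>i. smult (real (i choose b) * (t * v) ^ (i - b) * s ^ b) (monom 1 b))"
      unfolding binomial_ring
      by (intro sum.cong refl, rule poly_eq_poly_eq_iff[THEN iffD1])
         (simp add: fun_eq_iff poly_monom power_mult_distrib poly_power)
    finally have "slice_mean n ([:t * v, s:] ^ i)
        = (\<Sum>b\<le>i. real (i choose b) * (t * v) ^ (i - b) * (s ^ b * slice_mean n (monom 1 b)))"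
      by (simp add: slice_mean_sum[OF n2] slice_mean_smult[OF n2] mult.assoc)
    also have "\<dots> = (\<Sum>b\<le>i. real (i choose b) * (t * v) ^ (i - b) *
        (((1 - t\<^sup>2) * (1 - v\<^sup>2)) ^ (b div 2) * slice_mean n (monom 1 b)))"
    proof (intro sum.cong refl)
      fix b
      have "s ^ b * slice_mean n (monom 1 b) = ((1 - t\<^sup>2) * (1 - v\<^sup>2)) ^ (b div 2) * slice_mean n (monom 1 b)"
      proof (cases "even b")
        case True
        then have "s ^ b = (s\<^sup>2) ^ (b div 2)" by (simp flip: power_mult)
        then show ?thesis by (simp only: s2)
      qed (simp add: slice_mean_odd[OF n2])
      then show "real (i choose b) * (t * v) ^ (i - b) * (s ^ b * slice_mean n (monom 1 b))
          = real (i choose b) * (t * v) ^ (i - b) * (((1 - t\<^sup>2) * (1 - v\<^sup>2)) ^ (b div 2) * slice_mean n (monom 1 b))"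
        by (simp only:)
    qed
    also have "\<dots> = poly (parallel_monom n t i) v"
      unfolding parallel_monom_def poly_sum
      by (intro sum.cong refl) (simp add: poly_monom power_mult_distrib power2_eq_square)
    finally show ?thesis ..
  qed
  show ?thesis
    unfolding translate_def pcompose_as_sum poly_sum slice_mean_sum[OF n2]
    by (simp add: mon slice_mean_smult[OF n2] s_def)
qed

lemma poly_translate_at_1: "t \<in> {-1..1} \<Longrightarrow> poly (translate n t p) 1 = poly p t"
proof -
  assume t: "t \<in> {-1..1}"
  have "pcompose p [:t:] = [:poly p t:]"
    by (rule poly_eq_poly_eq_iff[THEN iffD1]) (simp add: fun_eq_iff poly_pcompose)
  then show ?thesis using poly_translate[OF t, of 1 p] by (simp add: slice_mean_const[OF n2])
qed

text \<open>Both sides obey the same recursion with step 2, vanish for odd \<open>k\<close>, and at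
  k = 0 give the total mass. This replaces a change to polar coordinates.\<close>

lemma sphere_moment:
  fixes e :: "real^'n"
  assumes e: "norm e = 1"
  shows "(LINT y|surface_measure. (e \<bullet> y) ^ k) = sphere_area n * gmean \<alpha> (monom 1 k)"
proof (induction k rule: less_induct)
  case (less k)
  consider "odd k" | "k = 0" | j where "k = j + 2" by (metis add_2_eq_Suc' not0_implies_Suc odd_one One_nat_def)
  then show ?case
  proof cases
    case 1
    then show ?thesis
      using mixed_moment_odd[of k 0 e e] by (simp add: gmean_odd_moment[OF ultraspherical_alpha])
  next
    case 2
    then show ?thesis
      using measure_surface_measure_space[where 'a = "real^'n"] n
      by (simp add: monom_0 gmean_1[OF ultraspherical_alpha, unfolded one_pCons])
  next
    case 3
    have c: "real j + 2 * \<alpha> + 3 = real j + real n" using \<alpha> by simp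
    have "(real j + real n) * (LINT y|surface_measure. (e \<bullet> y) ^ k)
        = (real j + real n) * (sphere_area n * gmean \<alpha> (monom 1 k))"
      using sphere_moment_rec[OF e, of j] gmean_moment_rec[OF ultraspherical_alpha, of j, unfolded c] less[of j] n 3
      by (simp add: algebra_simps)
    then show ?thesis using n2 by simp
  qed
qed

lemma integral_poly_inner:
  fixes e :: "real^'n"
  assumes e: "norm e = 1"
  shows "(LINT y|surface_measure. poly p (e \<bullet> y)) = sphere_area n * gmean \<alpha> p"
proof -
  have "(LINT y|surface_measure. poly p (e \<bullet> y))
      = (\<Sum>i\<le>degree p. coeff p i * (LINT y|surface_measure. (e \<bullet> y) ^ i))"
    unfolding poly_altdef
    by (subst Bochner_Integration.integral_sum)
       (auto intro!: integrable_surface_measure continuous_intros)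
  also have "\<dots> = sphere_area n * gmean \<alpha> (\<Sum>i\<le>degree p. smult (coeff p i) (monom 1 i))"
    by (simp add: sphere_moment[OF e] gmean_simps sum_distrib_left mult_ac)
  finally show ?thesis by (simp only: poly_as_sum_monom[symmetric])
qed

text \<open>Integration over parallels, on monomials: with u = e \<bullet> y, the value f \<bullet>
  y is sqrt (1 - u^2) times a coordinate of a uniform point on the sphere one dimension lower,
  independent of u. No such disintegration is constructed; the closed forms of the moments are
  compared.\<close>

lemma mixed_moment:
  fixes e f :: "real^'n"
  assumes e: "norm e = 1" and f: "norm f = 1" and ef: "e \<bullet> f = 0"
  shows "(LINT y|surface_measure. (e \<bullet> y) ^ a * (f \<bullet> y) ^ b)
       = sphere_area n * gmean \<alpha> (monom 1 a * [:1, 0, -1:] ^ (b div 2)) * slice_mean n (monom 1 b)"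
proof -
  let ?W = "LINT y|surface_measure. (e \<bullet> y) ^ a * (f \<bullet> y) ^ b"
  define j where "j = b div 2"
  let ?V = "gmean \<alpha> (monom 1 a * [:1, 0, -1:] ^ j)"
  have V: "?V * (\<Prod>i<j. real a + 1 + 2 * real i)
       = gmean \<alpha> (monom 1 (a + 2 * j)) * (\<Prod>i<j. real n - 1 + 2 * real i)"
    by (rule gmean_monom_parallel[OF n2 \<alpha>])
  have Pa: "(\<Prod>i<j. real a + 1 + 2 * real i) \<noteq> 0" by (simp add: add_nonneg_eq_0_iff)
  consider "odd b" | "even b" "odd a" | "even b" "even a" by blast
  then show ?thesis
  proof cases
    case 1
    then have "?W = 0"
    proof (cases "even a")
      case False
      with 1 obtain m where m: "a + b = 2 * m" by (meson odd_add evenE)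
      then have "real ((2 * m) choose b) * ?W = 0"
        using mixed_moment_binomial[OF e f ef, of b m] 1 by (simp flip: m)
      moreover have "b \<le> 2 * m" using m by simp
      ultimately show ?thesis by (simp add: binomial_eq_0_iff)
    qed (simp add: mixed_moment_odd)
    with 1 show ?thesis by (simp add: slice_mean_odd[OF n2])
  next
    case 2
    then have "?V = 0" using V Pa gmean_odd_moment[OF ultraspherical_alpha, of "a + 2 * j"] by simp
    with 2 show ?thesis by (simp add: mixed_moment_odd j_def)
  next
    case 3
    then obtain l where a: "a = 2 * l" by blast
    have b: "b = 2 * j" using 3 by (simp add: j_def)
    have bin: "real ((2 * (l + j)) choose (2 * j)) * ?W
        = real ((l + j) choose j) * (sphere_area n * gmean \<alpha> (monom 1 (a + 2 * j)))"
      using mixed_moment_binomial[OF e f ef, of b "l + j"] by (simp add: a b sphere_moment[OF e] algebra_simps)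
    let ?Q = "\<Prod>i<j. 1 + 2 * real i" and ?N = "\<Prod>i<j. real n - 1 + 2 * real i"
      and ?A = "\<Prod>i<j. real a + 1 + 2 * real i"
    have N: "slice_mean n (monom 1 b) * ?N = ?Q" unfolding b by (rule slice_mean_even[OF n2])
    have Q: "?Q \<noteq> 0" by (simp add: add_nonneg_eq_0_iff)
    have "real ((2 * (l + j)) choose (2 * j)) * ?Q * (?W * ?A)
        = real ((l + j) choose j) * ?A * (sphere_area n * gmean \<alpha> (monom 1 (a + 2 * j)) * ?Q)"
      using arg_cong[OF bin, of "\<lambda>x. x * (?Q * ?A)"] by (simp add: mult_ac)
    also have "real ((l + j) choose j) * ?A = real ((2 * (l + j)) choose (2 * j)) * ?Q"
      using choose_double[of l j] by (simp add: a)
    finally have "?W * ?A = sphere_area n * gmean \<alpha> (monom 1 (a + 2 * j)) * ?Q"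
      using Q by (simp add: binomial_eq_0_iff del: prod_zero_iff)
    also have "\<dots> = sphere_area n * (gmean \<alpha> (monom 1 (a + 2 * j)) * ?N) * slice_mean n (monom 1 b)"
      by (simp flip: N)
    also have "\<dots> = (sphere_area n * ?V * slice_mean n (monom 1 b)) * ?A"
      unfolding V[symmetric] by (simp add: mult_ac)
    finally show ?thesis using Pa unfolding j_def[symmetric] by (subst (asm) mult_cancel_right) blast
  qed
qed

text \<open>Writing \<open>y\<close> as u x + s f reduces powers of y \<bullet> z to those of x
  \<bullet> z and f \<bullet> z. Evaluating the latter by \<open>mixed_moment\<close> produces
  exactly the coefficients of \<open>parallel_monom\<close>, so \<open>translate\<close> is the
  average over parallels around \<open>x\<close>.\<close>

lemma integral_poly_inner_poly_inner:
  fixes x y :: "real^'n"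
  assumes x: "norm x = 1" and y: "norm y = 1"
  shows "(LINT z|surface_measure. poly p (x \<bullet> z) * poly q (y \<bullet> z))
       = sphere_area n * gmean \<alpha> (p * translate n (x \<bullet> y) q)"
proof -
  define u where "u = x \<bullet> y"
  obtain f where f: "norm f = 1" "x \<bullet> f = 0" "y = u *\<^sub>R x + sqrt (1 - u\<^sup>2) *\<^sub>R f"
    using sphere_orthonormal_decomposition[OF x y] n n2 unfolding u_def by auto
  define s where "s = sqrt (1 - u\<^sup>2)"
  have "\<bar>u\<bar> \<le> 1" using Cauchy_Schwarz_ineq2[of x y] x y by (simp add: u_def)
  then have s2: "s\<^sup>2 = 1 - u\<^sup>2" by (simp add: s_def abs_square_le_1)
  have mon: "(LINT z|surface_measure. (x \<bullet> z) ^ k * (y \<bullet> z) ^ i)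
      = sphere_area n * gmean \<alpha> (monom 1 k * parallel_monom n u i)" for k i
  proof -
    have "(x \<bullet> z) ^ k * (y \<bullet> z) ^ i
        = (\<Sum>b\<le>i. (real (i choose b) * u ^ (i - b) * s ^ b) * ((x \<bullet> z) ^ (k + (i - b)) * (f \<bullet> z) ^ b))" for z
    proof -
      have "y \<bullet> z = s * (f \<bullet> z) + u * (x \<bullet> z)"
        by (subst f(3)) (simp add: s_def inner_add_left)
      show ?thesis
        unfolding \<open>y \<bullet> z = _\<close> binomial_ring sum_distrib_left
        by (intro sum.cong refl) (simp add: binomial_ring power_mult_distrib power_add[symmetric] mult_ac)
    qed
    then have "(LINT z|surface_measure. (x \<bullet> z) ^ k * (y \<bullet> z) ^ i)
        = (\<Sum>b\<le>i. (real (i choose b) * u ^ (i - b) * s ^ b)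
             * (LINT z|surface_measure. (x \<bullet> z) ^ (k + (i - b)) * (f \<bullet> z) ^ b))"
      by (simp, subst Bochner_Integration.integral_sum)
         (auto intro!: integrable_surface_measure continuous_intros)
    also have "\<dots> = (\<Sum>b\<le>i. sphere_area n * (real (i choose b) * u ^ (i - b) * (1 - u\<^sup>2) ^ (b div 2) * slice_mean n (monom 1 b))
        * gmean \<alpha> (monom 1 (k + (i - b)) * [:1, 0, -1:] ^ (b div 2)))"
    proof (intro sum.cong refl)
      fix b
      have "s ^ b * slice_mean n (monom 1 b) = (1 - u\<^sup>2) ^ (b div 2) * slice_mean n (monom 1 b)"
      proof (cases "even b")
        case True
        then have "s ^ b = (s\<^sup>2) ^ (b div 2)" by (simp flip: power_mult)
        then show ?thesis by (simp only: s2)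
      qed (simp add: slice_mean_odd[OF n2])
      note sb = this
      let ?G = "gmean \<alpha> (monom 1 (k + (i - b)) * [:1, 0, -1:] ^ (b div 2))"
      have "(real (i choose b) * u ^ (i - b) * s ^ b)
             * (LINT z|surface_measure. (x \<bullet> z) ^ (k + (i - b)) * (f \<bullet> z) ^ b)
          = sphere_area n * (real (i choose b) * u ^ (i - b) * (s ^ b * slice_mean n (monom 1 b))) * ?G"
        unfolding mixed_moment[OF x f(1,2)] by (simp only: mult_ac)
      then show "(real (i choose b) * u ^ (i - b) * s ^ b)
             * (LINT z|surface_measure. (x \<bullet> z) ^ (k + (i - b)) * (f \<bullet> z) ^ b)
          = sphere_area n * (real (i choose b) * u ^ (i - b) * (1 - u\<^sup>2) ^ (b div 2) * slice_mean n (monom 1 b)) * ?G"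
        unfolding sb by (simp only: mult.assoc)
    qed
    also have "\<dots> = sphere_area n * gmean \<alpha> (monom 1 k * parallel_monom n u i)"
    proof -
      have "monom 1 (k + (i - b)) * q = monom 1 k * (monom 1 (i - b) * q)" for b and q :: "real poly"
        by (simp add: mult_monom mult.assoc[symmetric])
      then show ?thesis
        unfolding parallel_monom_def sum_distrib_left mult_smult_right
        by (simp only: gmean_simps sum_distrib_left mult.assoc)
    qed
    finally show ?thesis .
  qed
  have "(LINT z|surface_measure. poly p (x \<bullet> z) * poly q (y \<bullet> z))
      = (LINT z|surface_measure. (\<Sum>k\<le>degree p. \<Sum>i\<le>degree q. (coeff p k * coeff q i) * ((x \<bullet> z) ^ k * (y \<bullet> z) ^ i)))"
    by (simp add: poly_altdef sum_product mult_ac)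
  also have "\<dots> = (\<Sum>k\<le>degree p. \<Sum>i\<le>degree q. (coeff p k * coeff q i) * (LINT z|surface_measure. (x \<bullet> z) ^ k * (y \<bullet> z) ^ i))"
    by (subst Bochner_Integration.integral_sum,
        force intro!: integrable_surface_measure continuous_intros,
        subst Bochner_Integration.integral_sum)
       (auto intro!: integrable_surface_measure continuous_intros)
  also have "\<dots> = sphere_area n * gmean \<alpha> ((\<Sum>k\<le>degree p. smult (coeff p k) (monom 1 k)) * translate n u q)"
    unfolding translate_def sum_product gmean_simps mon
    by (simp add: sum_distrib_left gmean_simps mult_ac)
  finally show ?thesis by (simp only: poly_as_sum_monom[symmetric] u_def)
qed

text \<open>Exchanging \<open>x\<close> and \<open>y\<close> in the preceding integral exchanges
  \<open>p\<close> and \<open>q\<close> and leaves x \<bullet> y unchanged.\<close>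

lemma gmean_translate_sym:
  assumes "t \<in> {-1..1}"
  shows "gmean \<alpha> (p * translate n t q) = gmean \<alpha> (q * translate n t p)"
proof -
  obtain x y :: "real^'n" where xy: "norm x = 1" "norm y = 1" "x \<bullet> y = t"
    using ex_unit_vectors_inner[OF _ assms, where 'a = "real^'n"] n n2 by auto
  have "sphere_area n * gmean \<alpha> (p * translate n t q) = sphere_area n * gmean \<alpha> (q * translate n t p)"
    using integral_poly_inner_poly_inner[OF xy(1,2), of p q]
      integral_poly_inner_poly_inner[OF xy(2,1), of q p] xy(3)
    by (simp add: inner_commute mult.commute)
  then show ?thesis using sphere_area_pos[of n] n2 by simp
qed

abbreviation P :: "nat \<Rightarrow> real poly" where "P \<equiv> jacobi_poly \<alpha> \<alpha>"

lemma translate_jacobi: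
  assumes t: "t \<in> {-1..1}"
  shows "translate n t (P k) = smult (poly (P k) t) (P k)"
proof -
  let ?r = "translate n t (P k)"
  have "jcoeff \<alpha> ?r j = 0" if "j < k" for j
  proof -
    have "gmean \<alpha> (P k * translate n t (P j)) = 0"
      using that degree_translate_le[of n t "P j"] degree_jacobi[OF ultraspherical_alpha]
      by (intro jacobi_orth_lower[OF ultraspherical_alpha]) simp
    then show ?thesis
      using gmean_translate_sym[OF t, of "P j" "P k"] by (simp add: jcoeff_def mult.commute)
  qed
  moreover have "?r = (\<Sum>j\<le>k. smult (jcoeff \<alpha> ?r j) (P j))"
    using degree_translate_le[of n t "P k"] degree_jacobi[OF ultraspherical_alpha]
    by (intro jacobi_expansion[OF ultraspherical_alpha]) simp
  ultimately have eq: "?r = smult (jcoeff \<alpha> ?r k) (P k)"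
    by (simp add: sum.lessThan_Suc[symmetric] lessThan_Suc_atMost[symmetric])
  \<comment> \<open>The eigenvalue is read off at 1: there \<open>P k\<close> is 1, and the
    translate of a polynomial has the value of that polynomial at \<open>t\<close>.\<close>
  then have "poly ?r 1 = jcoeff \<alpha> ?r k"
    by (metis poly_smult jacobi_at_1[OF ultraspherical_alpha] mult.right_neutral)
  then show ?thesis using eq poly_translate_at_1[OF t] by simp
qed

lemma integral_jacobi_jacobi:
  fixes x y :: "real^'n"
  assumes x: "norm x = 1" and y: "norm y = 1"
  shows "(LINT z|surface_measure. poly (P k) (x \<bullet> z) * poly (P k) (y \<bullet> z))
       = sphere_area n * gmean \<alpha> (P k * P k) * poly (P k) (x \<bullet> y)"
proof -
  have "x \<bullet> y \<in> {-1..1}" using Cauchy_Schwarz_ineq2[of x y] x y by (simp add: abs_le_iff)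
  then show ?thesis
    by (simp add: integral_poly_inner_poly_inner[OF x y] translate_jacobi gmean_simps)
qed

text \<open>Multiplication by \<open>P k (x \<bullet> y) = const * \<integral> P k (x \<bullet> z) * P k (y \<bullet> z) d\<omega>(z)\<close>
  averages kernels \<open>K x y * \<phi> x * \<phi> y\<close>.\<close>

lemma positive_kernel_mult_jacobi:
  fixes K :: "real^'n \<Rightarrow> real^'n \<Rightarrow> real"
  assumes K: "positive_kernel_on (sphere 0 1) K"
  shows "positive_kernel_on (sphere 0 1) (\<lambda>x y. K x y * poly (P k) (x \<bullet> y))"
  unfolding positive_kernel_on_def
proof (intro allI impI)
  fix N :: nat and x :: "nat \<Rightarrow> real^'n" and c :: "nat \<Rightarrow> real"
  assume x: "\<forall>i<N. x i \<in> sphere 0 1"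
  let ?C = "sphere_area n * gmean \<alpha> (P k * P k)"
  have C: "?C > 0"
    using sphere_area_pos[of n] n2 jacobi_square_pos[OF ultraspherical_alpha] by simp
  have "?C * (\<Sum>i<N. \<Sum>j<N. c i * c j * (K (x i) (x j) * poly (P k) (x i \<bullet> x j)))
      = (\<Sum>i<N. \<Sum>j<N. c i * c j * K (x i) (x j) * (?C * poly (P k) (x i \<bullet> x j)))"
    by (simp add: sum_distrib_left mult_ac)
  also have "\<dots> = (\<Sum>i<N. \<Sum>j<N. c i * c j * K (x i) (x j)
      * (LINT z|surface_measure. poly (P k) (x i \<bullet> z) * poly (P k) (x j \<bullet> z)))"
    using x by (intro sum.cong refl) (simp add: integral_jacobi_jacobi)
  also have "\<dots> = (LINT z|surface_measure. (\<Sum>i<N. \<Sum>j<N. c i * c j * K (x i) (x j)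
      * (poly (P k) (x i \<bullet> z) * poly (P k) (x j \<bullet> z))))"
    by (subst Bochner_Integration.integral_sum,
        force intro!: integrable_surface_measure continuous_intros,
        subst Bochner_Integration.integral_sum)
       (auto intro!: integrable_surface_measure continuous_intros)
  also have "\<dots> \<ge> 0"
  proof (rule Bochner_Integration.integral_nonneg)
    fix z
    have "0 \<le> (\<Sum>i<N. \<Sum>j<N. (c i * poly (P k) (x i \<bullet> z)) * (c j * poly (P k) (x j \<bullet> z)) * K (x i) (x j))"
      using K[unfolded positive_kernel_on_def, rule_format, of N x "\<lambda>i. c i * poly (P k) (x i \<bullet> z)"] x by simp
    then show "0 \<le> (\<Sum>i<N. \<Sum>j<N. c i * c j * K (x i) (x j) * (poly (P k) (x i \<bullet> z) * poly (P k) (x j \<bullet> z)))"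
      by (simp add: mult_ac)
  qed
  finally show "0 \<le> (\<Sum>i<N. \<Sum>j<N. c i * c j * (K (x i) (x j) * poly (P k) (x i \<bullet> x j)))"
    using C by (simp add: zero_le_mult_iff)
qed

lemma positive_kernel_jacobi:
  "positive_kernel_on (sphere 0 1 :: (real^'n) set) (\<lambda>x y. poly (P k) (x \<bullet> y))"
  using positive_kernel_mult_jacobi[OF positive_kernel_const[of 1]] by simp

text \<open>Positivity at two points with inner product \<open>t\<close> concerns a 2 by 2 matrix
  with unit diagonal and off-diagonal entry \<open>P k\<close> at \<open>t\<close>; the coefficient
  vectors (1, 1) and (1, -1) give the two bounds.\<close>

lemma abs_jacobi_le_1:
  assumes t: "t \<in> {-1..1}"
  shows "\<bar>poly (P k) t\<bar> \<le> 1"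
proof -
  obtain x y :: "real^'n" where xy: "norm x = 1" "norm y = 1" "x \<bullet> y = t"
    using ex_unit_vectors_inner[OF _ t, where 'a = "real^'n"] n n2 by auto
  have "0 \<le> (\<Sum>i<(2::nat). \<Sum>j<(2::nat). (if i = 0 then 1 else c) * (if j = 0 then 1 else c)
       * poly (P k) ((if i = 0 then x else y) \<bullet> (if j = 0 then x else y)))" for c
    using positive_kernel_jacobi[unfolded positive_kernel_on_def, rule_format, of 2 "\<lambda>i. if i = 0 then x else y" "\<lambda>i. if i = 0 then 1 else c" k]
      xy by simp
  then have "0 \<le> 1 + c * poly (P k) t + c * poly (P k) t + c * c" for c
    using xy jacobi_at_1[OF ultraspherical_alpha, of k]
    by (simp add: numeral_2_eq_2 norm_eq_1 inner_commute algebra_simps)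
  from this[of 1] this[of "-1"] show ?thesis by (simp add: abs_le_iff)
qed

end

subsection \<open>Positive kernels have nonnegative integral\<close>

definition kernel_continuous :: "('a::euclidean_space \<Rightarrow> 'a \<Rightarrow> real) \<Rightarrow> bool" where
  "kernel_continuous K \<longleftrightarrow> continuous_on (sphere 0 1 \<times> sphere 0 1) (\<lambda>p. K (fst p) (snd p))"

definition double_integral :: "('a::euclidean_space \<Rightarrow> 'a \<Rightarrow> real) \<Rightarrow> real" where
  "double_integral K = (LINT x|surface_measure. (LINT y|surface_measure. K x y))"

lemma pair_sigma_finite_surface_measure:
  "pair_sigma_finite (surface_measure :: 'a::euclidean_space measure) (surface_measure :: 'a measure)"
proof -
  interpret finite_measure "surface_measure :: 'a measure" by (rule finite_measure_surface_measure)
  show ?thesis ..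
qed

lemma kernel_bound:
  assumes "kernel_continuous K"
  obtains B where "B > 0" "\<forall>x\<in>sphere 0 1. \<forall>y\<in>sphere 0 1. \<bar>K x y\<bar> \<le> B"
proof -
  have "compact ((\<lambda>p. K (fst p) (snd p)) ` (sphere 0 1 \<times> sphere 0 1))"
    using assms unfolding kernel_continuous_def
    by (intro compact_continuous_image compact_Times) auto
  then have "bounded ((\<lambda>p. K (fst p) (snd p)) ` (sphere 0 1 \<times> sphere 0 1))" by (rule compact_imp_bounded)
  then obtain B where "B > 0" "\<forall>r\<in>(\<lambda>p. K (fst p) (snd p)) ` (sphere 0 1 \<times> sphere 0 1). norm r \<le> B"
    unfolding bounded_pos by blast
  then show thesis using that[of B] by force
qed

lemma kernel_measurable:
  fixes K :: "'a::euclidean_space \<Rightarrow> 'a \<Rightarrow> real"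
  assumes "kernel_continuous K"
  shows "(\<lambda>p. K (fst p) (snd p)) \<in> borel_measurable (surface_measure \<Otimes>\<^sub>M surface_measure)"
proof -
  have id: "(\<lambda>x::'a. x) \<in> surface_measure \<rightarrow>\<^sub>M borel"
    by (rule borel_measurable_surface_measure) (rule continuous_on_id)
  have "(\<lambda>p. (fst p, snd p)) \<in> (surface_measure \<Otimes>\<^sub>M surface_measure) \<rightarrow>\<^sub>M (borel :: ('a \<times> 'a) measure)"
    unfolding borel_prod[symmetric]
    by (intro measurable_Pair measurable_compose[OF measurable_fst id] measurable_compose[OF measurable_snd id])
  then have "(\<lambda>p. p) \<in> (surface_measure \<Otimes>\<^sub>M surface_measure)
      \<rightarrow>\<^sub>M restrict_space (borel :: ('a \<times> 'a) measure) (sphere 0 1 \<times> sphere 0 1)"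
    by (intro measurable_restrict_space2) (simp_all add: space_pair_measure space_surface_measure)
  from measurable_compose[OF this borel_measurable_continuous_on_restrict[OF assms[unfolded kernel_continuous_def]]]
  show ?thesis .
qed

lemma kernel_integrable:
  fixes K :: "'a::euclidean_space \<Rightarrow> 'a \<Rightarrow> real"
  assumes "kernel_continuous K"
  shows "integrable (surface_measure \<Otimes>\<^sub>M surface_measure) (\<lambda>p. K (fst p) (snd p))"
proof -
  interpret finite_measure "surface_measure :: 'a measure" by (rule finite_measure_surface_measure)
  interpret F: finite_measure "surface_measure \<Otimes>\<^sub>M surface_measure :: ('a \<times> 'a) measure"
    by (rule finite_measure_pair_measure) (rule finite_measure_surface_measure)+
  obtain B where "B > 0" "\<forall>x\<in>sphere 0 1. \<forall>y\<in>sphere 0 1. \<bar>K x y\<bar> \<le> B"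
    by (rule kernel_bound[OF assms])
  then show ?thesis
    by (intro F.integrable_const_bound[of _ B] kernel_measurable[OF assms] AE_I2)
       (auto simp: space_pair_measure space_surface_measure)
qed

lemma double_integral_pair:
  assumes "kernel_continuous K"
  shows "double_integral K = (LINT p|(surface_measure \<Otimes>\<^sub>M surface_measure). K (fst p) (snd p))"
proof -
  interpret pair_sigma_finite "surface_measure :: 'a measure" "surface_measure :: 'a measure"
    by (rule pair_sigma_finite_surface_measure)
  show ?thesis
    using integral_fst'[OF kernel_integrable[OF assms]] by (simp add: double_integral_def)
qed

lemma kernel_continuous_add: "kernel_continuous K \<Longrightarrow> kernel_continuous L \<Longrightarrow> kernel_continuous (\<lambda>x y. K x y + L x y)"
  unfolding kernel_continuous_def by (intro continuous_intros)

lemma kernel_continuous_diff: "kernel_continuous K \<Longrightarrow> kernel_continuous L \<Longrightarrow> kernel_continuous (\<lambda>x y. K x y - L x y)"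
  unfolding kernel_continuous_def by (intro continuous_intros)

lemma kernel_continuous_mult: "kernel_continuous K \<Longrightarrow> kernel_continuous L \<Longrightarrow> kernel_continuous (\<lambda>x y. K x y * L x y)"
  unfolding kernel_continuous_def by (intro continuous_intros)

lemma kernel_continuous_const: "kernel_continuous (\<lambda>x y. c)"
  unfolding kernel_continuous_def by (intro continuous_intros)

lemma kernel_continuous_sum:
  "(\<And>i. i \<in> I \<Longrightarrow> kernel_continuous (K i)) \<Longrightarrow> kernel_continuous (\<lambda>x y. \<Sum>i\<in>I. K i x y)"
  unfolding kernel_continuous_def by (intro continuous_intros)

lemma kernel_continuous_poly_inner: "kernel_continuous (\<lambda>x y. poly p (x \<bullet> y))"
  unfolding kernel_continuous_def by (intro continuous_intros)

lemma kernel_continuous_diagonal: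
  fixes K :: "'a::euclidean_space \<Rightarrow> 'a \<Rightarrow> real"
  assumes "kernel_continuous K"
  shows "continuous_on (sphere 0 1) (\<lambda>x. K x x)" and "kernel_continuous (\<lambda>x y. K x x)"
proof -
  show *: "continuous_on (sphere 0 1) (\<lambda>x. K x x)"
  proof -
    have "continuous_on (sphere 0 1) (\<lambda>x. K (fst (x, x)) (snd (x, x)))"
      by (rule continuous_on_compose2[OF assms[unfolded kernel_continuous_def]]) (auto intro!: continuous_intros)
    then show ?thesis by simp
  qed
  show "kernel_continuous (\<lambda>x y. K x x)"
    unfolding kernel_continuous_def by (rule continuous_on_compose2[OF *]) (auto intro!: continuous_intros)
qed

lemmas kernel_continuous_intros = kernel_continuous_add kernel_continuous_diff kernel_continuous_mult
  kernel_continuous_const kernel_continuous_sum kernel_continuous_poly_inner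

lemma double_integral_add:
  "kernel_continuous K \<Longrightarrow> kernel_continuous L \<Longrightarrow>
     double_integral (\<lambda>x y. K x y + L x y) = double_integral K + double_integral L"
  by (simp add: double_integral_pair kernel_continuous_intros kernel_integrable)

lemma double_integral_cmult: "double_integral (\<lambda>x y. c * K x y) = c * double_integral K"
  by (simp add: double_integral_def)

lemma double_integral_sum:
  assumes "\<And>i. i \<in> I \<Longrightarrow> kernel_continuous (K i)"
  shows "double_integral (\<lambda>x y. \<Sum>i\<in>I. K i x y) = (\<Sum>i\<in>I. double_integral (K i))"
  using assms by (simp add: double_integral_pair kernel_continuous_intros kernel_integrable)

lemma double_integral_mono:
  assumes "kernel_continuous K" "kernel_continuous L"
    and "\<And>x y. x \<in> sphere 0 1 \<Longrightarrow> y \<in> sphere 0 1 \<Longrightarrow> K x y \<le> L x y"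
  shows "double_integral K \<le> double_integral L"
  using assms
  by (auto simp: double_integral_pair kernel_integrable space_pair_measure space_surface_measure intro!: integral_mono)

lemma double_integral_const:
  "double_integral (\<lambda>x y :: 'a::euclidean_space. c) = c * (sphere_area DIM('a))\<^sup>2"
  by (simp add: double_integral_def measure_surface_measure_space power2_eq_square)

lemma positive_kernel_finite_sum:
  assumes K: "positive_kernel_on S K" and V: "finite V" "V \<subseteq> S"
  shows "0 \<le> (\<Sum>v\<in>V. \<Sum>w\<in>V. c v * c w * K v w)"
proof -
  obtain h where h: "bij_betw h {0..<card V} V" using ex_bij_betw_nat_finite[OF V(1)] by blast
  then have hb: "bij_betw h {..<card V} V" by (simp add: atLeast0LessThan)
  have "(\<Sum>v\<in>V. \<Sum>w\<in>V. c v * c w * K v w)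
      = (\<Sum>i<card V. \<Sum>j<card V. c (h i) * c (h j) * K (h i) (h j))"
    by (simp only: sum.reindex_bij_betw[OF hb, symmetric])
  moreover have "\<forall>i<card V. h i \<in> S" using bij_betwE[OF hb] V(2) by auto
  ultimately show ?thesis using K by (simp add: positive_kernel_on_def)
qed

lemma integral_simple_function_compose:
  fixes h :: "'b \<Rightarrow> real"
  assumes "finite_measure M" and g: "simple_function M g"
  shows "(LINT y|M. h (g y)) = (\<Sum>w\<in>g ` space M. h w * measure M (g -` {w} \<inter> space M))"
proof -
  interpret finite_measure M by fact
  have fin: "finite (g ` space M)" and sets: "g -` {w} \<inter> space M \<in> sets M" for w
    using g simple_functionD by auto
  have "(LINT y|M. h (g y)) = (LINT y|M. (\<Sum>w\<in>g ` space M. h w * indicator (g -` {w} \<inter> space M) y))"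
  proof (rule Bochner_Integration.integral_cong[OF refl])
    fix y assume y: "y \<in> space M"
    have "(\<Sum>w\<in>g ` space M. h w * indicator (g -` {w} \<inter> space M) y)
        = (\<Sum>w\<in>{g y}. h w * indicator (g -` {w} \<inter> space M) y)"
      using fin y by (intro sum.mono_neutral_right) (auto simp: indicator_def)
    then show "h (g y) = (\<Sum>w\<in>g ` space M. h w * indicator (g -` {w} \<inter> space M) y)"
      using y by simp
  qed
  also have "\<dots> = (\<Sum>w\<in>g ` space M. h w * measure M (g -` {w} \<inter> space M))"
    using sets by (subst Bochner_Integration.integral_sum)
      (auto intro!: integrable_mult_right integrable_real_indicator simp: emeasure_finite less_top[symmetric])
  finally show ?thesis .
qed

lemma sphere_simple_approximation:
  obtains g :: "nat \<Rightarrow> 'a::euclidean_space \<Rightarrow> 'a" where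
    "\<forall>i. simple_function surface_measure (g i)" "\<forall>i x. g i x \<in> sphere 0 1"
    "\<forall>x\<in>sphere 0 1. (\<lambda>i. g i x) \<longlonglongrightarrow> x"
proof -
  obtain e :: 'a where e: "norm e = 1" using vector_choose_size[of 1] by auto
  have "(\<lambda>x::'a. x) \<in> surface_measure \<rightarrow>\<^sub>M borel"
    by (rule borel_measurable_surface_measure) (rule continuous_on_id)
  from borel_measurable_implies_sequence_metric[OF this, of 0]
  obtain F :: "nat \<Rightarrow> 'a \<Rightarrow> 'a" where F: "\<And>i. simple_function surface_measure (F i)"
    "\<And>x. x \<in> sphere 0 1 \<Longrightarrow> (\<lambda>i. F i x) \<longlonglongrightarrow> x"
    unfolding space_surface_measure by blast
  define r where "r = (\<lambda>v::'a. if v = 0 then e else sgn v)"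
  show thesis
  proof (rule that[of "\<lambda>i x. r (F i x)"]; intro allI ballI)
    show "simple_function surface_measure (\<lambda>x. r (F i x))" for i
      by (rule simple_function_compose1[OF F(1)])
    show "r (F i x) \<in> sphere 0 1" for i x using e by (simp add: r_def norm_sgn)
    fix x :: 'a assume x: "x \<in> sphere 0 1"
    then have nz: "x \<noteq> 0" by auto
    have "sgn x = x" using x by (simp add: sgn_div_norm)
    then have "(\<lambda>i. sgn (F i x)) \<longlonglongrightarrow> x" using tendsto_sgn[OF F(2)[OF x] nz] by simp
    moreover have "\<forall>\<^sub>F i in sequentially. sgn (F i x) = r (F i x)"
      using tendsto_imp_eventually_ne[OF F(2)[OF x] nz] by eventually_elim (simp add: r_def)
    ultimately show "(\<lambda>i. r (F i x)) \<longlonglongrightarrow> x"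
      by (rule Lim_transform_eventually)
  qed
qed

text \<open>Positivity only speaks of finitely many points. Replacing both variables by the same
  simple function turns the integral into a finite quadratic form weighted by the measures of the
  fibres; continuity and two dominated limits do the rest.\<close>

lemma double_integral_nonneg:
  fixes K :: "'a::euclidean_space \<Rightarrow> 'a \<Rightarrow> real"
  assumes cont: "kernel_continuous K" and pos: "positive_kernel_on (sphere 0 1) K"
  shows "0 \<le> double_integral K"
proof -
  let ?\<sigma> = "surface_measure :: 'a measure"
  interpret finite_measure ?\<sigma> by (rule finite_measure_surface_measure)
  obtain g :: "nat \<Rightarrow> 'a \<Rightarrow> 'a" where "\<forall>i. simple_function ?\<sigma> (g i)" "\<forall>i x. g i x \<in> sphere 0 1"
    "\<forall>x\<in>sphere 0 1. (\<lambda>i. g i x) \<longlonglongrightarrow> x"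
    by (rule sphere_simple_approximation)
  then have g: "\<And>i. simple_function ?\<sigma> (g i)" "\<And>i x. g i x \<in> sphere 0 1"
    "\<And>x. x \<in> sphere 0 1 \<Longrightarrow> (\<lambda>i. g i x) \<longlonglongrightarrow> x"
    by blast+
  obtain B where "B > 0" and B: "\<forall>x\<in>sphere 0 1. \<forall>y\<in>sphere 0 1. \<bar>K x y\<bar> \<le> B"
    by (rule kernel_bound[OF cont])
  have lim: "(\<lambda>i. K (g i x) (g i y)) \<longlonglongrightarrow> K x y" if "x \<in> sphere 0 1" "y \<in> sphere 0 1" for x y
  proof -
    have "(\<lambda>i. K (fst (g i x, g i y)) (snd (g i x, g i y))) \<longlonglongrightarrow> K (fst (x, y)) (snd (x, y))"
      by (rule continuous_on_tendsto_compose[OF cont[unfolded kernel_continuous_def]])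
         (use g that in \<open>auto intro!: tendsto_Pair always_eventually\<close>)
    then show ?thesis by simp
  qed
  have inner: "(\<lambda>i. LINT y|?\<sigma>. K (g i x) (g i y)) \<longlonglongrightarrow> (LINT y|?\<sigma>. K x y)" if x: "x \<in> sphere 0 1" for x
  proof (rule integral_dominated_convergence[where w = "\<lambda>_. B"])
    show "(\<lambda>y. K x y) \<in> borel_measurable ?\<sigma>"
    proof (rule borel_measurable_surface_measure)
      have "continuous_on (sphere 0 1) (\<lambda>y. K (fst (x, y)) (snd (x, y)))"
        by (rule continuous_on_compose2[OF cont[unfolded kernel_continuous_def]])
           (use x in \<open>auto intro!: continuous_intros\<close>)
      then show "continuous_on (sphere 0 1) (K x)" by simp
    qed
    show "(\<lambda>y. K (g i x) (g i y)) \<in> borel_measurable ?\<sigma>" for i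
      by (rule borel_measurable_simple_function) (rule simple_function_compose1[OF g(1)])
  qed (use lim x B g(2) in \<open>auto simp: space_surface_measure intro!: AE_I2\<close>)
  have inner_eq: "(LINT y|?\<sigma>. K v (g i y)) = (\<Sum>w\<in>g i ` space ?\<sigma>. K v w * measure ?\<sigma> (g i -` {w} \<inter> space ?\<sigma>))" for v i
    by (rule integral_simple_function_compose[OF finite_measure_surface_measure g(1)])
  have "(\<lambda>i. LINT x|?\<sigma>. LINT y|?\<sigma>. K (g i x) (g i y)) \<longlonglongrightarrow> (LINT x|?\<sigma>. LINT y|?\<sigma>. K x y)"
  proof (rule integral_dominated_convergence[where w = "\<lambda>_. B * sphere_area DIM('a)"])
    show meas: "(\<lambda>x. LINT y|?\<sigma>. K (g i x) (g i y)) \<in> borel_measurable ?\<sigma>" for i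
      by (rule borel_measurable_simple_function) (rule simple_function_compose1[OF g(1)])
    show "(\<lambda>x. LINT y|?\<sigma>. K x y) \<in> borel_measurable ?\<sigma>"
      by (rule borel_measurable_LIMSEQ_real[where u = "\<lambda>i x. LINT y|?\<sigma>. K (g i x) (g i y)"])
         (simp_all add: inner meas space_surface_measure)
    show "AE x in ?\<sigma>. norm (LINT y|?\<sigma>. K (g i x) (g i y)) \<le> B * sphere_area DIM('a)" for i
    proof (rule AE_I2)
      fix x
      have "norm (LINT y|?\<sigma>. K (g i x) (g i y)) \<le> (LINT y|?\<sigma>. B)"
        by (rule Bochner_Integration.integral_norm_bound_integral)
           (use B g(2) in \<open>auto intro!: integrable_const_bound[of _ B] borel_measurable_simple_function
              simple_function_compose1[OF g(1)] AE_I2\<close>)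
      then show "norm (LINT y|?\<sigma>. K (g i x) (g i y)) \<le> B * sphere_area DIM('a)"
        by (simp add: measure_surface_measure_space mult.commute)
    qed
  qed (use inner in \<open>auto simp: space_surface_measure intro!: AE_I2\<close>)
  moreover have "0 \<le> (LINT x|?\<sigma>. LINT y|?\<sigma>. K (g i x) (g i y))" for i
  proof -
    let ?V = "g i ` space ?\<sigma>" and ?c = "\<lambda>w. measure ?\<sigma> (g i -` {w} \<inter> space ?\<sigma>)"
    have "(LINT x|?\<sigma>. LINT y|?\<sigma>. K (g i x) (g i y)) = (\<Sum>v\<in>?V. (LINT y|?\<sigma>. K v (g i y)) * ?c v)"
      by (rule integral_simple_function_compose[OF finite_measure_surface_measure g(1),
            where h = "\<lambda>v. LINT y|?\<sigma>. K v (g i y)"])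
    also have "\<dots> = (\<Sum>v\<in>?V. \<Sum>w\<in>?V. ?c v * ?c w * K v w)"
      by (simp add: inner_eq sum_distrib_left sum_distrib_right mult_ac)
    also have "\<dots> \<ge> 0"
      by (rule positive_kernel_finite_sum[OF pos]) (use g simple_functionD(1)[OF g(1)] in auto)
    finally show ?thesis .
  qed
  ultimately show ?thesis unfolding double_integral_def by (intro LIMSEQ_le_const) auto
qed

text \<open>A Schur product by hand: x \<bullet> y is a sum over basis vectors b of (x \<bullet> b)
  (y \<bullet> b), and each summand is absorbed into the coefficients of the quadratic form.\<close>

lemma positive_kernel_mult_half_chord:
  fixes K :: "'a::euclidean_space \<Rightarrow> 'a \<Rightarrow> real"
  assumes K: "positive_kernel_on S K"
  shows "positive_kernel_on S (\<lambda>x y. K x y * ((1 + x \<bullet> y) / 2))"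
  unfolding positive_kernel_on_def
proof (intro allI impI)
  fix N :: nat and x :: "nat \<Rightarrow> 'a" and c :: "nat \<Rightarrow> real"
  assume x: "\<forall>i<N. x i \<in> S"
  let ?q = "\<lambda>d. \<Sum>i<N. \<Sum>j<N. d i * d j * K (x i) (x j)"
  have q: "0 \<le> ?q d" for d using K x by (simp add: positive_kernel_on_def)
  have "(\<Sum>i<N. \<Sum>j<N. c i * c j * (K (x i) (x j) * ((1 + x i \<bullet> x j) / 2)))
      = (?q c + (\<Sum>i<N. \<Sum>j<N. \<Sum>b\<in>Basis. (c i * (x i \<bullet> b)) * (c j * (x j \<bullet> b)) * K (x i) (x j))) / 2"
    by (simp add: euclidean_inner[of "x _" "x _"] sum.distrib[symmetric] sum_divide_distrib
        sum_distrib_left algebra_simps add_divide_distrib)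
  also have "(\<Sum>i<N. \<Sum>j<N. \<Sum>b\<in>Basis. (c i * (x i \<bullet> b)) * (c j * (x j \<bullet> b)) * K (x i) (x j))
      = (\<Sum>b\<in>Basis. ?q (\<lambda>i. c i * (x i \<bullet> b)))"
    by (simp only: sum.swap[of _ Basis])
  also have "(?q c + (\<Sum>b\<in>Basis. ?q (\<lambda>i. c i * (x i \<bullet> b)))) / 2 \<ge> 0"
    using q by (simp add: sum_nonneg)
  finally show "0 \<le> (\<Sum>i<N. \<Sum>j<N. c i * c j * (K (x i) (x j) * ((1 + x i \<bullet> x j) / 2)))" .
qed

subsection \<open>Bounding the integral of a kernel\<close>

definition chord_poly :: "nat \<Rightarrow> real poly" where
  "chord_poly N = [:1 / 2, 1 / 2:] ^ N"

lemma poly_chord_poly: "poly (chord_poly N) u = ((1 + u) / 2) ^ N"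
  by (simp add: chord_poly_def add_divide_distrib)

lemma degree_chord_poly: "degree (chord_poly N) = N"
  by (simp add: chord_poly_def degree_power_eq)

lemma chord_poly_nonzero: "chord_poly N \<noteq> 0"
  by (simp add: chord_poly_def)

lemma positive_kernel_chord_poly:
  fixes S :: "'a::euclidean_space set"
  shows "positive_kernel_on S (\<lambda>x y. poly (chord_poly N) (x \<bullet> y))"
proof (induction N)
  case 0
  then show ?case using positive_kernel_const[of 1] by (simp add: poly_chord_poly)
next
  case (Suc N)
  then show ?case using positive_kernel_mult_half_chord[OF Suc] by (simp add: poly_chord_poly mult.commute)
qed

text \<open>The unit vectors \<open>(t, sqrt (1 - t\<^sup>2))\<close> and \<open>(v, sqrt (1 - v\<^sup>2))\<close> have distance at
  least \<open>\<bar>t - v\<bar>\<close>.\<close>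

lemma parallel_inner_bounds:
  fixes t v z :: real
  assumes "t \<in> {-1..1}" "v \<in> {-1..1}" "z \<in> {-1..1}"
  shows "t * v + sqrt (1 - t\<^sup>2) * sqrt (1 - v\<^sup>2) * z \<le> 1 - (t - v)\<^sup>2 / 2"
    and "-1 \<le> t * v + sqrt (1 - t\<^sup>2) * sqrt (1 - v\<^sup>2) * z"
proof -
  define a b where "a = sqrt (1 - t\<^sup>2)" and "b = sqrt (1 - v\<^sup>2)"
  have ab: "a\<^sup>2 = 1 - t\<^sup>2" "b\<^sup>2 = 1 - v\<^sup>2" "0 \<le> a" "0 \<le> b"
    using assms by (simp_all add: a_def b_def abs_square_le_1 abs_le_iff)
  have "\<bar>a * b * z\<bar> \<le> a * b * 1"
    unfolding abs_mult using assms(3) ab by (intro mult_mono) auto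
  then have abz: "\<bar>a * b * z\<bar> \<le> a * b" by simp
  have "0 \<le> (a - b)\<^sup>2" by simp
  then have "a * b \<le> (a\<^sup>2 + b\<^sup>2) / 2" by (simp add: power2_diff)
  then have le: "a * b \<le> 1 - (t\<^sup>2 + v\<^sup>2) / 2" unfolding ab by (simp add: field_simps)
  have "t * v + a * b * z \<le> t * v + 1 - (t\<^sup>2 + v\<^sup>2) / 2" using abz le by linarith
  also have "\<dots> = 1 - (t - v)\<^sup>2 / 2" by (simp add: power2_diff field_simps)
  finally show "t * v + sqrt (1 - t\<^sup>2) * sqrt (1 - v\<^sup>2) * z \<le> 1 - (t - v)\<^sup>2 / 2"
    by (simp add: a_def b_def)
  have "0 \<le> (t + v)\<^sup>2" by simp
  then have "-1 \<le> t * v - (1 - (t\<^sup>2 + v\<^sup>2) / 2)" by (simp add: power2_sum field_simps)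
  then show "-1 \<le> t * v + sqrt (1 - t\<^sup>2) * sqrt (1 - v\<^sup>2) * z"
    using abz le unfolding a_def[symmetric] b_def[symmetric] by linarith
qed

context ultraspherical
begin

section \<open>Means of \<open>chord_poly\<close>: slower decay than any geometric sequence\<close>

lemma gmean_chord_poly_pos: "0 < gmean \<alpha> (chord_poly N)"
proof -
  have nn: "0 \<le> poly (chord_poly N) u" if "u \<in> {-1..1}" for u
    using that by (simp add: poly_chord_poly)
  have "gmean \<alpha> (chord_poly N) \<noteq> 0"
    using gmean_eq_0_imp[OF ultraspherical_alpha nn] chord_poly_nonzero by blast
  then show ?thesis using gmean_nonneg[OF ultraspherical_alpha nn] by (simp add: less_le)
qed

text \<open>Integration by parts with q = \<open>chord_poly N\<close>, using (1 - u^2) q' = N (1 -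
  u) q and u = 2 (1 + u) / 2 - 1. The quotient of consecutive means tends to 1.\<close>

lemma gmean_chord_poly_Suc:
  "(real N + 2 * \<alpha> + 2) * gmean \<alpha> (chord_poly (Suc N)) = (real N + \<alpha> + 1) * gmean \<alpha> (chord_poly N)"
proof -
  have N: "poly ([:1, 0, -1:] * pderiv (chord_poly N)) u = real N * (1 - u) * ((1 + u) / 2) ^ N" for u
  proof (cases N)
    case 0
    then show ?thesis by (simp add: chord_poly_def)
  next
    case (Suc M)
    have "pderiv (chord_poly (Suc M)) = smult (real (Suc M) / 2) (chord_poly M)"
      unfolding chord_poly_def pderiv_power_Suc by (simp add: pderiv_pCons)
    moreover define X where "X = ((1 + u) / 2) ^ M"
    ultimately have "poly ([:1, 0, -1:] * pderiv (chord_poly N)) u = (1 - u\<^sup>2) * (real (Suc M) / 2 * X)"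
      by (simp only: Suc poly_mult poly_smult poly_chord_poly) (simp add: power2_eq_square)
    also have "\<dots> = real (Suc M) * (1 - u) * ((1 + u) / 2 * X)"
      by (simp add: power2_eq_square field_simps)
    finally show ?thesis by (simp add: Suc X_def)
  qed
  have "[:1, 0, -1:] * pderiv (chord_poly N) - smult (2 * \<alpha> + 2) ([:0, 1:] * chord_poly N)
      = smult (2 * (real N + \<alpha> + 1)) (chord_poly N) - smult (2 * (real N + 2 * \<alpha> + 2)) (chord_poly (Suc N))"
  proof (rule poly_eq_poly_eq_iff[THEN iffD1], rule ext)
    fix u :: real
    define X where "X = ((1 + u) / 2) ^ N"
    have "poly ([:1, 0, -1:] * pderiv (chord_poly N) - smult (2 * \<alpha> + 2) ([:0, 1:] * chord_poly N)) u
        = real N * (1 - u) * X - (2 * \<alpha> + 2) * (u * X)"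
      by (simp only: poly_diff N poly_smult) (simp add: poly_chord_poly X_def)
    also have "\<dots> = 2 * (real N + \<alpha> + 1) * X - 2 * (real N + 2 * \<alpha> + 2) * ((1 + u) / 2 * X)"
      by (simp add: field_simps)
    also have "\<dots> = poly (smult (2 * (real N + \<alpha> + 1)) (chord_poly N) - smult (2 * (real N + 2 * \<alpha> + 2)) (chord_poly (Suc N))) u"
      by (simp add: poly_chord_poly X_def)
    finally show "poly ([:1, 0, -1:] * pderiv (chord_poly N) - smult (2 * \<alpha> + 2) ([:0, 1:] * chord_poly N)) u
        = poly (smult (2 * (real N + \<alpha> + 1)) (chord_poly N) - smult (2 * (real N + 2 * \<alpha> + 2)) (chord_poly (Suc N))) u" .
  qed
  with jint_by_parts[OF ultraspherical_alpha, of "chord_poly N"]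
  have "gmean \<alpha> (smult (2 * (real N + \<alpha> + 1)) (chord_poly N) - smult (2 * (real N + 2 * \<alpha> + 2)) (chord_poly (Suc N))) = 0"
    by (simp add: gmean_def)
  then have "2 * ((real N + \<alpha> + 1) * gmean \<alpha> (chord_poly N)) = 2 * ((real N + 2 * \<alpha> + 2) * gmean \<alpha> (chord_poly (Suc N)))"
    by (simp only: gmean_diff[OF ultraspherical_alpha] gmean_smult[OF ultraspherical_alpha]
        eq_iff_diff_eq_0[symmetric] mult.assoc)
  then show ?thesis by simp
qed

lemma power_over_gmean_chord_poly_tendsto_0:
  assumes q: "0 \<le> q" "q < 1"
  shows "(\<lambda>N. q ^ N / gmean \<alpha> (chord_poly N)) \<longlonglongrightarrow> 0"
proof (rule summable_LIMSEQ_zero)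
  \<comment> \<open>Consecutive terms have quotients tending to \<open>q\<close>, so any ratio
    strictly between \<open>q\<close> and 1 works eventually.\<close>
  define c where "c = (1 + q) / 2"
  have c: "q < c" "c < 1" using q by (simp_all add: c_def)
  have "\<forall>\<^sub>F N in sequentially. (2 * \<alpha> + 2) / (c - q) \<le> real N"
    using filterlim_real_sequentially unfolding filterlim_at_top by blast
  then obtain N0 where N0: "(2 * \<alpha> + 2) / (c - q) \<le> real N" if "N \<ge> N0" for N
    unfolding eventually_sequentially by blast
  show "summable (\<lambda>N. q ^ N / gmean \<alpha> (chord_poly N))"
  proof (rule summable_ratio_test[OF c(2)])
    fix N assume N: "N \<ge> N0"
    let ?A = "gmean \<alpha> (chord_poly N)" and ?A' = "gmean \<alpha> (chord_poly (Suc N))"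
    have pos: "0 < ?A" "0 < ?A'" by (rule gmean_chord_poly_pos)+
    have d: "0 < real N + \<alpha> + 1" "0 < real N + 2 * \<alpha> + 2"
      using ultraspherical_alpha by (simp_all add: add_pos_nonneg add_nonneg_pos)
    have "2 * \<alpha> + 2 \<le> real N * (c - q)" using N0[OF N] c by (simp add: pos_divide_le_eq)
    then have "q * (2 * \<alpha> + 2) \<le> real N * (c - q)"
      using ultraspherical_alpha q by (smt (verit) mult_left_le_one_le)
    then have "q * (real N + 2 * \<alpha> + 2) \<le> c * real N" by (simp add: algebra_simps)
    also have "\<dots> \<le> c * (real N + \<alpha> + 1)" using c q ultraspherical_alpha by (intro mult_left_mono) auto
    finally have "q * (real N + 2 * \<alpha> + 2) * ?A' \<le> c * (real N + \<alpha> + 1) * ?A'"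
      using pos by (intro mult_right_mono) auto
    then have "(real N + \<alpha> + 1) * (q * ?A) \<le> (real N + \<alpha> + 1) * (c * ?A')"
      using gmean_chord_poly_Suc[of N] by (simp add: mult_ac)
    then have "q * ?A \<le> c * ?A'" using d by (simp add: mult_le_cancel_left_pos)
    then have "q ^ N * (q * ?A) \<le> q ^ N * (c * ?A')" using q by (intro mult_left_mono) auto
    then have "q ^ Suc N / ?A' \<le> c * (q ^ N / ?A)" using pos by (simp add: field_simps)
    then show "norm (q ^ Suc N / ?A') \<le> c * norm (q ^ N / ?A)"
      using pos q by simp
  qed
qed

lemma double_integral_poly_inner:
  "double_integral (\<lambda>x y :: real^'n. poly p (x \<bullet> y)) = (sphere_area n)\<^sup>2 * gmean \<alpha> p"
proof -
  have "double_integral (\<lambda>x y :: real^'n. poly p (x \<bullet> y))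
      = (LINT x|(surface_measure :: (real^'n) measure). sphere_area n * gmean \<alpha> p)"
    unfolding double_integral_def
    by (rule Bochner_Integration.integral_cong[OF refl])
       (simp add: space_surface_measure integral_poly_inner)
  then show ?thesis
    using measure_surface_measure_space[where 'a = "real^'n"] n by (simp add: power2_eq_square)
qed

lemma jcoeff_0: "jcoeff \<alpha> p 0 = gmean \<alpha> p"
  by (simp add: jcoeff_def jacobi_0[OF ultraspherical_alpha] gmean_1[OF ultraspherical_alpha])

text \<open>Up to positive factors the coefficient is the double integral of the product of two
  positive kernels, itself a positive kernel.\<close>

lemma jcoeff_chord_poly_nonneg: "0 \<le> jcoeff \<alpha> (chord_poly N) k"
proof -
  have "0 \<le> double_integral (\<lambda>x y :: real^'n. poly (chord_poly N) (x \<bullet> y) * poly (P k) (x \<bullet> y))"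
    by (intro double_integral_nonneg kernel_continuous_intros positive_kernel_mult_jacobi positive_kernel_chord_poly)
  also have "\<dots> = (sphere_area n)\<^sup>2 * gmean \<alpha> (chord_poly N * P k)"
    using double_integral_poly_inner[of "chord_poly N * P k"] by simp
  finally have "0 \<le> gmean \<alpha> (chord_poly N * P k)"
    using sphere_area_pos[of n] n2 by (simp add: zero_le_mult_iff)
  then show ?thesis
    unfolding jcoeff_def using jacobi_square_pos[OF ultraspherical_alpha, of k] by simp
qed

lemma chord_poly_expansion: "chord_poly N = (\<Sum>k\<le>N. smult (jcoeff \<alpha> (chord_poly N) k) (P k))"
  by (rule jacobi_expansion[OF ultraspherical_alpha]) (simp add: degree_chord_poly)

lemma translate_chord_poly_expansion:
  assumes t: "t \<in> {-1..1}"
  shows "translate n t (chord_poly N) = (\<Sum>k\<le>N. smult (jcoeff \<alpha> (chord_poly N) k * poly (P k) t) (P k))"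
proof -
  have "jcoeff \<alpha> (translate n t p) k = jcoeff \<alpha> p k * poly (P k) t" for p k
    using gmean_translate_sym[OF t, of "P k" p]
    by (simp add: jcoeff_def translate_jacobi[OF t] gmean_simps mult.commute)
  then show ?thesis
    using jacobi_expansion[OF ultraspherical_alpha, of "translate n t (chord_poly N)" N]
      degree_translate_le[of n t "chord_poly N"] by (simp add: degree_chord_poly)
qed

text \<open>The translate is a mean of powers whose bases lie between 0 and 1 - (t - v)^2 / 4 by
  \<open>parallel_inner_bounds\<close>.\<close>

lemma translate_chord_poly_bounds:
  assumes t: "t \<in> {-1..1}" and v: "v \<in> {-1..1}"
  shows "0 \<le> poly (translate n t (chord_poly N)) v"
    and "poly (translate n t (chord_poly N)) v \<le> (1 - (t - v)\<^sup>2 / 4) ^ N"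
proof -
  have eval: "poly (pcompose (chord_poly N) [:t * v, sqrt (1 - t\<^sup>2) * sqrt (1 - v\<^sup>2):]) z
      = ((1 + (t * v + sqrt (1 - t\<^sup>2) * sqrt (1 - v\<^sup>2) * z)) / 2) ^ N" for z
    by (simp add: poly_pcompose poly_chord_poly mult.commute)
  show "0 \<le> poly (translate n t (chord_poly N)) v"
    unfolding poly_translate[OF t v]
  proof (rule slice_mean_nonneg[OF n2], unfold eval, rule zero_le_power)
    fix z :: real assume z: "z \<in> {-1..1}"
    show "0 \<le> (1 + (t * v + sqrt (1 - t\<^sup>2) * sqrt (1 - v\<^sup>2) * z)) / 2"
      using parallel_inner_bounds(2)[OF t v z] by simp
  qed
  show "poly (translate n t (chord_poly N)) v \<le> (1 - (t - v)\<^sup>2 / 4) ^ N"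
    unfolding poly_translate[OF t v]
  proof (rule slice_mean_le[OF n2], unfold eval, rule power_mono)
    fix z :: real assume z: "z \<in> {-1..1}"
    show "(1 + (t * v + sqrt (1 - t\<^sup>2) * sqrt (1 - v\<^sup>2) * z)) / 2 \<le> 1 - (t - v)\<^sup>2 / 4"
      using parallel_inner_bounds(1)[OF t v z] by simp
    show "0 \<le> (1 + (t * v + sqrt (1 - t\<^sup>2) * sqrt (1 - v\<^sup>2) * z)) / 2"
      using parallel_inner_bounds(2)[OF t v z] by simp
  qed
qed

text \<open>Symmetry against the constant 1, which translation fixes.\<close>

lemma gmean_translate:
  assumes "t \<in> {-1..1}"
  shows "gmean \<alpha> (translate n t p) = gmean \<alpha> p"
  using gmean_translate_sym[OF assms, of "P 0" p] translate_jacobi[OF assms, of 0]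
  by (simp add: jacobi_0[OF ultraspherical_alpha])

lemma ex_jacobi_neg:
  assumes t: "-1 < t" "t < 1"
  shows "\<exists>k. poly (P k) t < 0"
proof (rule ccontr)
  assume "\<not> ?thesis"
  then have nn: "0 \<le> poly (P k) t" for k by (simp add: not_less)
  have t': "t \<in> {-1..1}" using t by simp
  let ?q = "(1 + t) / 2"
  have "1 \<le> ?q ^ N / gmean \<alpha> (chord_poly N)" for N
  proof -
    let ?f = "\<lambda>k. jcoeff \<alpha> (chord_poly N) k * poly (P k) t"
    have "?q ^ N = poly (translate n t (chord_poly N)) 1"
      by (simp add: poly_translate_at_1[OF t'] poly_chord_poly)
    also have "\<dots> = (\<Sum>k\<le>N. ?f k)"
      by (simp add: translate_chord_poly_expansion[OF t'] poly_sum jacobi_at_1[OF ultraspherical_alpha])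
    also have "\<dots> \<ge> ?f 0"
      by (intro member_le_sum) (simp_all add: nn jcoeff_chord_poly_nonneg)
    finally show ?thesis
      using gmean_chord_poly_pos[of N] by (simp add: jcoeff_0 jacobi_0[OF ultraspherical_alpha])
  qed
  moreover have "(\<lambda>N. ?q ^ N / gmean \<alpha> (chord_poly N)) \<longlonglongrightarrow> 0"
    by (rule power_over_gmean_chord_poly_tendsto_0) (use t in auto)
  ultimately have "(1::real) \<le> 0" by (intro LIMSEQ_le_const[where a = 1]) auto
  then show False by simp
qed

text \<open>Divided by its mean, the translated chord polynomial is a nonnegative density of mean 1.
  Away from x \<bullet> y = t it is at most q^N over that mean, hence negligible; near x \<bullet> y
  = t the kernel \<open>F\<close> is uniformly small.\<close>

lemma concentration:
  fixes F :: "real^'n \<Rightarrow> real^'n \<Rightarrow> real"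
  assumes t: "t \<in> {-1..1}" and cont: "kernel_continuous F"
    and zero: "\<And>x y. x \<in> sphere 0 1 \<Longrightarrow> y \<in> sphere 0 1 \<Longrightarrow> x \<bullet> y = t \<Longrightarrow> F x y = 0"
  shows "(\<lambda>N. double_integral (\<lambda>x y. F x y * poly (translate n t (chord_poly N)) (x \<bullet> y))
            / gmean \<alpha> (chord_poly N)) \<longlonglongrightarrow> 0"
proof (rule LIMSEQ_I)
  fix r :: real assume r: "0 < r"
  define w where "w = (sphere_area n)\<^sup>2"
  have w: "w > 0" using sphere_area_pos[of n] n2 by (simp add: w_def)
  \<comment> \<open>The part near the parallel then contributes exactly r / 2 after division by the
    mean.\<close>
  define \<epsilon> where "\<epsilon> = r / (2 * w)"
  have \<epsilon>: "\<epsilon> > 0" using r w by (simp add: \<epsilon>_def)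
  obtain B where B: "B > 0" "\<forall>x\<in>sphere 0 1. \<forall>y\<in>sphere 0 1. \<bar>F x y\<bar> \<le> B"
    by (rule kernel_bound[OF cont])
  let ?S = "sphere (0 :: real^'n) 1"
  have inner: "x \<bullet> y \<in> {-1..1}" if "x \<in> ?S" "y \<in> ?S" for x y
    using Cauchy_Schwarz_ineq2[of x y] that by (simp add: abs_le_iff)
  obtain \<delta> where \<delta>: "0 < \<delta>" "\<delta> < 1"
    "\<And>x y. x \<in> ?S \<Longrightarrow> y \<in> ?S \<Longrightarrow> \<bar>t - x \<bullet> y\<bar> < \<delta> \<Longrightarrow> \<bar>F x y\<bar> < \<epsilon>"
  proof -
    \<comment> \<open>The compact set where \<open>F\<close> is not small misses x \<bullet> y = t,
      so on it x \<bullet> y keeps a positive distance from \<open>t\<close>.\<close>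
    define C where "C = {p \<in> ?S \<times> ?S. \<epsilon> \<le> \<bar>F (fst p) (snd p)\<bar>}"
    have "continuous_on (?S \<times> ?S) (\<lambda>p. \<bar>F (fst p) (snd p)\<bar>)"
      using cont unfolding kernel_continuous_def by (intro continuous_intros)
    then have "closed ((?S \<times> ?S) \<inter> (\<lambda>p. \<bar>F (fst p) (snd p)\<bar>) -` {\<epsilon>..})"
      by (intro continuous_closed_preimage closed_Times) auto
    also have "(?S \<times> ?S) \<inter> (\<lambda>p. \<bar>F (fst p) (snd p)\<bar>) -` {\<epsilon>..} = C"
      by (auto simp: C_def)
    finally have "compact ((?S \<times> ?S) \<inter> C)"
      by (intro compact_Int_closed compact_Times) auto
    moreover have "(?S \<times> ?S) \<inter> C = C" by (auto simp: C_def)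
    ultimately have "compact C" by simp
    show thesis
    proof (cases "C = {}")
      case True
      show thesis
        by (rule that[of "1/2"]) (use True in \<open>auto simp: C_def not_le\<close>)
    next
      case False
      have "continuous_on C (\<lambda>p. \<bar>t - fst p \<bullet> snd p\<bar>)" by (intro continuous_intros)
      from continuous_attains_inf[OF \<open>compact C\<close> False this]
      obtain p where p: "p \<in> C" "\<forall>q\<in>C. \<bar>t - fst p \<bullet> snd p\<bar> \<le> \<bar>t - fst q \<bullet> snd q\<bar>" by blast
      have "t \<noteq> fst p \<bullet> snd p" using p(1) zero[of "fst p" "snd p"] \<epsilon> by (auto simp: C_def)
      then have pos: "0 < \<bar>t - fst p \<bullet> snd p\<bar>" by simp
      show thesis
      proof (rule that[of "min (1/2) \<bar>t - fst p \<bullet> snd p\<bar>"])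
        fix x y assume xy: "x \<in> ?S" "y \<in> ?S" "\<bar>t - x \<bullet> y\<bar> < min (1/2) \<bar>t - fst p \<bullet> snd p\<bar>"
        then have "(x, y) \<notin> C" using p(2) by force
        then show "\<bar>F x y\<bar> < \<epsilon>" using xy by (simp add: C_def)
      qed (use pos in auto)
    qed
  qed
  \<comment> \<open>This bounds the base 1 - (t - v)^2 / 4 once v is at distance at least \<delta>
    from t.\<close>
  define q where "q = 1 - \<delta>\<^sup>2 / 4"
  have "\<delta>\<^sup>2 < 1" using \<delta> by (simp add: power_less_one_iff)
  then have q: "0 \<le> q" "q < 1" using \<delta> by (simp_all add: q_def)
  have "(\<lambda>N. B * w * (q ^ N / gmean \<alpha> (chord_poly N))) \<longlonglongrightarrow> B * w * 0"
    by (intro tendsto_intros power_over_gmean_chord_poly_tendsto_0 q)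
  then have "\<forall>\<^sub>F N in sequentially. B * w * (q ^ N / gmean \<alpha> (chord_poly N)) < r / 2"
    by (rule order_tendstoD) (use r in simp)
  then obtain N0 where N0: "B * w * (q ^ N / gmean \<alpha> (chord_poly N)) < r / 2" if "N \<ge> N0" for N
    unfolding eventually_sequentially by blast
  show "\<exists>N0. \<forall>N\<ge>N0. norm (double_integral (\<lambda>x y. F x y * poly (translate n t (chord_poly N)) (x \<bullet> y))
            / gmean \<alpha> (chord_poly N) - 0) < r"
  proof (intro exI[of _ N0] allI impI)
    fix N assume N: "N \<ge> N0"
    let ?A = "gmean \<alpha> (chord_poly N)" and ?T = "translate n t (chord_poly N)"
    have A: "?A > 0" by (rule gmean_chord_poly_pos)
    have bound: "\<bar>F x y * poly ?T (x \<bullet> y)\<bar> \<le> \<epsilon> * poly ?T (x \<bullet> y) + B * q ^ N"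
      if xy: "x \<in> ?S" "y \<in> ?S" for x y
    proof -
      note T = translate_chord_poly_bounds[OF t inner[OF xy], of N]
      show ?thesis
      proof (cases "\<bar>t - x \<bullet> y\<bar> < \<delta>")
        case True
        then have "\<bar>F x y\<bar> * poly ?T (x \<bullet> y) \<le> \<epsilon> * poly ?T (x \<bullet> y)"
          using T \<delta>(3)[OF xy] by (intro mult_right_mono) auto
        moreover have "0 \<le> B * q ^ N" using B q by simp
        ultimately show ?thesis using T by (simp add: abs_mult)
      next
        case False
        have "\<delta>\<^sup>2 \<le> \<bar>t - x \<bullet> y\<bar>\<^sup>2" using False \<delta> by (intro power_mono) auto
        then have "1 - (t - x \<bullet> y)\<^sup>2 / 4 \<le> q" by (simp add: q_def)
        \<comment> \<open>Distance at most 2 keeps the base nonnegative, as monotonicity of powers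
          requires.\<close>
        moreover have "\<bar>t - x \<bullet> y\<bar>\<^sup>2 \<le> 2\<^sup>2" using t inner[OF xy] by (intro power_mono) auto
        ultimately have "(1 - (t - x \<bullet> y)\<^sup>2 / 4) ^ N \<le> q ^ N" by (intro power_mono) auto
        then have "\<bar>F x y\<bar> * poly ?T (x \<bullet> y) \<le> B * q ^ N"
          using T B xy by (intro mult_mono) auto
        moreover have "0 \<le> \<epsilon> * poly ?T (x \<bullet> y)" using T \<epsilon> by simp
        ultimately show ?thesis using T by (simp add: abs_mult)
      qed
    qed
    let ?G = "\<lambda>x y :: real^'n. \<epsilon> * poly ?T (x \<bullet> y) + B * q ^ N"
    let ?H = "\<lambda>x y. F x y * poly ?T (x \<bullet> y)"
    have contG: "kernel_continuous ?G" and contH: "kernel_continuous ?H"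
      by (intro kernel_continuous_intros cont)+
    have G: "double_integral ?G = w * (\<epsilon> * ?A + B * q ^ N)"
    proof -
      have "double_integral ?G = double_integral (\<lambda>x y :: real^'n. \<epsilon> * poly ?T (x \<bullet> y)) + double_integral (\<lambda>x y :: real^'n. B * q ^ N)"
        by (intro double_integral_add kernel_continuous_intros)
      moreover have "double_integral (\<lambda>x y :: real^'n. B * q ^ N) = B * q ^ N * w"
        using double_integral_const[where 'a = "real^'n", of "B * q ^ N"] n by (simp add: w_def)
      moreover have "double_integral (\<lambda>x y :: real^'n. \<epsilon> * poly ?T (x \<bullet> y)) = \<epsilon> * (w * ?A)"
        by (simp only: double_integral_cmult double_integral_poly_inner gmean_translate[OF t] w_def)
      ultimately show ?thesis by (simp only: distrib_left mult_ac)
    qed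
    have "double_integral ?H \<le> double_integral ?G"
      using bound by (intro double_integral_mono contG contH) (auto simp: abs_le_iff)
    moreover have "double_integral (\<lambda>x y. (-1) * ?H x y) \<le> double_integral ?G"
      using bound by (intro double_integral_mono contG contH kernel_continuous_mult kernel_continuous_const)
        (auto simp: abs_le_iff)
    ultimately have "\<bar>double_integral ?H\<bar> \<le> w * (\<epsilon> * ?A + B * q ^ N)"
      unfolding double_integral_cmult G by (simp add: abs_le_iff)
    then have "\<bar>double_integral ?H\<bar> / ?A \<le> w * (\<epsilon> * ?A + B * q ^ N) / ?A"
      using A by (intro divide_right_mono) auto
    also have "\<dots> = r / 2 + B * w * (q ^ N / ?A)" using A w by (simp add: \<epsilon>_def field_simps)
    also have "\<dots> < r" using N0[OF N] by linarith
    finally show "norm (double_integral ?H / ?A - 0) < r" using A by simp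
  qed
qed

lemma kernel_upper_bound:
  fixes K :: "real^'n \<Rightarrow> real^'n \<Rightarrow> real"
  assumes t: "t \<in> {-1..1}" and cont: "kernel_continuous K"
    and pos: "positive_kernel_on (sphere 0 1) K"
    and trace: "(LINT x|surface_measure. K x x) = 1"
    and zero: "\<And>x y. x \<in> sphere 0 1 \<Longrightarrow> y \<in> sphere 0 1 \<Longrightarrow> x \<bullet> y = t \<Longrightarrow> K x y = 0"
    and m: "\<And>k. m \<le> poly (P k) t"
  shows "(1 - m) * double_integral K \<le> - m * sphere_area n"
proof -
  let ?I = "double_integral K" and ?A = "\<lambda>N. gmean \<alpha> (chord_poly N)"
  let ?Q = "\<lambda>N. double_integral (\<lambda>x y. K x y * poly (translate n t (chord_poly N)) (x \<bullet> y))"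
  \<comment> \<open>The diagonal is the parallel x \<bullet> y = 1, where translation is the
    identity on \<open>chord_poly N\<close>. Subtracting \<open>K x x\<close> makes the kernel
    vanish there, so \<open>concentration\<close> applies with t = 1.\<close>
  let ?R = "\<lambda>N. double_integral (\<lambda>x y. (K x y - K x x) * poly (translate n 1 (chord_poly N)) (x \<bullet> y))"
  have one: "(1::real) \<in> {-1..1}" by simp
  have t1: "translate n 1 (chord_poly N) = chord_poly N" for N
    using translate_chord_poly_expansion[OF one, of N] chord_poly_expansion[of N]
    by (simp add: jacobi_at_1[OF ultraspherical_alpha])
  have limQ: "(\<lambda>N. ?Q N / ?A N) \<longlonglongrightarrow> 0" by (rule concentration[OF t cont zero])
  have limR: "(\<lambda>N. ?R N / ?A N) \<longlonglongrightarrow> 0"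
  proof (rule concentration[OF one])
    fix x y :: "real^'n" assume "x \<in> sphere 0 1" "y \<in> sphere 0 1" "x \<bullet> y = 1"
    then have "(norm (x - y))\<^sup>2 = 0"
      by (simp add: power2_norm_eq_inner inner_diff_left inner_diff_right inner_commute norm_eq_1)
    then show "K x y - K x x = 0" by simp
  qed (intro kernel_continuous_intros cont kernel_continuous_diagonal(2)[OF cont])
  have main: "0 \<le> ?Q N / ?A N - m * (?R N / ?A N + sphere_area n) - (1 - m) * ?I" for N
  proof -
    let ?a = "jcoeff \<alpha> (chord_poly N)"
    let ?J = "\<lambda>k. double_integral (\<lambda>x y. K x y * poly (P k) (x \<bullet> y))"
    have J: "0 \<le> ?J k" for k
      by (intro double_integral_nonneg kernel_continuous_intros cont positive_kernel_mult_jacobi pos)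
    have expand: "double_integral (\<lambda>x y. K x y * poly (\<Sum>k\<le>N. smult (c k) (P k)) (x \<bullet> y)) = (\<Sum>k\<le>N. c k * ?J k)" for c
    proof -
      have "double_integral (\<lambda>x y. K x y * poly (\<Sum>k\<le>N. smult (c k) (P k)) (x \<bullet> y))
          = double_integral (\<lambda>x y. \<Sum>k\<le>N. c k * (K x y * poly (P k) (x \<bullet> y)))"
        by (simp add: poly_sum sum_distrib_left mult_ac)
      also have "\<dots> = (\<Sum>k\<le>N. c k * ?J k)"
        by (subst double_integral_sum) (intro kernel_continuous_intros cont, simp add: double_integral_cmult)
      finally show ?thesis .
    qed
    \<comment> \<open>Integrating out y in the subtracted diagonal part leaves the trace, which is
      1.\<close>
    have D: "double_integral (\<lambda>x y. K x y * poly (chord_poly N) (x \<bullet> y)) = ?R N + sphere_area n * ?A N"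
    proof -
      have "double_integral (\<lambda>x y. K x y * poly (chord_poly N) (x \<bullet> y))
          = double_integral (\<lambda>x y. (K x y - K x x) * poly (chord_poly N) (x \<bullet> y) + K x x * poly (chord_poly N) (x \<bullet> y))"
        by (simp add: algebra_simps)
      also have "\<dots> = ?R N + double_integral (\<lambda>x y. K x x * poly (chord_poly N) (x \<bullet> y))"
        unfolding t1
        by (intro double_integral_add kernel_continuous_intros cont kernel_continuous_diagonal(2)[OF cont])
      also have "double_integral (\<lambda>x y. K x x * poly (chord_poly N) (x \<bullet> y))
          = (LINT x|surface_measure. K x x * (sphere_area n * ?A N))"
        unfolding double_integral_def
        by (rule Bochner_Integration.integral_cong[OF refl]) (simp add: space_surface_measure integral_poly_inner)
      finally show ?thesis by (simp add: trace)
    qed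
    have "?Q N - m * (?R N + sphere_area n * ?A N) - (1 - m) * ?A N * ?I
        = (\<Sum>k\<le>N. ?a k * poly (P k) t * ?J k) - m * (\<Sum>k\<le>N. ?a k * ?J k) - (1 - m) * ?A N * ?I"
      unfolding D[symmetric] translate_chord_poly_expansion[OF t] expand
      by (subst (2) chord_poly_expansion) (simp only: expand)
    also have "\<dots> = (\<Sum>k\<le>N. ?a k * (poly (P k) t - m) * ?J k) - (1 - m) * ?A N * ?I"
      by (simp add: sum_distrib_left sum_subtractf algebra_simps)
    \<comment> \<open>The summand k = 0 equals the subtracted term exactly, as its coefficient is
      the mean of \<open>chord_poly N\<close> and \<open>P 0\<close> is 1. All other summands are
      nonnegative.\<close>
    also have "(\<Sum>k\<le>N. ?a k * (poly (P k) t - m) * ?J k)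
        = (1 - m) * ?A N * ?I + (\<Sum>k\<in>{..N} - {0}. ?a k * (poly (P k) t - m) * ?J k)"
      by (subst sum.remove[of _ 0]) (simp_all add: jcoeff_0 jacobi_0[OF ultraspherical_alpha])
    finally have "?Q N - m * (?R N + sphere_area n * ?A N) - (1 - m) * ?A N * ?I
        = (\<Sum>k\<in>{..N} - {0}. ?a k * (poly (P k) t - m) * ?J k)" by simp
    also have "\<dots> \<ge> 0" using J m by (intro sum_nonneg mult_nonneg_nonneg jcoeff_chord_poly_nonneg) auto
    finally have "0 \<le> (?Q N - m * (?R N + sphere_area n * ?A N) - (1 - m) * ?A N * ?I) / ?A N"
      using gmean_chord_poly_pos[of N] by simp
    also have "\<dots> = ?Q N / ?A N - m * (?R N / ?A N + sphere_area n) - (1 - m) * ?I"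
      using gmean_chord_poly_pos[of N] by (simp add: field_simps)
    finally show ?thesis .
  qed
  have "(\<lambda>N. ?Q N / ?A N - m * (?R N / ?A N + sphere_area n) - (1 - m) * ?I)
      \<longlonglongrightarrow> 0 - m * (0 + sphere_area n) - (1 - m) * ?I"
    by (intro tendsto_intros limQ limR)
  then have "0 \<le> 0 - m * (0 + sphere_area n) - (1 - m) * ?I"
    by (rule LIMSEQ_le_const) (use main in blast)
  then show ?thesis by simp
qed

end

subsection \<open>Attainment of the minimum\<close>

lemma tendsto_0_if_square_tendsto_0:
  fixes a :: "'b \<Rightarrow> real"
  assumes "((\<lambda>k. (a k)\<^sup>2) \<longlongrightarrow> 0) F"
  shows "(a \<longlongrightarrow> 0) F"
  using tendsto_real_sqrt[OF assms] by (simp add: tendsto_rabs_zero_iff)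

definition jacobi_measure :: "real \<Rightarrow> real measure" where
  "jacobi_measure \<alpha> = density lborel (\<lambda>u. ennreal (indicator {-1..1} u * jacobi_weight \<alpha> \<alpha> u))"

lemma measurable_jacobi_weight [measurable]: "jacobi_weight \<alpha> \<beta> \<in> borel_measurable borel"
  unfolding jacobi_weight_def by measurable

lemma measurable_poly [measurable]: "poly p \<in> borel_measurable (borel :: real measure)"
  by (intro borel_measurable_continuous_onI continuous_intros)

lemma sets_jacobi_measure [measurable_cong]: "sets (jacobi_measure \<alpha>) = sets borel"
  by (simp add: jacobi_measure_def)

lemma space_jacobi_measure: "space (jacobi_measure \<alpha>) = UNIV"
  by (simp add: jacobi_measure_def)

lemma integral_jacobi_measure:
  fixes f :: "real \<Rightarrow> real"
  assumes [measurable]: "f \<in> borel_measurable borel"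
  shows "(LINT u|jacobi_measure \<alpha>. f u) = (LINT u|lborel. indicator {-1..1} u * jacobi_weight \<alpha> \<alpha> u * f u)"
  unfolding jacobi_measure_def
  by (subst integral_density) (auto simp: jacobi_weight_def)

lemma AE_jacobi_measure: "AE u in jacobi_measure \<alpha>. u \<in> {-1..1}"
  unfolding jacobi_measure_def by (subst AE_density) (auto simp: indicator_def)

lemma jint_jacobi_measure: "jint \<alpha> p = (LINT u|jacobi_measure \<alpha>. poly p u)"
  by (subst integral_jacobi_measure) (auto simp: jint_def set_lebesgue_integral_def mult.assoc)

lemma finite_measure_jacobi_measure:
  assumes "\<alpha> > -1"
  shows "finite_measure (jacobi_measure \<alpha>)"
proof (rule finite_measureI)
  have "integrable lborel (\<lambda>u. indicator {-1..1} u * jacobi_weight \<alpha> \<alpha> u)"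
    using set_integrable_jacobi_weight[OF assms assms] by (simp add: set_integrable_def)
  then have "(\<integral>\<^sup>+ u. ennreal (indicator {-1..1} u * jacobi_weight \<alpha> \<alpha> u) \<partial>lborel) < \<infinity>"
    by (subst nn_integral_eq_integral) (auto simp: jacobi_weight_def)
  then show "emeasure (jacobi_measure \<alpha>) (space (jacobi_measure \<alpha>)) \<noteq> \<infinity>"
    by (simp add: space_jacobi_measure) (simp add: jacobi_measure_def emeasure_density)
qed

context ultraspherical
begin

text \<open>Bessel's inequality; the norms \<open>gmean \<alpha> (P k * P k)\<close> are bounded since \<open>\<bar>P k\<bar> \<le> 1\<close>.\<close>

lemma bounded_coefficients_tendsto_0:
  fixes h :: "real \<Rightarrow> real"
  assumes h [measurable]: "h \<in> borel_measurable borel" and bound: "\<And>u. \<bar>h u\<bar> \<le> M"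
  shows "(\<lambda>k. LINT u|jacobi_measure \<alpha>. h u * poly (P k) u) \<longlonglongrightarrow> 0"
proof -
  let ?\<mu> = "jacobi_measure \<alpha>"
  interpret finite_measure ?\<mu> by (rule finite_measure_jacobi_measure[OF ultraspherical_alpha])
  have M: "0 \<le> M" using bound[of 0] by linarith
  have int_h2: "integrable ?\<mu> (\<lambda>u. h u * h u)"
  proof (rule integrable_const_bound[of _ "M * M"])
    have "\<bar>h u\<bar> * \<bar>h u\<bar> \<le> M * M" for u by (intro mult_mono bound M) simp
    then show "AE u in ?\<mu>. norm (h u * h u) \<le> M * M" by (simp add: abs_mult)
  qed measurable
  have int_poly: "integrable ?\<mu> (\<lambda>u. g u * poly p u)"
    if [measurable]: "g \<in> borel_measurable borel" and g: "\<And>u. \<bar>g u\<bar> \<le> C" for g :: "real \<Rightarrow> real" and C p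
  proof -
    have "compact (poly p ` {-1..1})" by (intro compact_continuous_image continuous_intros) auto
    then have "bounded (poly p ` {-1..1})" by (rule compact_imp_bounded)
    then obtain B where B: "B > 0" "\<forall>y\<in>poly p ` {-1..1}. norm y \<le> B" unfolding bounded_pos by blast
    have "AE u in ?\<mu>. norm (g u * poly p u) \<le> C * B"
      using AE_jacobi_measure
    proof eventually_elim
      case (elim u)
      have "0 \<le> C" using g[of u] by linarith
      then show ?case using B elim g[of u] by (auto simp: abs_mult intro!: mult_mono)
    qed
    then show ?thesis by (intro integrable_const_bound[of _ "C * B"]) auto
  qed
  define a where "a = (\<lambda>k. LINT u|?\<mu>. h u * poly (P k) u)"
  define c where "c = (\<lambda>k. jint \<alpha> (P k * P k))"
  have J: "jint \<alpha> 1 > 0" by (rule jint_1_pos[OF ultraspherical_alpha])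
  have c_pos: "0 < c k" for k
    using jacobi_square_pos[OF ultraspherical_alpha, of k] J by (simp add: c_def gmean_def zero_less_divide_iff)
  have c_le: "c k \<le> jint \<alpha> 1" for k
  proof -
    have "gmean \<alpha> (P k * P k) \<le> gmean \<alpha> 1"
    proof (rule gmean_le[OF ultraspherical_alpha])
      fix u :: real assume "u \<in> {-1..1}"
      then have "\<bar>poly (P k) u\<bar> * \<bar>poly (P k) u\<bar> \<le> 1 * 1" by (intro mult_mono abs_jacobi_le_1) auto
      then show "poly (P k * P k) u \<le> poly 1 u" by simp
    qed
    then show ?thesis using J by (simp add: c_def gmean_def field_simps)
  qed
  have bessel: "(\<Sum>k<N. (a k)\<^sup>2) \<le> jint \<alpha> 1 * (LINT u|?\<mu>. h u * h u)" for N
  proof -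
    \<comment> \<open>The orthogonal projection of \<open>h\<close> onto the first \<open>N\<close>
      Jacobi polynomials; expanding the integral of (h - S)^2 gives Bessel's inequality.\<close>
    define S where "S = (\<Sum>k<N. smult (a k / c k) (P k))"
    have hS: "(LINT u|?\<mu>. h u * poly S u) = (\<Sum>k<N. (a k)\<^sup>2 / c k)"
    proof -
      have "(LINT u|?\<mu>. h u * poly S u) = (LINT u|?\<mu>. (\<Sum>k<N. a k / c k * (h u * poly (P k) u)))"
        by (simp add: S_def poly_sum sum_distrib_left mult_ac)
      also have "\<dots> = (\<Sum>k<N. a k / c k * a k)"
        by (subst Bochner_Integration.integral_sum)
           (auto simp: a_def intro!: integrable_mult_right int_poly[OF h bound])
      finally show ?thesis by (simp add: power2_eq_square)
    qed
    have SS: "jint \<alpha> (S * S) = (\<Sum>k<N. (a k)\<^sup>2 / c k)"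
    proof -
      have jint_sum: "jint \<alpha> (\<Sum>i\<in>I. f i) = (\<Sum>i\<in>I. jint \<alpha> (f i))" for I :: "nat set" and f
        using gmean_sum[OF ultraspherical_alpha, of f I] J by (simp add: gmean_def sum_divide_distrib[symmetric])
      have "jint \<alpha> (S * S) = (\<Sum>j<N. \<Sum>k<N. (a j / c j) * ((a k / c k) * jint \<alpha> (P j * P k)))"
        unfolding S_def sum_product jint_sum by (simp add: jint_smult[OF ultraspherical_alpha] mult_ac)
      also have "\<dots> = (\<Sum>j<N. (a j / c j) * ((a j / c j) * c j))"
      proof (intro sum.cong refl)
        fix j assume j: "j \<in> {..<N}"
        have "(\<Sum>k<N. (a j / c j) * ((a k / c k) * jint \<alpha> (P j * P k)))
            = (\<Sum>k\<in>{j}. (a j / c j) * ((a k / c k) * jint \<alpha> (P j * P k)))"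
        proof (rule sum.mono_neutral_right)
          show "\<forall>k\<in>{..<N} - {j}. (a j / c j) * ((a k / c k) * jint \<alpha> (P j * P k)) = 0"
            using jacobi_orth[OF ultraspherical_alpha, of j] J by (auto simp: gmean_def)
        qed (use j in auto)
        then show "(\<Sum>k<N. (a j / c j) * ((a k / c k) * jint \<alpha> (P j * P k))) = (a j / c j) * ((a j / c j) * c j)"
          by (simp add: c_def)
      qed
      also have "\<dots> = (\<Sum>j<N. (a j)\<^sup>2 / c j)"
        using c_pos by (intro sum.cong refl) (simp add: power2_eq_square less_imp_neq[OF c_pos, symmetric])
      finally show ?thesis .
    qed
    have "0 \<le> (LINT u|?\<mu>. (h u - poly S u) * (h u - poly S u))"
      by (rule Bochner_Integration.integral_nonneg) simp
    also have "\<dots> = (LINT u|?\<mu>. h u * h u - 2 * (h u * poly S u) + 1 * poly (S * S) u)"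
      by (simp add: algebra_simps)
    also have "\<dots> = (LINT u|?\<mu>. h u * h u) - 2 * (LINT u|?\<mu>. h u * poly S u) + (LINT u|?\<mu>. 1 * poly (S * S) u)"
      using int_h2 int_poly[OF h bound, of S] int_poly[of "\<lambda>_. 1" 1 "S * S"] by simp
    also have "\<dots> = (LINT u|?\<mu>. h u * h u) - (\<Sum>k<N. (a k)\<^sup>2 / c k)"
      using SS by (simp add: hS jint_jacobi_measure)
    finally have "(\<Sum>k<N. (a k)\<^sup>2 / c k) \<le> (LINT u|?\<mu>. h u * h u)" by simp
    moreover have "(\<Sum>k<N. (a k)\<^sup>2) \<le> jint \<alpha> 1 * (\<Sum>k<N. (a k)\<^sup>2 / c k)"
      unfolding sum_distrib_left
    proof (rule sum_mono)
      fix k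
      have "c k * (a k)\<^sup>2 \<le> jint \<alpha> 1 * (a k)\<^sup>2" by (intro mult_right_mono c_le) simp
      then show "(a k)\<^sup>2 \<le> jint \<alpha> 1 * ((a k)\<^sup>2 / c k)" using c_pos[of k] by (simp add: field_simps)
    qed
    ultimately show ?thesis using J by (smt (verit) mult_left_mono)
  qed
  have "summable (\<lambda>k. (a k)\<^sup>2)"
    by (rule summableI_nonneg_bounded[OF _ bessel]) simp
  then have "(\<lambda>k. (a k)\<^sup>2) \<longlonglongrightarrow> 0" by (rule summable_LIMSEQ_zero)
  then show ?thesis unfolding a_def by (rule tendsto_0_if_square_tendsto_0)
qed

text \<open>The Riemann--Lebesgue lemma: truncate \<open>g\<close> where it exceeds a multiple of the weight.\<close>

lemma integrable_coefficients_tendsto_0: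
  fixes g :: "real \<Rightarrow> real"
  assumes g: "integrable lborel g" and supp: "\<And>u. u \<notin> {-1..1} \<Longrightarrow> g u = 0"
  shows "(\<lambda>k. LINT u|lborel. g u * poly (P k) u) \<longlonglongrightarrow> 0"
proof (rule LIMSEQ_I)
  fix r :: real assume r: "0 < r"
  have [measurable]: "g \<in> borel_measurable borel" using g by auto
  define w where "w = (\<lambda>u. indicator {-1..1} u * jacobi_weight \<alpha> \<alpha> u)"
  have w_nn: "0 \<le> w u" for u by (simp add: w_def jacobi_weight_def)
  have [measurable]: "w \<in> borel_measurable borel" unfolding w_def by measurable
  \<comment> \<open>Cutting at a multiple of the weight, not at a constant, makes the quotient by
    the weight bounded. The weight is positive inside the interval, so only the end points escape
    the limit.\<close>
  define G where "G = (\<lambda>j u. if \<bar>g u\<bar> \<le> real j * w u then g u else 0)"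
  have [measurable]: "G j \<in> borel_measurable borel" for j unfolding G_def by measurable
  have "(\<lambda>j. LINT u|lborel. \<bar>g u - G j u\<bar>) \<longlonglongrightarrow> (LINT u|(lborel :: real measure). 0)"
  proof (rule integral_dominated_convergence[where w = "\<lambda>u. \<bar>g u\<bar>"])
    have "AE u in lborel. u \<notin> {-1, 1 :: real}"
      by (intro AE_not_in finite_imp_null_set_lborel) auto
    then show "AE u in lborel. (\<lambda>j. \<bar>g u - G j u\<bar>) \<longlonglongrightarrow> 0"
    proof eventually_elim
      case (elim u)
      have "\<forall>\<^sub>F j in sequentially. \<bar>g u - G j u\<bar> = 0"
      proof (cases "u \<in> {-1..1}")
        case True
        then have w: "w u > 0" using elim by (auto simp: w_def jacobi_weight_def)
        have "\<forall>\<^sub>F j in sequentially. \<bar>g u\<bar> / w u \<le> real j"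
          using filterlim_real_sequentially unfolding filterlim_at_top by blast
        then show ?thesis by eventually_elim (use w in \<open>simp add: G_def pos_divide_le_eq\<close>)
      qed (simp add: G_def supp)
      then show ?case by (rule tendsto_eventually)
    qed
  qed (use g in \<open>auto simp: G_def\<close>)
  then have "\<forall>\<^sub>F j in sequentially. (LINT u|lborel. \<bar>g u - G j u\<bar>) < r / 2"
    by (intro order_tendstoD(2)[where a = "r / 2"]) (use r in auto)
  then obtain j where j: "(LINT u|lborel. \<bar>g u - G j u\<bar>) < r / 2"
    unfolding eventually_sequentially by blast
  \<comment> \<open>Where the weight is 0, division yields 0, and \<open>G j\<close> vanishes there
    too.\<close>
  define h where "h = (\<lambda>u. G j u / w u)"
  have Gh: "G j u = w u * h u" for u
    using w_nn[of u] by (cases "w u = 0") (simp_all add: h_def G_def)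
  have [measurable]: "h \<in> borel_measurable borel" unfolding h_def by measurable
  have h_bound: "\<bar>h u\<bar> \<le> real j" for u
    using w_nn[of u] by (cases "w u = 0") (auto simp: h_def G_def field_simps)
  have "(\<lambda>k. LINT u|jacobi_measure \<alpha>. h u * poly (P k) u) \<longlonglongrightarrow> 0"
    by (rule bounded_coefficients_tendsto_0[OF _ h_bound]) measurable
  from LIMSEQ_D[OF this, of "r / 2"] r
  obtain k0 where k0: "\<forall>k\<ge>k0. \<bar>LINT u|jacobi_measure \<alpha>. h u * poly (P k) u\<bar> < r / 2"
    by auto
  show "\<exists>k0. \<forall>k\<ge>k0. norm ((LINT u|lborel. g u * poly (P k) u) - 0) < r"
  proof (intro exI[of _ k0] allI impI)
    fix k assume k: "k \<ge> k0"
    have GP: "(LINT u|lborel. G j u * poly (P k) u) = (LINT u|jacobi_measure \<alpha>. h u * poly (P k) u)"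
      by (subst integral_jacobi_measure) (simp_all add: Gh w_def mult.assoc)
    have int_bound: "integrable lborel (\<lambda>u. f u * poly (P k) u)"
        and le: "\<bar>LINT u|lborel. f u * poly (P k) u\<bar> \<le> (LINT u|lborel. \<bar>f u\<bar>)"
      if f: "integrable lborel f" "\<And>u. u \<notin> {-1..1} \<Longrightarrow> f u = 0" for f :: "real \<Rightarrow> real"
    proof -
      have [measurable]: "f \<in> borel_measurable borel" using f by auto
      have b: "\<bar>f u * poly (P k) u\<bar> \<le> \<bar>f u\<bar>" for u
      proof (cases "u \<in> {-1..1}")
        case True
        then show ?thesis
          unfolding abs_mult using mult_left_le[OF abs_jacobi_le_1[OF True, of k], of "\<bar>f u\<bar>"] by simp
      qed (simp add: f(2))
      show *: "integrable lborel (\<lambda>u. f u * poly (P k) u)"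
        by (rule Bochner_Integration.integrable_bound[OF f(1)]) (use b in auto)
      have "\<bar>LINT u|lborel. f u * poly (P k) u\<bar> \<le> (LINT u|lborel. \<bar>f u * poly (P k) u\<bar>)"
        by (rule integral_abs_bound)
      also have "\<dots> \<le> (LINT u|lborel. \<bar>f u\<bar>)"
        by (rule integral_mono) (use * f(1) b in auto)
      finally show "\<bar>LINT u|lborel. f u * poly (P k) u\<bar> \<le> (LINT u|lborel. \<bar>f u\<bar>)" .
    qed
    have intG: "integrable lborel (G j)"
      by (rule Bochner_Integration.integrable_bound[OF g]) (auto simp: G_def)
    have suppG: "G j u = 0" if "u \<notin> {-1..1}" for u using supp[OF that] by (simp add: G_def)
    have "(LINT u|lborel. g u * poly (P k) u)
        = (LINT u|lborel. (g u - G j u) * poly (P k) u + G j u * poly (P k) u)"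
      by (simp add: algebra_simps)
    also have "\<dots> = (LINT u|lborel. (g u - G j u) * poly (P k) u) + (LINT u|lborel. G j u * poly (P k) u)"
      by (intro Bochner_Integration.integral_add int_bound) (use g intG supp suppG in auto)
    finally have "\<bar>LINT u|lborel. g u * poly (P k) u\<bar>
        \<le> \<bar>LINT u|lborel. (g u - G j u) * poly (P k) u\<bar> + \<bar>LINT u|lborel. G j u * poly (P k) u\<bar>"
      by simp
    moreover have "\<bar>LINT u|lborel. (g u - G j u) * poly (P k) u\<bar> \<le> (LINT u|lborel. \<bar>g u - G j u\<bar>)"
      by (intro le) (use g intG supp suppG in auto)
    ultimately show "norm ((LINT u|lborel. g u * poly (P k) u) - 0) < r"
      using j k0[rule_format, OF k] unfolding GP by simp
  qed
qed

text \<open>The product formula writes \<open>(P k t)\<^sup>2\<close> as the integral of \<open>P k\<close> against a density that does not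
  depend on \<open>k\<close>.\<close>

lemma jacobi_tendsto_0:
  assumes "n \<ge> 3" and t: "-1 < t" "t < 1"
  shows "(\<lambda>k. poly (P k) t) \<longlonglongrightarrow> 0"
proof -
  define \<beta> where "\<beta> = (real n - 4) / 2"
  have \<beta>: "\<beta> > -1" using assms by (simp add: \<beta>_def)
  have t': "t \<in> {-1..1}" using t by simp
  define c where "c = 1 - t\<^sup>2"
  have c: "0 < c" "c \<le> 1" using t by (simp_all add: c_def abs_square_less_1)
  define w where "w = (\<lambda>z. indicator {-1..1} z * jacobi_weight \<beta> \<beta> z)"
  have int_w: "integrable lborel w"
    using set_integrable_jacobi_weight[OF \<beta> \<beta>] by (simp add: w_def set_integrable_def)
  \<comment> \<open>The density of v = t^2 + (1 - t^2) z when z follows the normalised weight for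
    \<beta>: the product formula with both arguments equal to \<open>t\<close>. For n = 2 this law
    consists of two atoms, hence n \<ge> 3.\<close>
  define g where "g = (\<lambda>v. w (- t\<^sup>2 / c + (1 / c) * v) / (c * jint \<beta> 1))"
  have square: "(poly (P k) t)\<^sup>2 = (LINT v|lborel. g v * poly (P k) v)" for k
  proof -
    have "(poly (P k) t)\<^sup>2 = poly (translate n t (P k)) t"
      by (simp add: translate_jacobi[OF t'] power2_eq_square)
    also have "\<dots> = gmean \<beta> (pcompose (P k) [:t\<^sup>2, c:])"
      using assms(1) c by (simp add: poly_translate[OF t' t'] slice_mean_def \<beta>_def c_def power2_eq_square)
    also have "\<dots> = (LINT z|lborel. w z * poly (P k) (t\<^sup>2 + c * z)) / jint \<beta> 1"
      by (simp add: gmean_def jint_def set_lebesgue_integral_def w_def poly_pcompose mult_ac)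
    also have "(LINT z|lborel. w z * poly (P k) (t\<^sup>2 + c * z))
        = \<bar>1 / c\<bar> * (LINT v|lborel. w (- t\<^sup>2 / c + (1 / c) * v) * poly (P k) (t\<^sup>2 + c * (- t\<^sup>2 / c + (1 / c) * v)))"
      using lborel_integral_real_affine[of "1 / c" "\<lambda>z. w z * poly (P k) (t\<^sup>2 + c * z)" "- t\<^sup>2 / c"] c
      by simp
    also have "\<dots> / jint \<beta> 1 = (LINT v|lborel. g v * poly (P k) v)"
    proof -
      have "t\<^sup>2 + c * (- t\<^sup>2 / c + (1 / c) * v) = v" for v using c by (simp add: field_simps)
      moreover have "g v * poly (P k) v = (1 / (c * jint \<beta> 1)) * (w (- t\<^sup>2 / c + (1 / c) * v) * poly (P k) v)" for v
        by (simp add: g_def)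
      ultimately show ?thesis using c by (simp only: integral_mult_right_zero) simp
    qed
    finally show ?thesis .
  qed
  have "integrable lborel (\<lambda>v. w (- t\<^sup>2 / c + (1 / c) * v))"
    by (rule lborel_integrable_real_affine[OF int_w]) (use c in simp)
  then have int_g: "integrable lborel g" unfolding g_def by (rule integrable_divide_zero)
  have supp: "g v = 0" if "v \<notin> {-1..1}" for v
  proof -
    have "- t\<^sup>2 / c + (1 / c) * v = (v - t\<^sup>2) / c" by (simp add: diff_divide_distrib)
    moreover have "(v - t\<^sup>2) / c \<notin> {-1..1}"
    proof
      assume "(v - t\<^sup>2) / c \<in> {-1..1}"
      then have "v - t\<^sup>2 \<le> c" "- c \<le> v - t\<^sup>2" using c by (simp_all add: field_simps)
      then show False using that c zero_le_power2[of t] unfolding c_def atLeastAtMost_iff by linarith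
    qed
    ultimately show ?thesis by (simp add: g_def w_def)
  qed
  have "(\<lambda>k. (poly (P k) t)\<^sup>2) \<longlonglongrightarrow> 0"
    unfolding square by (rule integrable_coefficients_tendsto_0[OF int_g supp])
  then show ?thesis by (rule tendsto_0_if_square_tendsto_0)
qed

text \<open>In the plane the product formula is d'Alembert's equation, so \<open>P k (cos (j \<theta>)) = cos (j c)\<close>
  whenever \<open>P k (cos \<theta>) = cos c\<close>.\<close>

lemma finite_range_jacobi:
  assumes "n = 2" and t: "-1 < t" "t < 1" and rat: "arccos t / pi \<in> \<rat>"
  shows "finite (range (\<lambda>k. poly (P k) t))"
proof -
  define \<theta> where "\<theta> = arccos t"
  have cos\<theta>: "cos \<theta> = t" using t by (simp add: \<theta>_def)
  from rat obtain i N :: int where N: "N > 0" "\<theta> / pi = real_of_int i / real_of_int N"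
    unfolding \<theta>_def by (elim Rats_cases')
  define m where "m = nat N"
  have m: "m > 0" "\<theta> * real m = pi * real_of_int i"
    using N by (simp_all add: m_def field_simps)
  have in_set: "poly (P k) t \<in> (\<lambda>l. cos (pi * real l / real m)) ` {..m}" for k
  proof -
    define c where "c = arccos (poly (P k) t)"
    have b: "\<bar>poly (P k) t\<bar> \<le> 1" using t by (intro abs_jacobi_le_1) auto
    have c: "cos c = poly (P k) t" "0 \<le> c" "c \<le> pi"
      using b arccos_lbound[of "poly (P k) t"] arccos_ubound[of "poly (P k) t"]
      by (simp_all add: c_def abs_le_iff)
    have dAlembert: "2 * poly (P k) (cos x) * poly (P k) (cos y) = poly (P k) (cos (x + y)) + poly (P k) (cos (x - y))" for x y
    proof -
      have x: "cos x \<in> {-1..1}" and y: "cos y \<in> {-1..1}" by auto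
      have "poly (P k) (cos x) * poly (P k) (cos y) = poly (translate n (cos x) (P k)) (cos y)"
        by (simp add: translate_jacobi[OF x])
      \<comment> \<open>For n = 2 the slice mean takes z = 1 and z = -1. The signs of the sines only
        decide which of the two values belongs to x + y and which to x - y.\<close>
      also have "\<dots> = (poly (P k) (cos x * cos y + \<bar>sin x\<bar> * \<bar>sin y\<bar>) + poly (P k) (cos x * cos y - \<bar>sin x\<bar> * \<bar>sin y\<bar>)) / 2"
      proof -
        have "slice_mean n q = (poly q 1 + poly q (-1)) / 2" for q
          using assms(1) by (simp add: slice_mean_def)
        moreover have "sqrt (1 - (cos x)\<^sup>2) = \<bar>sin x\<bar>" for x :: real
          by (simp flip: sin_squared_eq)
        ultimately show ?thesis unfolding poly_translate[OF x y] by (simp add: poly_pcompose)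
      qed
      finally show ?thesis
        by (cases "0 \<le> sin x"; cases "0 \<le> sin y") (simp_all add: cos_add cos_diff add.commute)
    qed
    have "poly (P k) (cos (real j * \<theta>)) = cos (real j * c)" for j
    proof (induction j rule: induct_nat_012)
      case 0
      then show ?case by (simp add: jacobi_at_1[OF ultraspherical_alpha])
    next
      case 1
      then show ?case by (simp add: cos\<theta> c)
    next
      case (ge2 j)
      have "poly (P k) (cos (real (Suc (Suc j)) * \<theta>)) = 2 * cos (real (Suc j) * c) * cos c - cos (real j * c)"
        using dAlembert[of "real (Suc j) * \<theta>" \<theta>] ge2 by (simp add: cos\<theta> c algebra_simps)
      also have "\<dots> = cos (real (Suc (Suc j)) * c)"
        using cos_add[of "real (Suc j) * c" c] cos_diff[of "real (Suc j) * c" c] by (simp add: algebra_simps)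
      finally show ?case .
    qed
    \<comment> \<open>The factor 2 yields a multiple of 2 pi whatever the parity of
      \<open>i\<close>. Then \<open>cos (2 m c)\<close> is \<open>P k\<close> at 1, that is 1, which
      confines \<open>c\<close> to multiples of pi / m.\<close>
    moreover have "real (2 * m) * \<theta> = 2 * pi * real_of_int i" using m(2) by (simp add: algebra_simps)
    ultimately have "cos (real (2 * m) * c) = poly (P k) (cos (2 * pi * real_of_int i))" by metis
    also have "\<dots> = 1"
      using jacobi_at_1[OF ultraspherical_alpha, of k] by (simp add: cos_int_2pin)
    finally obtain l :: int where l: "real (2 * m) * c = real_of_int l * 2 * pi"
      unfolding cos_one_2pi_int by blast
    then have cl: "c = pi * real_of_int l / real m" using m by (simp add: field_simps)
    have "0 \<le> l" "l \<le> int m"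
    proof -
      have "0 \<le> pi * real_of_int l" using c(2) m unfolding cl by (simp add: zero_le_divide_iff)
      then show "0 \<le> l" using pi_gt_zero by (simp add: zero_le_mult_iff)
      have "pi * real_of_int l \<le> pi * real m" using c(3) m unfolding cl by (simp add: pos_divide_le_eq)
      then show "l \<le> int m" by simp
    qed
    then show ?thesis using cl c(1) by (intro image_eqI[of _ _ "nat l"]) simp_all
  qed
  then have "range (\<lambda>k. poly (P k) t) \<subseteq> (\<lambda>l. cos (pi * real l / real m)) ` {..m}" by blast
  then show ?thesis by (rule finite_subset) simp
qed

end

subsection \<open>Optimal values\<close>

context ultraspherical
begin

lemma sphere_area_n_pos: "0 < sphere_area n"
  using sphere_area_pos[of n] n2 by simp

lemma lp_feasible_iff:
  "lp_feasible n t f \<longleftrightarrow> (\<forall>k. 0 \<le> f k) \<and> f sums (1 / sphere_area n) \<and>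
     summable (\<lambda>k. f (Suc k) * poly (P (Suc k)) t) \<and>
     f 0 + (\<Sum>k. f (Suc k) * poly (P (Suc k)) t) = 0"
  unfolding lp_feasible_def Let_def \<alpha> ..

text \<open>Weak duality: bound every \<open>P (Suc k)\<close> at \<open>t\<close> below by
  \<open>m\<close> in the second constraint and eliminate the tail of \<open>f\<close> by the
  first.\<close>

lemma lp_upper_bound:
  assumes f: "lp_feasible n t f" and m: "\<And>k. m \<le> poly (P k) t" "m < 0"
  shows "lp_objective n f \<le> sphere_area n * (m / (m - 1))"
proof -
  let ?\<omega> = "sphere_area n"
  note \<omega> = sphere_area_n_pos
  have nn: "0 \<le> f k" for k using f by (simp add: lp_feasible_iff)
  have "(\<lambda>k. f (Suc k)) sums (1 / ?\<omega> - f 0)"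
    using f by (simp add: lp_feasible_iff sums_Suc_iff)
  then have ms: "(\<lambda>k. f (Suc k) * m) sums ((1 / ?\<omega> - f 0) * m)" by (rule sums_mult2)
  have "(1 / ?\<omega> - f 0) * m = (\<Sum>k. f (Suc k) * m)" using ms by (rule sums_unique)
  also have "\<dots> \<le> (\<Sum>k. f (Suc k) * poly (P (Suc k)) t)"
    using f ms m nn by (intro suminf_le mult_left_mono) (auto simp: lp_feasible_iff sums_iff)
  also have "\<dots> = - f 0" using f by (simp add: lp_feasible_iff)
  finally have "(1 - m) * f 0 \<le> - m / ?\<omega>" by (simp add: algebra_simps)
  then have "f 0 \<le> (- m / ?\<omega>) / (1 - m)"
    using m(2) by (subst pos_le_divide_eq) (simp_all add: mult.commute)
  then have "?\<omega>\<^sup>2 * f 0 \<le> ?\<omega>\<^sup>2 * ((- m / ?\<omega>) / (1 - m))" by (intro mult_left_mono) auto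
  also have "\<dots> = ?\<omega> * (m / (m - 1))" using \<omega> m(2) by (simp add: power2_eq_square field_simps)
  finally show ?thesis by (simp add: lp_objective_def)
qed

text \<open>With two nonzero entries a at 0 and b at \<open>k\<close>, the constraints become a + b
  = 1 / \<open>sphere_area n\<close> and a + b p = 0; these are the solutions.\<close>

definition extremal_coeff :: "real \<Rightarrow> nat \<Rightarrow> nat \<Rightarrow> real" where
  "extremal_coeff p k j = (if j = 0 then - p / ((1 - p) * sphere_area n)
     else if j = k then 1 / ((1 - p) * sphere_area n) else 0)"

context
  fixes k :: nat and t p :: real
  assumes p: "poly (P k) t = p" "p < 0"
begin

lemma k_pos: "0 < k"
  using p jacobi_0[OF ultraspherical_alpha] by (cases k) auto

lemma lp_feasible_extremal: "lp_feasible n t (extremal_coeff p k)"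
proof -
  let ?\<omega> = "sphere_area n"
  let ?a = "- p / ((1 - p) * ?\<omega>)" and ?b = "1 / ((1 - p) * ?\<omega>)"
  note \<omega> = sphere_area_n_pos
  have nn: "0 \<le> extremal_coeff p k j" for j
    using p \<omega> by (simp add: extremal_coeff_def divide_nonpos_pos mult_nonneg_nonneg)
  have "(\<lambda>j. (if j = 0 then ?a else 0) + (if j = k then ?b else 0)) sums (?a + ?b)"
    by (intro sums_add sums_single)
  moreover have "(\<lambda>j. (if j = 0 then ?a else 0) + (if j = k then ?b else 0)) = extremal_coeff p k"
    using k_pos by (auto simp: extremal_coeff_def fun_eq_iff)
  moreover have "?a + ?b = 1 / ?\<omega>" using p \<omega> by (simp add: field_simps)
  ultimately have sums: "extremal_coeff p k sums (1 / ?\<omega>)" by simp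
  have "(\<lambda>j. if j = k - 1 then ?b * p else 0) sums (?b * p)" by (rule sums_single)
  moreover have "(\<lambda>j. if j = k - 1 then ?b * p else 0)
      = (\<lambda>j. extremal_coeff p k (Suc j) * poly (P (Suc j)) t)"
    using k_pos p(1) by (auto simp: extremal_coeff_def fun_eq_iff)
  ultimately have "(\<lambda>j. extremal_coeff p k (Suc j) * poly (P (Suc j)) t) sums (?b * p)" by simp
  then show ?thesis
    using nn sums by (simp add: lp_feasible_iff sums_iff) (simp add: extremal_coeff_def)
qed

lemma lp_objective_extremal: "lp_objective n (extremal_coeff p k) = sphere_area n * (p / (p - 1))"
  using p sphere_area_n_pos by (simp add: lp_objective_def extremal_coeff_def power2_eq_square field_simps)

definition extremal_kernel :: "real^'n \<Rightarrow> real^'n \<Rightarrow> real" where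
  "extremal_kernel x y = poly ([:- p / ((1 - p) * sphere_area n):]
     + smult (1 / ((1 - p) * sphere_area n)) (P k)) (x \<bullet> y)"

lemma theta_feasible_extremal: "theta_feasible t extremal_kernel"
  unfolding theta_feasible_def
proof (intro conjI ballI impI)
  let ?\<omega> = "sphere_area n"
  let ?a = "- p / ((1 - p) * ?\<omega>)" and ?b = "1 / ((1 - p) * ?\<omega>)"
  note \<omega> = sphere_area_n_pos
  have ab: "0 \<le> ?a" "0 \<le> ?b" using p \<omega> by (simp_all add: divide_nonpos_pos)
  have K: "extremal_kernel x y = ?a + ?b * poly (P k) (x \<bullet> y)" for x y
    by (simp add: extremal_kernel_def)
  show "continuous_on (sphere 0 1 \<times> sphere 0 1) (\<lambda>(x, y). extremal_kernel x y)"
    unfolding extremal_kernel_def case_prod_beta by (intro continuous_intros)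
  show "positive_kernel_on (sphere 0 1) extremal_kernel"
    unfolding positive_kernel_on_def
  proof (intro allI impI)
    fix N :: nat and x :: "nat \<Rightarrow> real^'n" and c :: "nat \<Rightarrow> real"
    assume x: "\<forall>i<N. x i \<in> sphere 0 1"
    have "(\<Sum>i<N. \<Sum>j<N. c i * c j * extremal_kernel (x i) (x j))
        = (\<Sum>i<N. \<Sum>j<N. c i * c j * ?a) + ?b * (\<Sum>i<N. \<Sum>j<N. c i * c j * poly (P k) (x i \<bullet> x j))"
      unfolding K sum_distrib_left sum.distrib[symmetric] by (intro sum.cong refl) (simp only: distrib_left mult_ac)
    also have "\<dots> \<ge> 0"
      using positive_kernel_const[OF ab(1), of "sphere 0 1 :: (real^'n) set"] positive_kernel_jacobi[of k] x ab(2)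
      unfolding positive_kernel_on_def by (intro add_nonneg_nonneg mult_nonneg_nonneg) blast+
    finally show "0 \<le> (\<Sum>i<N. \<Sum>j<N. c i * c j * extremal_kernel (x i) (x j))" .
  qed
  have "(LINT x|surface_measure. extremal_kernel x x) = (LINT x|(surface_measure :: (real^'n) measure). ?a + ?b)"
    by (rule Bochner_Integration.integral_cong[OF refl])
       (simp add: K space_surface_measure norm_eq_1 jacobi_at_1[OF ultraspherical_alpha])
  also have "\<dots> = (?a + ?b) * ?\<omega>"
    using measure_surface_measure_space[where 'a = "real^'n"] n by simp
  also have "\<dots> = 1" using p \<omega> by (simp add: field_simps)
  finally show "(LINT x|surface_measure. extremal_kernel x x) = 1" .
  show "extremal_kernel x y = extremal_kernel y x" for x y by (simp add: K inner_commute)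
  show "extremal_kernel x y = 0" if "x \<bullet> y = t" for x y
    using that p \<omega> by (simp add: K)
qed

text \<open>As \<open>k\<close> is positive, \<open>P k\<close> has mean 0, so only the constant
  part contributes.\<close>

lemma double_integral_extremal: "double_integral extremal_kernel = sphere_area n * (p / (p - 1))"
proof -
  have "gmean \<alpha> (P k) = 0"
    using jacobi_orth[OF ultraspherical_alpha, of k 0] k_pos by (simp add: jacobi_0[OF ultraspherical_alpha])
  moreover have "gmean \<alpha> [:c:] = c" for c
    using gmean_smult[OF ultraspherical_alpha, of c 1] gmean_1[OF ultraspherical_alpha] by simp
  ultimately show ?thesis
    unfolding extremal_kernel_def double_integral_poly_inner gmean_simps
    using p sphere_area_n_pos by (simp add: power2_eq_square field_simps)
qed

end

text \<open>The value p / (p - 1) is continuous at \<open>m\<close>, so it suffices to realise it at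
  negative Jacobi values approaching the infimum. This covers an infimum that is not
  attained.\<close>

lemma le_of_jacobi_values:
  fixes S :: ereal
  assumes t: "-1 < t" "t < 1" and m: "m = (INF k. poly (P k) t)"
    and le: "\<And>k. poly (P k) t < 0 \<Longrightarrow>
      ereal (sphere_area n * (poly (P k) t / (poly (P k) t - 1))) \<le> S"
    and bdd: "bdd_below (range (\<lambda>k. poly (P k) t))" and neg: "m < 0"
  shows "ereal (sphere_area n * (m / (m - 1))) \<le> S"
proof -
  \<comment> \<open>The minimum with 0 keeps the chosen values negative, as \<open>le\<close>
    demands, while they tend to \<open>m\<close>.\<close>
  have "\<exists>k. poly (P k) t < min 0 (m + 1 / real (Suc j))" for j
    using neg cINF_less_iff[OF _ bdd, of "min 0 (m + 1 / real (Suc j))"] unfolding m by simp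
  then obtain \<kappa> where \<kappa>: "\<And>j. poly (P (\<kappa> j)) t < min 0 (m + 1 / real (Suc j))" by metis
  have "(\<lambda>j. poly (P (\<kappa> j)) t) \<longlonglongrightarrow> m"
  proof (rule tendsto_sandwich)
    show "\<forall>\<^sub>F j in sequentially. m \<le> poly (P (\<kappa> j)) t"
      unfolding m by (intro always_eventually allI cINF_lower bdd) simp
    show "\<forall>\<^sub>F j in sequentially. poly (P (\<kappa> j)) t \<le> m + 1 / real (Suc j)"
      using \<kappa> by (intro always_eventually allI) (simp add: less_imp_le)
    show "(\<lambda>j. m + 1 / real (Suc j)) \<longlonglongrightarrow> m"
      using tendsto_add[OF tendsto_const[of m] lim_1_over_n[THEN LIMSEQ_Suc]] by simp
  qed simp
  then have "(\<lambda>j. sphere_area n * (poly (P (\<kappa> j)) t / (poly (P (\<kappa> j)) t - 1)))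
      \<longlonglongrightarrow> sphere_area n * (m / (m - 1))"
    using neg by (intro tendsto_intros) auto
  then have "(\<lambda>j. ereal (sphere_area n * (poly (P (\<kappa> j)) t / (poly (P (\<kappa> j)) t - 1))))
      \<longlonglongrightarrow> ereal (sphere_area n * (m / (m - 1)))"
    by (rule tendsto_ereal)
  then show ?thesis
    by (rule LIMSEQ_le_const2) (use \<kappa> le in auto)
qed

lemma lp_and_theta_value:
  assumes t: "-1 < t" "t < 1" and m: "m = (INF k. poly (P k) t)"
  shows "(\<forall>k. m \<le> poly (P k) t) \<and>
         (n \<ge> 3 \<or> arccos t / pi \<in> \<rat> \<longrightarrow>
            (\<exists>k. poly (P k) t = m) \<and>
            (\<exists>f. lp_feasible n t f \<and> lp_objective n f = sphere_area n * (m / (m - 1)))) \<and>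
         lp_value n t = ereal (sphere_area n * (m / (m - 1))) \<and>
         theta_sphere TYPE(real ^ 'n) t = lp_value n t"
proof -
  have t': "t \<in> {-1..1}" using t by simp
  have bdd: "bdd_below (range (\<lambda>k. poly (P k) t))"
  proof (rule bdd_belowI2)
    show "- 1 \<le> poly (P k) t" for k using abs_jacobi_le_1[OF t', of k] by linarith
  qed
  have lower: "m \<le> poly (P k) t" for k unfolding m by (rule cINF_lower[OF bdd]) simp
  obtain k0 where k0: "poly (P k0) t < 0" using ex_jacobi_neg[OF t] by blast
  then have neg: "m < 0" using lower[of k0] by linarith
  let ?V = "\<lambda>p. sphere_area n * (p / (p - 1))"
  have attained: "\<exists>k. poly (P k) t = m" if "n \<ge> 3 \<or> arccos t / pi \<in> \<rat>"
  proof -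
    have "\<exists>k. \<forall>j. poly (P k) t \<le> poly (P j) t"
    proof (cases "n = 2")
      case True
      then have fin: "finite (range (\<lambda>k. poly (P k) t))" using that t by (intro finite_range_jacobi) auto
      then have "Min (range (\<lambda>k. poly (P k) t)) \<in> range (\<lambda>k. poly (P k) t)" by (intro Min_in) auto
      then obtain k where "Min (range (\<lambda>k. poly (P k) t)) = poly (P k) t" by blast
      then show ?thesis using Min_le[OF fin] by (metis rangeI)
    next
      case False
      then have "(\<lambda>k. poly (P k) t) \<longlonglongrightarrow> 0" using n2 t by (intro jacobi_tendsto_0) auto
      then have "\<forall>\<^sub>F k in sequentially. poly (P k0) t < poly (P k) t" by (rule order_tendstoD) (rule k0)
      then obtain N where N: "\<And>k. k \<ge> N \<Longrightarrow> poly (P k0) t < poly (P k) t"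
        unfolding eventually_sequentially by blast
      \<comment> \<open>From \<open>N\<close> on all values exceed the negative value at
        \<open>k0\<close>. Since the segment contains \<open>k0\<close>, its minimum is
        global.\<close>
      define I where "I = {..max N k0}"
      obtain k where k: "k \<in> I" "\<And>j. j \<in> I \<Longrightarrow> poly (P k) t \<le> poly (P j) t"
        using arg_min_least[of I _ "\<lambda>k. poly (P k) t"] arg_min_if_finite(1)[of I "\<lambda>k. poly (P k) t"]
        by (metis I_def atMost_iff empty_iff finite_atMost max.cobounded1)
      have "poly (P k) t \<le> poly (P j) t" for j
      proof (cases "j \<in> I")
        case False
        then have "poly (P k0) t < poly (P j) t" by (intro N) (simp add: I_def)
        moreover have "poly (P k) t \<le> poly (P k0) t" by (rule k(2)) (simp add: I_def)
        ultimately show ?thesis by linarith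
      qed (rule k(2))
      then show ?thesis by blast
    qed
    then obtain k where k: "\<And>j. poly (P k) t \<le> poly (P j) t" by blast
    have "poly (P k) t \<le> m" unfolding m by (rule cINF_greatest) (simp_all add: k)
    then show ?thesis using lower[of k] by (intro exI[of _ k]) simp
  qed
  have lp: "lp_value n t = ereal (?V m)"
  proof (rule antisym)
    show "lp_value n t \<le> ereal (?V m)"
      unfolding lp_value_def by (rule SUP_least) (use lp_upper_bound[OF _ lower neg] in simp)
    show "ereal (?V m) \<le> lp_value n t"
    proof (rule le_of_jacobi_values[OF t m _ bdd neg])
      fix k assume k: "poly (P k) t < 0"
      show "ereal (?V (poly (P k) t)) \<le> lp_value n t"
        unfolding lp_value_def lp_objective_extremal[OF refl k, symmetric]
        by (rule SUP_upper) (simp add: lp_feasible_extremal[OF refl k])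
    qed
  qed
  have theta: "theta_sphere TYPE(real ^ 'n) t = ereal (?V m)"
  proof (rule antisym)
    show "theta_sphere TYPE(real ^ 'n) t \<le> ereal (?V m)"
      unfolding theta_sphere_def
    proof (rule SUP_least)
      fix K :: "real^'n \<Rightarrow> real^'n \<Rightarrow> real" assume "K \<in> {K. theta_feasible t K}"
      then have K: "theta_feasible t K" by simp
      have "(1 - m) * double_integral K \<le> - m * sphere_area n"
        by (rule kernel_upper_bound[OF t' _ _ _ _ lower])
           (use K in \<open>simp_all add: theta_feasible_def kernel_continuous_def case_prod_beta'\<close>)
      then have "double_integral K \<le> (- m * sphere_area n) / (1 - m)"
        using neg by (subst pos_le_divide_eq) (simp_all add: mult.commute)
      also have "\<dots> = ?V m" using neg by (simp add: field_simps)
      finally show "ereal (LINT x|surface_measure. LINT y|surface_measure. K x y) \<le> ereal (?V m)"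
        by (simp add: double_integral_def)
    qed
    show "ereal (?V m) \<le> theta_sphere TYPE(real ^ 'n) t"
    proof (rule le_of_jacobi_values[OF t m _ bdd neg])
      fix k assume k: "poly (P k) t < 0"
      show "ereal (?V (poly (P k) t)) \<le> theta_sphere TYPE(real ^ 'n) t"
        unfolding theta_sphere_def double_integral_extremal[OF refl k, symmetric] double_integral_def
        by (rule SUP_upper) (simp add: theta_feasible_extremal[OF refl k])
    qed
  qed
  have "\<exists>f. lp_feasible n t f \<and> lp_objective n f = ?V m" if "poly (P k) t = m" for k
    using lp_feasible_extremal[OF that neg] lp_objective_extremal[OF that neg] by blast
  then show ?thesis using lower attained lp theta by auto
qed

end

theorem theorem6p2:
  fixes n :: nat and \<alpha> t m :: real
  assumes "n = CARD('n::finite)" and "n \<ge> 2" and "\<alpha> = (real n - 3) / 2"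
    and "-1 < t" and "t < 1"
    and "m = (INF k. poly (jacobi_poly \<alpha> \<alpha> k) t)"
  shows "(\<forall>k. m \<le> poly (jacobi_poly \<alpha> \<alpha> k) t) \<and>
         (n \<ge> 3 \<or> arccos t / pi \<in> \<rat> \<longrightarrow>
            (\<exists>k. poly (jacobi_poly \<alpha> \<alpha> k) t = m) \<and>
            (\<exists>f. lp_feasible n t f \<and> lp_objective n f = sphere_area n * (m / (m - 1)))) \<and>
         lp_value n t = ereal (sphere_area n * (m / (m - 1))) \<and>
         theta_sphere TYPE(real ^ 'n) t = lp_value n t"
proof -
  interpret ultraspherical n \<alpha> "TYPE('n)"
    using assms by unfold_locales
  show ?thesis using assms by (intro lp_and_theta_value)
qed

end
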